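(* Let $M$ be a connected complex manifold of complex dimension $n$. Then the following hold: (i) $\mathcal{E}xt(M)\cap \mathcal{KRS}(M)\cap \mathcal{R}ad(M)=\mathcal{KE}(M)\cap \mathcal{R}ad(M)$; (ii) $\mathcal{C}_k(M)\cap \mathcal{C}_h(M)\cap \mathcal{R}ad(M)=\mathcal{KE}(M)\cap \mathcal{R}ad(M)$ for all $h,k$ with $1\le h,k\le n$ and $h\neq k$; (iii) $\mathcal{C}_k(M)\cap \mathcal{E}xt(M)\cap \mathcal{R}ad(M)=\mathcal{KE}(M)\cap \mathcal{R}ad(M)$ for all $k$ with $1<k\le n$; (iv) $\mathcal{C}_k(M)\cap \mathcal{KRS}(M)\cap \mathcal{R}ad(M)=\mathcal{KE}(M)\cap \mathcal{R}ad(M)$ for all $k$ with $1\le k\le n$.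
   Context: For a complex manifold $M$ of complex dimension $n$ and a Kähler metric $g$ on $M$, let $\omega$ denote the Kähler form and $\rho$ the Ricci form of $g$; in local holomorphic coordinates $g$ has components $g_{i\bar j}$, and its Ricci tensor has components $\mathrm{Ric}_{i\bar j}=-\frac{\partial^2}{\partial z_i\partial\bar z_j}\log\det(g_{k\bar l})$. - $\mathcal{KE}(M)$ is the set of Kähler-Einstein metrics on $M$, i.e. Kähler metrics with $\rho=\lambda\omega$ for some constant $\lambda\in\mathbb{R}$. - $\mathcal{E}xt(M)$ is the set of extremal metrics (in the sense of Calabi) on $M$: Kähler metrics such that the $(1,0)$-part of the Hamiltonian vector field associated to the scalar curvature is holomorphic. - A Kähler-Ricci soliton (KRS) on $M$ is a pair $(g,X)$ consisting of a Kähler metric $g$ and a holomorphic vector field $X$ such that $\rho=\lambda\omega+L_X\omega$ for some $\lambda\in\mathbb{R}$, where $L_X\omega$ is the Lie derivative of $\omega$ along $X$. $\mathcal{KRS}(M)$ is the set of Kähler metrics $g$ on $M$ such that $(g,X)$ is a KRS for some holomorphic vector field $X$. - For $1\le k\le n$, the $k$-generalized scalar curvature $\rho_k(g)$ of a Kähler metric $g$ is the function on $M$ defined by $$\frac{\det\left(g_{i\bar j}+s\,\mathrm{Ric}_{i\bar j}\right)}{\det(g_{i\bar j})}=1+\sum_{k=1}^n\rho_k(g)s^k$$ (so $\rho_1(g)$ is the scalar curvature). $\mathcal{C}_k(M)$ is the set of Kähler metrics $g$ on $M$ such that $\rho_k(g)$ is constant. - $\mathcal{R}ad(M)$ is the set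 of radial Kähler metrics on $M$: $M$ is connected and equipped with complex coordinates $z_1,\dots,z_n$, and $g$ admits a global Kähler potential depending only on $r=|z|^2=|z_1|^2+\cdots+|z_n|^2$, i.e. there is a smooth function $f:(r_{\inf},r_{\sup})\to\mathbb{R}$, $0\le r_{\inf}<r_{\sup}\le\infty$ (with $(r_{\inf},r_{\sup})$ the maximal domain where $f(r)$ is defined), such that $\omega=\frac{i}{2}\partial\bar\partial f(r)$. *)

theory Defs
  imports "HOL-Analysis.Analysis" "HOL-Computational_Algebra.Polynomial"
begin

primrec Ck_on :: "nat \<Rightarrow> 'a::real_normed_vector set \<Rightarrow> ('a \<Rightarrow> 'b::real_normed_vector) \<Rightarrow> bool" where
  "Ck_on 0 S f \<longleftrightarrow> continuous_on S f"
| "Ck_on (Suc k) S f \<longleftrightarrow>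
     (\<forall>x\<in>S. f differentiable (at x)) \<and> (\<forall>v. Ck_on k S (\<lambda>x. frechet_derivative f (at x) v))"

text \<open>Only meant for open \<open>S\<close>.\<close>
definition smooth_on :: "'a::real_normed_vector set \<Rightarrow> ('a \<Rightarrow> 'b::real_normed_vector) \<Rightarrow> bool" where
  "smooth_on S f \<longleftrightarrow> (\<forall>k. Ck_on k S f)"

text \<open>Holomorphic map between complex coordinate spaces: real differentiable with
  complex linear differential.  Only meant for open \<open>S\<close>.\<close>
definition holo_map_on :: "(complex^'a) set \<Rightarrow> (complex^'a \<Rightarrow> complex^'b) \<Rightarrow> bool" where
  "holo_map_on S F \<longleftrightarrow>
     (\<forall>x\<in>S. \<exists>D. (F has_derivative D) (at x) \<and> Vector_Spaces.linear (*s) (*s) D)"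

text \<open>Wirtinger derivatives with respect to \<open>z\<^sub>j\<close> and its conjugate; \<open>axis j 1\<close> and \<open>axis j \<i>\<close>
  are the real coordinate directions \<open>x\<^sub>j\<close> and \<open>y\<^sub>j\<close>, where \<open>z\<^sub>j = x\<^sub>j + \<i> y\<^sub>j\<close>.\<close>
definition dz :: "'n \<Rightarrow> (complex^'n \<Rightarrow> complex) \<Rightarrow> complex^'n \<Rightarrow> complex" where
  "dz j F x = (frechet_derivative F (at x) (axis j 1)
                 - \<i> * frechet_derivative F (at x) (axis j \<i>)) / 2"

definition dzbar :: "'n \<Rightarrow> (complex^'n \<Rightarrow> complex) \<Rightarrow> complex^'n \<Rightarrow> complex" where
  "dzbar j F x = (frechet_derivative F (at x) (axis j 1)
                    + \<i> * frechet_derivative F (at x) (axis j \<i>)) / 2"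

text \<open>Coefficients of \<open>\<partial>\<partial>\<close>-bar \<open>F\<close> with respect to the forms \<open>dz\<^sub>i \<and> dz\<close>-bar\<open>\<^sub>j\<close>.\<close>
definition ddbar :: "(complex^'n \<Rightarrow> complex) \<Rightarrow> complex^'n \<Rightarrow> complex^'n^'n" where
  "ddbar F x = (\<chi> i j. dz i (dzbar j F) x)"

text \<open>A chart is a domain together with a coordinate map; the values of the coordinate map
  outside the domain are irrelevant.\<close>
type_synonym ('m, 'n) chart = "'m set \<times> ('m \<Rightarrow> complex^'n)"

definition cimage :: "('m, 'n::finite) chart \<Rightarrow> (complex^'n) set" where
  "cimage c = snd c ` fst c"

definition is_chart :: "'m topology \<Rightarrow> ('m, 'n::finite) chart \<Rightarrow> bool" where
  "is_chart M c \<longleftrightarrow> openin M (fst c) \<and> open (cimage c) \<and>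
     homeomorphic_map (subtopology M (fst c)) (top_of_set (cimage c)) (snd c)"

definition transition ::
    "('m, 'n::finite) chart \<Rightarrow> ('m, 'n) chart \<Rightarrow> complex^'n \<Rightarrow> complex^'n" where
  "transition c d = snd d \<circ> inv_into (fst c) (snd c)"

definition compatible :: "('m, 'n::finite) chart \<Rightarrow> ('m, 'n) chart \<Rightarrow> bool" where
  "compatible c d \<longleftrightarrow>
     holo_map_on (snd c ` (fst c \<inter> fst d)) (transition c d) \<and>
     holo_map_on (snd d ` (fst c \<inter> fst d)) (transition d c)"

text \<open>\<open>M\<close> with the holomorphic atlas \<open>A\<close> is a complex manifold of dimension \<open>CARD('n)\<close>.\<close>
definition complex_manifold :: "'m topology \<Rightarrow> ('m, 'n::finite) chart set \<Rightarrow> bool" where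
  "complex_manifold M A \<longleftrightarrow> Hausdorff_space M \<and> second_countable M \<and>
     (\<forall>c\<in>A. is_chart M c) \<and> (\<Union>c\<in>A. fst c) = topspace M \<and>
     (\<forall>c\<in>A. \<forall>d\<in>A. compatible c d)"

text \<open>The maximal atlas, i.e. all local holomorphic coordinate systems of the manifold.\<close>
definition charts :: "'m topology \<Rightarrow> ('m, 'n::finite) chart set \<Rightarrow> ('m, 'n) chart set" where
  "charts M A = {c. is_chart M c \<and> (\<forall>d\<in>A. compatible c d)}"

text \<open>Tensor fields are families of component functions, one for every chart \<open>c\<close> of the maximal
  atlas, defined on \<open>cimage c\<close> and subject to the transformation law.  In a chart, the real
  tangent space is identified with \<open>\<complex>\<^sup>n\<close>: the vector \<open>v\<close> stands for the sum of
  \<open>Re v\<^sub>j \<partial>/\<partial>x\<^sub>j + Im v\<^sub>j \<partial>/\<partial>y\<^sub>j\<close>, whose (1,0)-part is the sum of \<open>v\<^sub>j \<partial>/\<partial>z\<^sub>j\<close>.\<close>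

type_synonym ('m, 'n) herm_tensor = "('m, 'n) chart \<Rightarrow> complex^'n \<Rightarrow> complex^'n^'n"
type_synonym ('m, 'n) vec_field = "('m, 'n) chart \<Rightarrow> complex^'n \<Rightarrow> complex^'n"

definition sesq :: "complex^'n^'n \<Rightarrow> complex^'n \<Rightarrow> complex^'n \<Rightarrow> complex" where
  "sesq h v w = (\<Sum>i\<in>UNIV. \<Sum>j\<in>UNIV. h $ i $ j * v $ i * cnj (w $ j))"

text \<open>The form \<open>\<i>/2\<close> times the sum of \<open>h\<^sub>i\<^sub>j dz\<^sub>i \<and> dz\<close>-bar\<open>\<^sub>j\<close>, evaluated at \<open>(v, w)\<close>.\<close>
definition form11 :: "complex^'n^'n \<Rightarrow> complex^'n \<Rightarrow> complex^'n \<Rightarrow> complex" where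
  "form11 h v w =
     \<i> / 2 * (\<Sum>i\<in>UNIV. \<Sum>j\<in>UNIV. h $ i $ j * (v $ i * cnj (w $ j) - w $ i * cnj (v $ j)))"

text \<open>Exterior and Lie derivative of a 2-form \<open>\<eta>\<close> on an open subset of \<open>\<complex>\<^sup>n\<close>; the vectors
  \<open>u, v, w\<close> are extended to constant vector fields, so the bracket terms of the
  coordinate-free formula for the exterior derivative vanish.\<close>
definition dform :: "(complex^'n \<Rightarrow> complex^'n \<Rightarrow> complex^'n \<Rightarrow> complex) \<Rightarrow>
    complex^'n \<Rightarrow> complex^'n \<Rightarrow> complex^'n \<Rightarrow> complex^'n \<Rightarrow> complex" where
  "dform \<eta> x u v w =
     frechet_derivative (\<lambda>y. \<eta> y v w) (at x) u
     - frechet_derivative (\<lambda>y. \<eta> y u w) (at x) v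
     + frechet_derivative (\<lambda>y. \<eta> y u v) (at x) w"

definition lie_form :: "(complex^'n \<Rightarrow> complex^'n) \<Rightarrow>
    (complex^'n \<Rightarrow> complex^'n \<Rightarrow> complex^'n \<Rightarrow> complex) \<Rightarrow>
    complex^'n \<Rightarrow> complex^'n \<Rightarrow> complex^'n \<Rightarrow> complex" where
  "lie_form X \<eta> x v w =
     frechet_derivative (\<lambda>y. \<eta> y v w) (at x) (X x)
     + \<eta> x (frechet_derivative X (at x) v) w
     + \<eta> x v (frechet_derivative X (at x) w)"

definition vector_field ::
    "'m topology \<Rightarrow> ('m, 'n::finite) chart set \<Rightarrow> ('m, 'n) vec_field \<Rightarrow> bool" where
  "vector_field M A X \<longleftrightarrow>
     (\<forall>c\<in>charts M A. \<forall>d\<in>charts M A. \<forall>x\<in>snd c ` (fst c \<inter> fst d).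
        X d (transition c d x) = frechet_derivative (transition c d) (at x) (X c x))"

text \<open>A real vector field whose (1,0)-part is a holomorphic section.\<close>
definition holomorphic_field ::
    "'m topology \<Rightarrow> ('m, 'n::finite) chart set \<Rightarrow> ('m, 'n) vec_field \<Rightarrow> bool" where
  "holomorphic_field M A X \<longleftrightarrow>
     vector_field M A X \<and> (\<forall>c\<in>charts M A. holo_map_on (cimage c) (X c))"

text \<open>\<open>g c x $ i $ j\<close> is the component of \<open>g\<close> with holomorphic index \<open>i\<close> and antiholomorphic
  index \<open>j\<close>.  The form is normalised so that \<open>\<omega> = \<i>/2 \<partial>\<partial>\<close>-bar \<open>\<Phi>\<close> means that the components
  of \<open>g\<close> are the mixed second derivatives of \<open>\<Phi>\<close>.\<close>

definition kaehler_form ::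
    "('m, 'n::finite) herm_tensor \<Rightarrow> ('m, 'n) chart \<Rightarrow>
     complex^'n \<Rightarrow> complex^'n \<Rightarrow> complex^'n \<Rightarrow> complex" where
  "kaehler_form g c x = form11 (g c x)"

definition kaehler_metric ::
    "'m topology \<Rightarrow> ('m, 'n::finite) chart set \<Rightarrow> ('m, 'n) herm_tensor \<Rightarrow> bool" where
  "kaehler_metric M A g \<longleftrightarrow>
     (\<forall>c\<in>charts M A.
        (\<forall>i j. smooth_on (cimage c) (\<lambda>x. g c x $ i $ j)) \<and>
        (\<forall>x\<in>cimage c.
           (\<forall>i j. g c x $ j $ i = cnj (g c x $ i $ j)) \<and>
           (\<forall>v. v \<noteq> 0 \<longrightarrow> 0 < Re (sesq (g c x) v v)) \<and>
           (\<forall>u v w. dform (kaehler_form g c) x u v w = 0))) \<and>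
     (\<forall>c\<in>charts M A. \<forall>d\<in>charts M A. \<forall>x\<in>snd c ` (fst c \<inter> fst d). \<forall>v w.
        sesq (g c x) v w =
        sesq (g d (transition c d x))
          (frechet_derivative (transition c d) (at x) v)
          (frechet_derivative (transition c d) (at x) w))"

text \<open>For a Kaehler metric the determinant is a positive real, so \<open>Re\<close> is only a coercion.\<close>
definition ricci ::
    "('m, 'n::finite) herm_tensor \<Rightarrow> ('m, 'n) herm_tensor" where
  "ricci g c x = - ddbar (\<lambda>y. complex_of_real (ln (Re (det (g c y))))) x"

text \<open>The Ricci form is obtained from the Ricci tensor as \<open>\<omega>\<close> is from \<open>g\<close>.  Another constant
  normalisation only rescales the Einstein constant and the soliton field below.\<close>
definition ricci_form ::
    "('m, 'n::finite) herm_tensor \<Rightarrow> ('m, 'n) chart \<Rightarrow>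
     complex^'n \<Rightarrow> complex^'n \<Rightarrow> complex^'n \<Rightarrow> complex" where
  "ricci_form g c x = form11 (ricci g c x)"

text \<open>The coefficient of \<open>s\<^sup>k\<close> in \<open>det (g + s Ric) / det g\<close>, where the determinant in the
  numerator is that of a matrix with entries in \<open>\<complex>[s]\<close>.  It is real and independent of the
  chart, hence a function on the manifold.\<close>
definition gen_scal_loc ::
    "('m, 'n::finite) herm_tensor \<Rightarrow> nat \<Rightarrow> ('m, 'n) chart \<Rightarrow> complex^'n \<Rightarrow> complex" where
  "gen_scal_loc g k c x =
     coeff (det (\<chi> i j. [: g c x $ i $ j, ricci g c x $ i $ j :])) k / det (g c x)"

definition gen_scal ::
    "'m topology \<Rightarrow> ('m, 'n::finite) chart set \<Rightarrow> ('m, 'n) herm_tensor \<Rightarrow> nat \<Rightarrow> 'm \<Rightarrow> real" where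
  "gen_scal M A g k p =
     (let c = (SOME c. c \<in> charts M A \<and> p \<in> fst c) in Re (gen_scal_loc g k c (snd c p)))"

abbreviation scal ::
    "'m topology \<Rightarrow> ('m, 'n::finite) chart set \<Rightarrow> ('m, 'n) herm_tensor \<Rightarrow> 'm \<Rightarrow> real" where
  "scal M A g \<equiv> gen_scal M A g 1"

definition hamiltonian_field ::
    "'m topology \<Rightarrow> ('m, 'n::finite) chart set \<Rightarrow> ('m, 'n) herm_tensor \<Rightarrow> ('m \<Rightarrow> real) \<Rightarrow>
     ('m, 'n) vec_field \<Rightarrow> bool" where
  "hamiltonian_field M A g u X \<longleftrightarrow> vector_field M A X \<and>
     (\<forall>c\<in>charts M A. \<forall>x\<in>cimage c. \<forall>v.
        kaehler_form g c x (X c x) v =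
        complex_of_real (frechet_derivative (u \<circ> inv_into (fst c) (snd c)) (at x) v))"

definition KE ::
    "'m topology \<Rightarrow> ('m, 'n::finite) chart set \<Rightarrow> ('m, 'n) herm_tensor set" where
  "KE M A = {g. kaehler_metric M A g \<and>
     (\<exists>l::real. \<forall>c\<in>charts M A. \<forall>x\<in>cimage c. \<forall>v w.
        ricci_form g c x v w = complex_of_real l * kaehler_form g c x v w)}"

definition Extremal ::
    "'m topology \<Rightarrow> ('m, 'n::finite) chart set \<Rightarrow> ('m, 'n) herm_tensor set" where
  "Extremal M A = {g. kaehler_metric M A g \<and>
     (\<exists>X. hamiltonian_field M A g (scal M A g) X \<and> holomorphic_field M A X)}"

definition kaehler_ricci_soliton ::
    "'m topology \<Rightarrow> ('m, 'n::finite) chart set \<Rightarrow> ('m, 'n) herm_tensor \<Rightarrow>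
     ('m, 'n) vec_field \<Rightarrow> bool" where
  "kaehler_ricci_soliton M A g X \<longleftrightarrow> kaehler_metric M A g \<and> holomorphic_field M A X \<and>
     (\<exists>l::real. \<forall>c\<in>charts M A. \<forall>x\<in>cimage c. \<forall>v w.
        ricci_form g c x v w =
        complex_of_real l * kaehler_form g c x v w
        + lie_form (X c) (kaehler_form g c) x v w)"

definition KRS ::
    "'m topology \<Rightarrow> ('m, 'n::finite) chart set \<Rightarrow> ('m, 'n) herm_tensor set" where
  "KRS M A = {g. \<exists>X. kaehler_ricci_soliton M A g X}"

definition ConstScal ::
    "'m topology \<Rightarrow> ('m, 'n::finite) chart set \<Rightarrow> nat \<Rightarrow> ('m, 'n) herm_tensor set" where
  "ConstScal M A k = {g. kaehler_metric M A g \<and>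
     (\<exists>a. \<forall>p\<in>topspace M. gen_scal M A g k p = a)}"

text \<open>Radial metrics: \<open>(topspace M, z)\<close> is a global holomorphic coordinate system.  The origin,
  where \<open>r = 0\<close> is an end point of the open interval on which \<open>f\<close> is smooth, may belong to the
  coordinate domain as long as \<open>f(|z|\<^sup>2)\<close> is smooth there as well (for example, the flat
  metric on \<open>\<complex>\<^sup>n\<close> is radial).\<close>
definition Radial ::
    "'m topology \<Rightarrow> ('m, 'n::finite) chart set \<Rightarrow> ('m, 'n) herm_tensor set" where
  "Radial M A = {g. kaehler_metric M A g \<and> connected_space M \<and>
     (\<exists>z (f :: real \<Rightarrow> real) (rinf :: ereal) (rsup :: ereal).
        (topspace M, z) \<in> charts M A \<and>
        0 \<le> rinf \<and> rinf < rsup \<and> smooth_on (einterval rinf rsup) f \<and>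
        (\<forall>p\<in>topspace M. (norm (z p))\<^sup>2 \<in> einterval rinf rsup \<or> (z p = 0 \<and> rinf = 0)) \<and>
        smooth_on (z ` topspace M) (\<lambda>x. f ((norm x)\<^sup>2)) \<and>
        (\<forall>x\<in>z ` topspace M. \<forall>v w.
           kaehler_form g (topspace M, z) x v w =
           form11 (ddbar (\<lambda>y. complex_of_real (f ((norm y)\<^sup>2))) x) v w))}"

end

theory Submission imports Defs "HOL-Complex_Analysis.Complex_Analysis" begin

no_notation fps_nth (infixl "$" 75)

text \<open>
  Write \<open>t = ln r\<close>, \<open>y = r f'(r)\<close> and let a dot be \<open>d/dt\<close>.  With respect to the
  Euclidean metric, \<open>g\<close> has the eigenvalues \<open>y/r\<close> (with multiplicity \<open>n - 1\<close>) and \<open>y\<close>-dot\<open>/r\<close>; the Ricci tensor has the same shape with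
  \<open>\<sigma> = n - (n - 1) y\<close>-dot\<open>/y - y\<close>-double-dot\<open>/y\<close>-dot in place of \<open>y\<close>.  Hence \<open>\<rho>\<^sub>k\<close> is, up to a factor, the derivative of
  \<open>\<sigma>\<^sup>k y\<^sup>n\<^sup>-\<^sup>k\<close> with respect to \<open>y\<^sup>n\<close>, and it is constant iff \<open>\<sigma>\<^sup>k y\<^sup>n\<^sup>-\<^sup>k = c y\<^sup>n + d\<close>; the metric is
  Einstein iff \<open>d = 0\<close> (\<open>n \<ge> 2\<close>).  A holomorphic Hamiltonian field forces the scalar curvature to be affine in \<open>y\<close>.  For a
  soliton with an arbitrary holomorphic field \<open>X\<close>, the radial component of \<open>X\<close> is harmonic on the complex lines through the
  origin; either it depends on \<open>r\<close> only, or comparing two lines gives a second equation, and in both cases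
  \<open>\<sigma> = l y + \<mu> y\<close>-dot or \<open>\<sigma> = l y + e\<close> on some interval (with a further family if \<open>n = 1\<close>).  Two of the conditions together are polynomial
  identities in \<open>y\<close>, which takes infinitely many values, and comparing coefficients gives \<open>\<sigma> = l y\<close>.
\<close>

section \<open>Holomorphic functions of several variables\<close>

text \<open>Two obstacles shape the details. \<open>holo_map_on\<close> asks for a complex linear
  differential at each point and nothing about its continuity, while comparing Ricci forms in two
  charts differentiates Jacobians; so smoothness of holomorphic maps has to be won first, by Cauchy
  estimates on complex lines. Secondly, the coordinate image of \<open>M\<close> is an arbitrary
  connected open set. It need not be invariant under rotations, so a soliton field cannot be
  averaged into a radial one. What survives is local: a curve \<open>exp w *s a\<close> shifts
  \<open>t\<close> by \<open>2 * Re w\<close>, and the functions of \<open>w\<close> built from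
  \<open>X\<close> are holomorphic. The shape of \<open>\<sigma>\<close> found in this way is known
  on some interval only. That is enough: it serves to determine the coefficients of a first integral
  of the other condition, and that integral holds for all \<open>t\<close>. In dimension one there
  is no tangential eigenvalue, so \<open>y\<close> has no known sign and \<open>\<sigma>\<close> may
  be off by a constant; this is behind the recurring case \<open>n = 1\<close>. The origin, when it
  belongs to the domain, is reached by continuity at the end.\<close>

definition clin_on :: "(complex^'n) set \<Rightarrow> (complex^'n \<Rightarrow> complex) \<Rightarrow> bool" where
  "clin_on S F \<longleftrightarrow>
     (\<forall>x\<in>S. \<exists>D. (F has_derivative D) (at x) \<and> (\<forall>c v. D (c *s v) = c * D v))"

lemma clin_onD:
  assumes "clin_on S F" "x \<in> S"
  shows "(F has_derivative frechet_derivative F (at x)) (at x)"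
    and "frechet_derivative F (at x) (c *s v) = c * frechet_derivative F (at x) v"
proof -
  from assms obtain D where D: "(F has_derivative D) (at x)" "\<And>c v. D (c *s v) = c * D v"
    unfolding clin_on_def by blast
  moreover have "D = frechet_derivative F (at x)"
    by (rule frechet_derivative_at[OF D(1)])
  ultimately show "(F has_derivative frechet_derivative F (at x)) (at x)"
    "frechet_derivative F (at x) (c *s v) = c * frechet_derivative F (at x) v" by auto
qed

lemma norm_vector_smult: "norm (c *s v) = cmod c * norm (v :: complex^'n)"
  by (simp add: norm_vec_def norm_mult L2_set_right_distrib)

lemma bounded_linear_smult_left: "bounded_linear (\<lambda>c. c *s (v :: complex^'n))"
  by (rule bounded_linear_intro[where K = "norm v"])
     (auto simp: vec_eq_iff algebra_simps norm_vector_smult)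

lemma has_derivative_smult_left [derivative_intros]:
  "(f has_derivative f') F \<Longrightarrow> ((\<lambda>w. f w *s (v :: complex^'n)) has_derivative (\<lambda>h. f' h *s v)) F"
  by (rule bounded_linear.has_derivative[OF bounded_linear_smult_left])

lemma clin_on_curve:
  assumes F: "clin_on S F" "\<gamma> w \<in> S"
    and \<gamma>: "(\<gamma> has_derivative (\<lambda>h. h *s v)) (at w)"
  shows "((\<lambda>w. F (\<gamma> w)) has_field_derivative frechet_derivative F (at (\<gamma> w)) v) (at w)"
proof -
  have "((\<lambda>w. F (\<gamma> w)) has_derivative (\<lambda>h. frechet_derivative F (at (\<gamma> w)) (h *s v))) (at w)"
    by (rule has_derivative_compose[OF \<gamma> clin_onD(1)[OF F], unfolded o_def])
  then show ?thesis
    unfolding has_field_derivative_def clin_onD(2)[OF F]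
    by (rule has_derivative_eq_rhs) (simp add: fun_eq_iff)
qed

lemma clin_on_line:
  assumes F: "clin_on S F" "x + w *s v \<in> S"
  shows "((\<lambda>w. F (x + w *s v)) has_field_derivative frechet_derivative F (at (x + w *s v)) v) (at w)"
  by (rule clin_on_curve[where \<gamma> = "\<lambda>w. x + w *s v", OF F]) (auto intro!: derivative_eq_intros)

lemma in_ball_line:
  assumes "x \<in> ball x0 a" "cmod w * norm v \<le> b"
  shows "x + w *s v \<in> ball x0 (a + b)"
proof -
  have "dist x0 (x + w *s v) \<le> dist x0 x + norm (w *s v)"
    using dist_triangle[of x0 "x + w *s v" x] by (simp add: dist_norm)
  then show ?thesis using assms by (simp add: norm_vector_smult)
qed

lemma clin_on_subset: "clin_on S F \<Longrightarrow> T \<subseteq> S \<Longrightarrow> clin_on T F"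
  unfolding clin_on_def by blast

lemma clin_on_continuous: "clin_on S F \<Longrightarrow> continuous_on S F"
  by (intro continuous_at_imp_continuous_on ballI has_derivative_continuous)
     (rule clin_onD(1))

text \<open>On the slice \<open>w \<mapsto> x + w *s v\<close> this is Taylor's formula in one
  variable, with the second derivative bounded by Cauchy's inequality. The point is that the error
  is uniform in \<open>x\<close> and \<open>v\<close> and uses a bound of \<open>F\<close> alone,
  none of its derivative.\<close>

lemma clin_second_difference:
  fixes F :: "complex^'n \<Rightarrow> complex"
  assumes F: "clin_on (ball x0 (2*d)) F" and B: "\<And>x. x \<in> ball x0 (2*d) \<Longrightarrow> cmod (F x) \<le> B"
    and x: "x \<in> ball x0 d" and "0 < d" and v: "norm v \<le> 1" and h: "cmod h < d/4"
  shows "cmod (F (x + h *s v) - F x - h * frechet_derivative F (at x) v) \<le> 32 * B / d^2 * (cmod h)^2"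
proof -
  define \<phi> where "\<phi> = (\<lambda>w. F (x + w *s v))"
  have in_ball: "x + w *s v \<in> ball x0 (2*d)" if "cmod w < d" for w
  proof -
    have "cmod w * norm v \<le> d * 1" using that v \<open>0 < d\<close> by (intro mult_mono) auto
    then have "x + w *s v \<in> ball x0 (d + d)" by (intro in_ball_line[OF x]) auto
    then show ?thesis by auto
  qed
  have der: "(\<phi> has_field_derivative frechet_derivative F (at (x + w *s v)) v) (at w)"
    if "cmod w < d" for w
    unfolding \<phi>_def by (rule clin_on_line[OF F in_ball[OF that]])
  have hol: "\<phi> holomorphic_on ball 0 d"
    by (rule holomorphic_onI, rule field_differentiable_at_within)
       (use der in \<open>force simp: field_differentiable_def\<close>)
  have hol2: "(deriv ^^ n) \<phi> holomorphic_on ball 0 d" for n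
    by (rule holomorphic_higher_deriv[OF hol]) auto
  have second: "cmod ((deriv ^^ 2) \<phi> w) \<le> 32 * B / d^2" if "w \<in> ball 0 (d/4)" for w
  proof -
    have sub: "cball w (d/4) \<subseteq> ball 0 d"
    proof
      fix u assume "u \<in> cball w (d/4)"
      then have "dist 0 u \<le> dist 0 w + d/4" using dist_triangle[of 0 u w] by auto
      then show "u \<in> ball 0 d" using that \<open>0 < d\<close> by auto
    qed
    \<comment> \<open>Discs of radius \<open>d/4\<close> around points of
      \<open>ball 0 (d/4)\<close> stay in the domain of the slice; \<open>fact 2 * 16\<close> is the
      origin of the 32.\<close>
    have "cmod ((deriv ^^ 2) \<phi> w) \<le> fact 2 * B / (d/4) ^ 2"
    proof (rule Cauchy_inequality)
      show "\<phi> holomorphic_on ball w (d/4)"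
        using sub ball_subset_cball by (intro holomorphic_on_subset[OF hol]) blast
      show "continuous_on (cball w (d/4)) \<phi>"
        by (rule continuous_on_subset[OF holomorphic_on_imp_continuous_on[OF hol] sub])
      show "cmod (\<phi> u) \<le> B" if "cmod (w - u) = d/4" for u
      proof -
        have "u \<in> ball 0 d" using sub that by (auto simp: dist_norm)
        then show ?thesis unfolding \<phi>_def by (intro B in_ball) auto
      qed
    qed (use \<open>0 < d\<close> in auto)
    then show ?thesis by (simp add: field_simps power2_eq_square)
  qed
  have "cmod ((deriv ^^ 0) \<phi> h - (\<Sum>i\<le>1. (deriv ^^ i) \<phi> 0 * (h - 0) ^ i / fact i))
      \<le> 32 * B / d^2 * cmod (h - 0) ^ Suc 1 / fact 1"
  proof (rule complex_Taylor[where S = "ball 0 (d/4)"])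
    fix i :: nat and w :: complex assume "w \<in> ball 0 (d/4)" "i \<le> 1"
    then have "w \<in> ball 0 d" using \<open>0 < d\<close> by auto
    then have "((deriv ^^ i) \<phi> has_field_derivative deriv ((deriv ^^ i) \<phi>) w) (at w)"
      by (intro holomorphic_derivI[OF hol2]) auto
    then show "((deriv ^^ i) \<phi> has_field_derivative (deriv ^^ Suc i) \<phi> w) (at w within ball 0 (d/4))"
      by (auto intro: has_field_derivative_at_within)
  qed (use second h \<open>0 < d\<close> in \<open>auto simp: numeral_2_eq_2\<close>)
  moreover have "deriv \<phi> 0 = frechet_derivative F (at x) v"
    by (rule DERIV_imp_deriv) (use der[of 0] \<open>0 < d\<close> in auto)
  moreover have "F (x + h *s v) - F x - h * D = \<phi> h - (D * h + \<phi> 0)" for D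
    by (simp add: \<phi>_def)
  ultimately show ?thesis by (simp only: funpow_0 funpow.simps o_id One_nat_def atMost_Suc) (simp add: power2_eq_square)
qed

lemma clin_on_add:
  assumes "clin_on S F" "clin_on S G"
  shows "clin_on S (\<lambda>x. F x + G x)"
  unfolding clin_on_def
proof
  fix x assume x: "x \<in> S"
  show "\<exists>D. ((\<lambda>x. F x + G x) has_derivative D) (at x) \<and> (\<forall>c v. D (c *s v) = c * D v)"
    by (rule exI, rule conjI, rule has_derivative_add[OF clin_onD(1)[OF assms(1) x] clin_onD(1)[OF assms(2) x]])
       (simp add: clin_onD(2)[OF assms(1) x] clin_onD(2)[OF assms(2) x] algebra_simps)
qed

lemma clin_on_mult:
  assumes "clin_on S F" "clin_on S G"
  shows "clin_on S (\<lambda>x. F x * G x)"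
  unfolding clin_on_def
proof
  fix x assume x: "x \<in> S"
  show "\<exists>D. ((\<lambda>x. F x * G x) has_derivative D) (at x) \<and> (\<forall>c v. D (c *s v) = c * D v)"
    by (rule exI, rule conjI, rule has_derivative_mult[OF clin_onD(1)[OF assms(1) x] clin_onD(1)[OF assms(2) x]])
       (simp add: clin_onD(2)[OF assms(1) x] clin_onD(2)[OF assms(2) x] algebra_simps)
qed

lemma clin_on_const: "clin_on S (\<lambda>x. c)"
  unfolding clin_on_def by (auto intro!: exI[of _ "\<lambda>_. 0"])

lemma clin_on_sum: "(\<And>i. i \<in> I \<Longrightarrow> clin_on S (F i)) \<Longrightarrow> clin_on S (\<lambda>x. \<Sum>i\<in>I. F i x)"
  by (induction I rule: infinite_finite_induct) (auto intro: clin_on_const clin_on_add)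

lemma clin_on_prod: "(\<And>i. i \<in> I \<Longrightarrow> clin_on S (F i)) \<Longrightarrow> clin_on S (\<lambda>x. \<Prod>i\<in>I. F i x)"
  by (induction I rule: infinite_finite_induct) (auto intro: clin_on_const clin_on_mult)

lemma clin_on_inverse:
  assumes F: "clin_on S F" and nz: "\<And>x. x \<in> S \<Longrightarrow> F x \<noteq> 0"
  shows "clin_on S (\<lambda>x. inverse (F x))"
  unfolding clin_on_def
proof
  fix x assume x: "x \<in> S"
  show "\<exists>D. ((\<lambda>x. inverse (F x)) has_derivative D) (at x) \<and> (\<forall>c v. D (c *s v) = c * D v)"
    by (rule exI, rule conjI, rule Deriv.has_derivative_inverse[OF nz[OF x] clin_onD(1)[OF F x]])
       (simp add: clin_onD(2)[OF F x] algebra_simps)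
qed

lemma clin_on_cong:
  assumes "open S" "clin_on S F" "\<And>x. x \<in> S \<Longrightarrow> F x = G x"
  shows "clin_on S G"
  unfolding clin_on_def
proof
  fix x assume x: "x \<in> S"
  have "(G has_derivative frechet_derivative F (at x)) (at x)"
    by (rule has_derivative_transform_within_open[OF clin_onD(1)[OF assms(2) x] assms(1) x assms(3)])
  then show "\<exists>D. (G has_derivative D) (at x) \<and> (\<forall>c v. D (c *s v) = c * D v)"
    using clin_onD(2)[OF assms(2) x] by blast
qed

lemma open_line_preimage: "open T \<Longrightarrow> open {w. x + w *s (u :: complex^'n) \<in> T}"
proof -
  assume "open T"
  have "continuous_on UNIV (\<lambda>w. x + w *s u)"
    by (intro continuous_intros bounded_linear.continuous_on[OF bounded_linear_smult_left])
  then show ?thesis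
    using open_vimage[OF \<open>open T\<close>, of "\<lambda>w. x + w *s u"] by (simp add: vimage_def)
qed

lemma holomorphic_on_clin_line:
  assumes "clin_on T F"
  shows "(\<lambda>w. F (x + w *s u)) holomorphic_on {w. x + w *s u \<in> T}"
proof (rule holomorphic_onI, rule field_differentiable_at_within)
  fix w assume "w \<in> {w. x + w *s u \<in> T}"
  then have "x + w *s u \<in> T" by simp
  from clin_on_line[OF assms this]
  show "(\<lambda>w. F (x + w *s u)) field_differentiable at w"
    unfolding field_differentiable_def by blast
qed

lemma clin_on_shift:
  assumes "clin_on S F" "\<And>x. x \<in> T \<Longrightarrow> x + a \<in> S"
  shows "clin_on T (\<lambda>x. F (x + a))"
  unfolding clin_on_def
proof
  fix x assume x: "x \<in> T"
  have "((\<lambda>x. F (x + a)) has_derivative frechet_derivative F (at (x + a))) (at x)"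
    by (rule has_derivative_compose[where f = "\<lambda>x. x + a" and f' = "\<lambda>h. h"])
       (auto intro!: derivative_eq_intros clin_onD(1)[OF assms(1)] assms(2) x)
  then show "\<exists>D. ((\<lambda>x. F (x + a)) has_derivative D) (at x) \<and> (\<forall>c v. D (c *s v) = c * D v)"
    using clin_onD(2)[OF assms(1) assms(2)[OF x]] by blast
qed

text \<open>The directional derivative \<open>E\<close> is a uniform limit of difference quotients
  \<open>Q m\<close>, which are holomorphic. Along each complex line Weierstrass makes
  \<open>E\<close> holomorphic and Cauchy compares the derivatives of \<open>Q m\<close> and
  \<open>E\<close>, uniformly in base point and direction. This is what is needed to differentiate
  the limit in the Frechet sense.\<close>

lemma clin_on_directional_derivative_unit:
  fixes F :: "complex^'n \<Rightarrow> complex"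
  assumes S: "open S" and F: "clin_on S F" and v: "norm v \<le> 1"
  shows "clin_on S (\<lambda>x. frechet_derivative F (at x) v)"
  unfolding clin_on_def
proof
  fix x0 assume "x0 \<in> S"
  then obtain \<epsilon> where \<epsilon>: "\<epsilon> > 0" "cball x0 \<epsilon> \<subseteq> S"
    using S open_contains_cball by blast
  define d where "d = \<epsilon> / 2"
  have d: "d > 0" "cball x0 (2*d) \<subseteq> S" using \<epsilon> by (auto simp: d_def)
  have "bounded (F ` cball x0 (2*d))"
    by (intro compact_imp_bounded compact_continuous_image compact_cball
        continuous_on_subset[OF clin_on_continuous[OF F] d(2)])
  then obtain B where B: "\<And>x. x \<in> ball x0 (2*d) \<Longrightarrow> cmod (F x) \<le> B"
    unfolding bounded_iff using ball_subset_cball[of x0 "2*d"] by blast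
  have F': "clin_on (ball x0 (2*d)) F"
    using d(2) ball_subset_cball by (intro clin_on_subset[OF F]) blast
  define E where "E = (\<lambda>x. frechet_derivative F (at x) v)"
  define \<eta> where "\<eta> = (\<lambda>m::nat. d / 8 * inverse (real (Suc m)))"
  define Q where "Q = (\<lambda>m x. (F (x + of_real (\<eta> m) *s v) + (-1) * F x) * of_real (inverse (\<eta> m)))"
  define C where "C = 32 * B / d^2"
  have \<eta>: "\<eta> m > 0" "\<eta> m < d/4" for m
  proof -
    have "inverse (real (Suc m)) \<le> 1" by (simp add: field_simps)
    then have "\<eta> m \<le> d / 8 * 1"
      unfolding \<eta>_def using d(1) by (intro mult_left_mono) auto
    then show "\<eta> m < d/4" using d(1) by simp
    show "\<eta> m > 0" using d(1) by (simp add: \<eta>_def)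
  qed
  have "\<eta> \<longlonglongrightarrow> 0"
    unfolding \<eta>_def by (rule tendsto_mult_right_zero[OF LIMSEQ_inverse_real_of_nat])
  have C: "C \<ge> 0" using order_trans[OF norm_ge_zero B[of x0]] d(1) by (simp add: C_def)
  have near: "x + of_real (\<eta> m) *s v \<in> ball x0 (2*d)" if "x \<in> ball x0 d" for x m
  proof -
    have "cmod (of_real (\<eta> m)) * norm v \<le> d/4 * 1"
      using \<eta>[of m] v by (intro mult_mono) auto
    from in_ball_line[OF that this] show ?thesis using d(1) by auto
  qed
  have Q: "clin_on (ball x0 d) (Q m)" for m
    unfolding Q_def
    using d(1) by (intro clin_on_mult clin_on_add clin_on_const clin_on_shift[OF F'] near clin_on_subset[OF F']) auto
  have err: "cmod (Q m x - E x) \<le> C * \<eta> m" if "x \<in> ball x0 d" for m x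
  proof -
    have "cmod (F (x + of_real (\<eta> m) *s v) - F x - of_real (\<eta> m) * E x) \<le> C * (\<eta> m)^2"
      using clin_second_difference[OF F' B that d(1) v, of "of_real (\<eta> m)"] \<eta>[of m]
      by (simp add: E_def C_def)
    also have "F (x + of_real (\<eta> m) *s v) - F x - of_real (\<eta> m) * E x = of_real (\<eta> m) * (Q m x - E x)"
      using \<eta>(1)[of m] by (simp add: Q_def field_simps)
    finally show ?thesis
      using \<eta>(1)[of m] by (simp add: norm_mult power2_eq_square)
  qed
  have tend: "(\<lambda>m. C * \<eta> m) \<longlonglongrightarrow> 0"
    using tendsto_mult_right_zero[OF \<open>\<eta> \<longlonglongrightarrow> 0\<close>] .
  have holE: "(\<lambda>w. E (x + w *s u)) holomorphic_on {w. x + w *s u \<in> ball x0 d}" for x u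
  proof (rule holomorphic_uniform_sequence)
    show "open {w. x + w *s u \<in> ball x0 d}" by (rule open_line_preimage) simp
    show "(\<lambda>w. Q m (x + w *s u)) holomorphic_on {w. x + w *s u \<in> ball x0 d}" for m
      by (rule holomorphic_on_clin_line[OF Q])
    fix w assume "w \<in> {w. x + w *s u \<in> ball x0 d}"
    then obtain \<delta> where \<delta>: "\<delta> > 0" "cball w \<delta> \<subseteq> {w. x + w *s u \<in> ball x0 d}"
      using open_line_preimage[of "ball x0 d" x u] open_contains_cball by blast
    have "uniform_limit (cball w \<delta>) (\<lambda>m w. Q m (x + w *s u)) (\<lambda>w. E (x + w *s u)) sequentially"
    proof (rule uniform_limitI)
      fix e :: real assume "e > 0"
      then have "\<forall>\<^sub>F m in sequentially. C * \<eta> m < e"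
        using order_tendstoD(2)[OF tend] by blast
      then show "\<forall>\<^sub>F m in sequentially. \<forall>w\<in>cball w \<delta>. dist (Q m (x + w *s u)) (E (x + w *s u)) < e"
      proof eventually_elim
        case (elim m)
        show ?case
        proof
          fix w' assume "w' \<in> cball w \<delta>"
          then have "x + w' *s u \<in> ball x0 d" using \<delta>(2) by blast
          from err[OF this, of m] elim show "dist (Q m (x + w' *s u)) (E (x + w' *s u)) < e"
            by (simp add: dist_norm)
        qed
      qed
    qed
    with \<delta> show "\<exists>\<delta>>0. cball w \<delta> \<subseteq> {w. x + w *s u \<in> ball x0 d} \<and>
        uniform_limit (cball w \<delta>) (\<lambda>m w. Q m (x + w *s u)) (\<lambda>w. E (x + w *s u)) sequentially"
      by blast
  qed
  \<comment> \<open>The candidate for the differential of \<open>E\<close>, known on each line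
    separately. Its linearity in \<open>u\<close> comes out of the limit theorem; only homogeneity
    over the complex numbers is checked by hand.\<close>
  define G where "G = (\<lambda>x u. deriv (\<lambda>w. E (x + w *s u)) 0)"
  have derE: "((\<lambda>w. E (x + w *s u)) has_field_derivative G x u) (at 0)" if "x \<in> ball x0 d" for x u
    unfolding G_def
    by (rule holomorphic_derivI[OF holE[of x u] open_line_preimage[OF open_ball]]) (use that in simp)
  have derQ: "((\<lambda>w. Q m (x + w *s u)) has_field_derivative frechet_derivative (Q m) (at x) u) (at 0)"
    if "x \<in> ball x0 d" for x u m
    using clin_on_line[OF Q, of x 0 u m] that by simp
  have est: "cmod (frechet_derivative (Q m) (at x) u - G x u) \<le> (4 * C / d) * \<eta> m * norm u"
    if x: "x \<in> ball x0 (d/2)" for m x u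
  proof (cases "u = 0")
    case True
    have "x \<in> ball x0 d" using x d by auto
    from clin_onD(2)[OF Q this, of m 0 u] have "frechet_derivative (Q m) (at x) u = 0"
      using True by simp
    moreover have "G x u = 0" using True by (simp add: G_def)
    ultimately show ?thesis using True by simp
  next
    case False
    \<comment> \<open>A radius inversely proportional to \<open>norm u\<close> keeps the disc inside
      the ball and makes the Cauchy bound proportional to \<open>norm u\<close>, as an operator norm
      estimate has to be.\<close>
    define R where "R = d / (4 * norm u)"
    have R: "R > 0" using False d(1) by (simp add: R_def)
    define W where "W = {w. x + w *s u \<in> ball x0 d}"
    have W: "cball 0 R \<subseteq> W"
    proof
      fix w :: complex assume "w \<in> cball 0 R"
      then have "cmod w * norm u \<le> R * norm u" by (intro mult_right_mono) auto
      also have "\<dots> = d/4" using False by (simp add: R_def)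
      finally have "x + w *s u \<in> ball x0 (d/2 + d/4)" by (rule in_ball_line[OF x])
      then show "w \<in> W" using d(1) by (auto simp: W_def)
    qed
    define \<phi> where "\<phi> = (\<lambda>w. Q m (x + w *s u) - E (x + w *s u))"
    have hol: "\<phi> holomorphic_on W"
      unfolding \<phi>_def W_def by (intro holomorphic_intros holE holomorphic_on_clin_line[OF Q])
    have "cmod ((deriv ^^ 1) \<phi> 0) \<le> fact 1 * (C * \<eta> m) / R ^ 1"
    proof (rule Cauchy_inequality)
      show "\<phi> holomorphic_on ball 0 R"
        using W ball_subset_cball by (intro holomorphic_on_subset[OF hol]) blast
      show "continuous_on (cball 0 R) \<phi>"
        by (rule continuous_on_subset[OF holomorphic_on_imp_continuous_on[OF hol] W])
      fix w :: complex assume "cmod (0 - w) = R"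
      then have "w \<in> W" using W by auto
      then show "cmod (\<phi> w) \<le> C * \<eta> m" unfolding \<phi>_def by (intro err) (simp add: W_def)
    qed (rule R)
    moreover have "deriv \<phi> 0 = frechet_derivative (Q m) (at x) u - G x u"
      unfolding \<phi>_def using x d(1) by (intro DERIV_imp_deriv DERIV_diff derE derQ) auto
    ultimately have "cmod (frechet_derivative (Q m) (at x) u - G x u) \<le> C * \<eta> m / R" by simp
    also have "C * \<eta> m / R = (4 * C / d) * \<eta> m * norm u" using False d(1) by (simp add: R_def)
    finally show ?thesis .
  qed
  have "\<exists>g. \<forall>x\<in>ball x0 (d/2). (\<lambda>m. Q m x) \<longlonglongrightarrow> g x \<and> (g has_derivative G x) (at x within ball x0 (d/2))"
  proof (rule has_derivative_sequence[where ?x0.0 = x0 and l = "E x0"])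
    show "(Q m has_derivative frechet_derivative (Q m) (at x)) (at x within ball x0 (d/2))"
      if "x \<in> ball x0 (d/2)" for m x
      by (rule has_derivative_at_withinI[OF clin_onD(1)[OF Q]]) (use that d(1) in auto)
    show "\<forall>\<^sub>F m in sequentially. \<forall>x\<in>ball x0 (d/2). \<forall>u. cmod (frechet_derivative (Q m) (at x) u - G x u) \<le> e * norm u"
      if "e > 0" for e
    proof -
      have "(\<lambda>m. (4 * C / d) * \<eta> m) \<longlonglongrightarrow> 0"
        using tendsto_mult_right_zero[OF \<open>\<eta> \<longlonglongrightarrow> 0\<close>] .
      then have "\<forall>\<^sub>F m in sequentially. (4 * C / d) * \<eta> m < e"
        using order_tendstoD(2) that by blast
      then show ?thesis
      proof eventually_elim
        case (elim m)
        show ?case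
        proof (intro ballI allI)
          fix x u assume "x \<in> ball x0 (d/2)"
          from est[OF this, of m u] show "cmod (frechet_derivative (Q m) (at x) u - G x u) \<le> e * norm u"
            using elim by (elim order_trans) (intro mult_right_mono, auto)
        qed
      qed
    qed
    show "(\<lambda>m. Q m x0) \<longlonglongrightarrow> E x0"
      by (rule LIM_zero_cancel, rule Lim_null_comparison[OF _ tend]) (use err[of x0] d(1) in auto)
  qed (use d(1) in auto)
  then obtain g where g: "\<And>x. x \<in> ball x0 (d/2) \<Longrightarrow> (\<lambda>m. Q m x) \<longlonglongrightarrow> g x"
    "\<And>x. x \<in> ball x0 (d/2) \<Longrightarrow> (g has_derivative G x) (at x within ball x0 (d/2))" by blast
  have gE: "g x = E x" if "x \<in> ball x0 (d/2)" for x
  proof -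
    have x: "x \<in> ball x0 d" using that d(1) by auto
    have "(\<lambda>m. Q m x) \<longlonglongrightarrow> E x"
      by (rule LIM_zero_cancel, rule Lim_null_comparison[OF _ tend]) (use err[OF x] in auto)
    then show ?thesis using g(1)[OF that] LIMSEQ_unique by blast
  qed
  have x0: "x0 \<in> ball x0 (d/2)" using d(1) by auto
  have "(g has_derivative G x0) (at x0)"
    using g(2)[OF x0] unfolding at_within_open[OF x0 open_ball] .
  then have E: "(E has_derivative G x0) (at x0)"
    by (rule has_derivative_transform_within_open[OF _ open_ball x0]) (rule gE)
  \<comment> \<open>The lines with directions \<open>u\<close> and \<open>c *s u\<close> are the
    same line with its parameter rescaled by \<open>c\<close>.\<close>
  have "G x0 (c *s u) = c * G x0 u" for c u
  proof -
    have "((\<lambda>w. E (x0 + (c * w) *s u)) has_field_derivative G x0 u * c) (at 0)"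
      by (rule DERIV_chain2[where g = "\<lambda>w. c * w" and f = "\<lambda>w. E (x0 + w *s u)"])
         (use derE[of x0 u] d(1) in \<open>auto intro!: derivative_eq_intros\<close>)
    moreover have "((\<lambda>w. E (x0 + w *s (c *s u))) has_field_derivative G x0 (c *s u)) (at 0)"
      using derE[of x0 "c *s u"] d(1) by auto
    ultimately show ?thesis
      by (simp add: vector_smult_assoc mult.commute DERIV_unique)
  qed
  with E show "\<exists>D. (E has_derivative D) (at x0) \<and> (\<forall>c v. D (c *s v) = c * D v)" by blast
qed

text \<open>Dividing by \<open>norm v + 1\<close> instead of \<open>norm v\<close> reduces to short
  vectors and includes \<open>v = 0\<close>.\<close>

lemma clin_on_directional_derivative:
  fixes F :: "complex^'n \<Rightarrow> complex"
  assumes S: "open S" and F: "clin_on S F"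
  shows "clin_on S (\<lambda>x. frechet_derivative F (at x) v)"
proof -
  define a where "a = complex_of_real (norm v + 1)"
  define u where "u = inverse a *s v"
  have a: "a \<noteq> 0" "cmod a = norm v + 1"
    unfolding a_def norm_of_real of_real_eq_0_iff using norm_ge_zero[of v] by linarith+
  have "norm u = norm v / (norm v + 1)"
    by (simp add: u_def norm_vector_smult norm_inverse a(2) divide_inverse del: inverse_eq_divide)
  then have "norm u \<le> 1"
    using norm_ge_zero[of v] by (simp del: norm_ge_zero)
  from this have "clin_on S (\<lambda>x. a * frechet_derivative F (at x) u)"
    by (intro clin_on_mult clin_on_const clin_on_directional_derivative_unit S F)
  moreover have "v = a *s u" using a by (simp add: u_def vector_smult_assoc)
  ultimately show ?thesis
    by (elim clin_on_cong[OF S]) (simp add: clin_onD(2)[OF F])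
qed

section \<open>Smooth functions and Wirtinger calculus\<close>

lemma Ck_on_cong:
  assumes "open S" "\<And>x. x \<in> S \<Longrightarrow> f x = g x" "Ck_on k S f"
  shows "Ck_on k S g"
  using assms(2,3)
proof (induction k arbitrary: f g)
  case 0
  then show ?case using continuous_on_cong[of S S f g] by simp
next
  case (Suc k)
  have D: "(g has_derivative frechet_derivative f (at x)) (at x)" if "x \<in> S" for x
  proof -
    from Suc.prems(2) that have "(f has_derivative frechet_derivative f (at x)) (at x)"
      by (simp add: frechet_derivative_works)
    from has_derivative_transform_within_open[OF this assms(1) that Suc.prems(1)]
    show ?thesis by simp
  qed
  have eq: "frechet_derivative f (at x) v = frechet_derivative g (at x) v" if "x \<in> S" for x v
    by (rule fun_cong[OF frechet_derivative_at[OF D[OF that]]])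
  have "Ck_on k S (\<lambda>x. frechet_derivative g (at x) v)" for v
    by (rule Suc.IH[of "\<lambda>x. frechet_derivative f (at x) v", OF eq]) (use Suc.prems(2) in auto)
  moreover have "g differentiable at x" if "x \<in> S" for x
    using D[OF that] unfolding differentiable_def by blast
  ultimately show ?case by simp
qed

lemma Ck_on_Suc_lower: "Ck_on (Suc k) S f \<Longrightarrow> Ck_on k S f"
proof (induction k arbitrary: f)
  case 0
  then show ?case
    by (auto intro!: continuous_at_imp_continuous_on differentiable_imp_continuous_within)
next
  case (Suc k)
  have "Ck_on k S (\<lambda>x. frechet_derivative f (at x) v)" for v
    by (rule Suc.IH) (use Suc.prems in auto)
  then show ?case using Suc.prems by auto
qed

lemma Ck_on_SucI:
  assumes "open S" "\<And>x. x \<in> S \<Longrightarrow> (f has_derivative D x) (at x)" "\<And>v. Ck_on k S (\<lambda>x. D x v)"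
  shows "Ck_on (Suc k) S f"
proof -
  have "Ck_on k S (\<lambda>x. frechet_derivative f (at x) v)" for v
    by (rule Ck_on_cong[OF assms(1) fun_cong[OF frechet_derivative_at[OF assms(2)]] assms(3)])
  then show ?thesis using assms(2) by (auto simp: differentiable_def)
qed

lemma Ck_on_SucD:
  assumes "Ck_on (Suc k) S f" "x \<in> S"
  shows "(f has_derivative frechet_derivative f (at x)) (at x)"
  using assms by (simp add: frechet_derivative_works)

lemma Ck_on_const: "Ck_on k S (\<lambda>x. c)"
proof (induction k arbitrary: c)
  case (Suc k)
  then show ?case by simp
qed simp

lemma Ck_on_add:
  assumes "open S" "Ck_on k S f" "Ck_on k S g"
  shows "Ck_on k S (\<lambda>x. f x + g x)"
  using assms(2,3)
proof (induction k arbitrary: f g)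
  case 0
  then show ?case by (auto intro: continuous_on_add)
next
  case (Suc k)
  show ?case
    by (rule Ck_on_SucI[OF assms(1) has_derivative_add[OF Ck_on_SucD[OF Suc.prems(1)] Ck_on_SucD[OF Suc.prems(2)]]])
       (use Suc in auto)
qed

lemma Ck_on_bounded_linear:
  assumes "open S" "bounded_linear L" "Ck_on k S f"
  shows "Ck_on k S (\<lambda>x. L (f x))"
  using assms(3)
proof (induction k arbitrary: f)
  case 0
  then show ?case by (auto intro: bounded_linear.continuous_on[OF assms(2)])
next
  case (Suc k)
  show ?case
    by (rule Ck_on_SucI[OF assms(1) bounded_linear.has_derivative[OF assms(2) Ck_on_SucD[OF Suc.prems]]])
       (use Suc in auto)
qed

lemma Ck_on_mult:
  fixes f g :: "'a::real_normed_vector \<Rightarrow> 'b::real_normed_algebra"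
  assumes "open S" "Ck_on k S f" "Ck_on k S g"
  shows "Ck_on k S (\<lambda>x. f x * g x)"
  using assms(2,3)
proof (induction k arbitrary: f g)
  case 0
  then show ?case by (auto intro: continuous_on_mult)
next
  case (Suc k)
  show ?case
    by (rule Ck_on_SucI[OF assms(1) has_derivative_mult[OF Ck_on_SucD[OF Suc.prems(1)] Ck_on_SucD[OF Suc.prems(2)]]])
       (use Suc Ck_on_Suc_lower[OF Suc.prems(1)] Ck_on_Suc_lower[OF Suc.prems(2)] in
         \<open>auto intro!: Ck_on_add[OF assms(1)]\<close>)
qed

lemma Ck_on_inverse:
  fixes f :: "'a::real_normed_vector \<Rightarrow> 'b::real_normed_field"
  assumes "open S" "\<And>x. x \<in> S \<Longrightarrow> f x \<noteq> 0" "Ck_on k S f"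
  shows "Ck_on k S (\<lambda>x. inverse (f x))"
  using assms(3)
proof (induction k)
  case 0
  then show ?case using assms(2) by (auto intro: continuous_on_inverse)
next
  case (Suc k)
  have *: "Ck_on k S (\<lambda>x. inverse (f x))" by (rule Suc.IH[OF Ck_on_Suc_lower[OF Suc.prems]])
  have "Ck_on k S (\<lambda>x. (-1) * (inverse (f x) * frechet_derivative f (at x) v * inverse (f x)))" for v
    by (intro Ck_on_mult Ck_on_const assms(1) *) (use Suc.prems in auto)
  then show ?case
    by (intro Ck_on_SucI[OF assms(1) Deriv.has_derivative_inverse[OF assms(2) Ck_on_SucD[OF Suc.prems]]]) auto
qed

lemma smooth_on_cong:
  "open S \<Longrightarrow> smooth_on S f \<Longrightarrow> (\<And>x. x \<in> S \<Longrightarrow> f x = g x) \<Longrightarrow> smooth_on S g"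
  unfolding smooth_on_def by (blast intro: Ck_on_cong)

lemma smooth_on_const: "smooth_on S (\<lambda>x. c)"
  unfolding smooth_on_def by (blast intro: Ck_on_const)

lemma smooth_on_add: "open S \<Longrightarrow> smooth_on S f \<Longrightarrow> smooth_on S g \<Longrightarrow> smooth_on S (\<lambda>x. f x + g x)"
  unfolding smooth_on_def by (blast intro: Ck_on_add)

lemma smooth_on_mult:
  fixes f g :: "'a::real_normed_vector \<Rightarrow> 'b::real_normed_algebra"
  shows "open S \<Longrightarrow> smooth_on S f \<Longrightarrow> smooth_on S g \<Longrightarrow> smooth_on S (\<lambda>x. f x * g x)"
  unfolding smooth_on_def by (blast intro: Ck_on_mult)

lemma smooth_on_inverse:
  fixes f :: "'a::real_normed_vector \<Rightarrow> 'b::real_normed_field"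
  shows "open S \<Longrightarrow> (\<And>x. x \<in> S \<Longrightarrow> f x \<noteq> 0) \<Longrightarrow> smooth_on S f \<Longrightarrow> smooth_on S (\<lambda>x. inverse (f x))"
  unfolding smooth_on_def using Ck_on_inverse by blast

lemma smooth_on_bounded_linear:
  "open S \<Longrightarrow> bounded_linear L \<Longrightarrow> smooth_on S f \<Longrightarrow> smooth_on S (\<lambda>x. L (f x))"
  unfolding smooth_on_def by (blast intro: Ck_on_bounded_linear)

lemma smooth_on_has_derivative:
  assumes "smooth_on S f" "x \<in> S"
  shows "(f has_derivative frechet_derivative f (at x)) (at x)"
  by (rule Ck_on_SucD[where k = 0, OF _ assms(2)]) (use assms(1) in \<open>simp only: smooth_on_def\<close>)

lemma smooth_on_differentiable: "smooth_on S f \<Longrightarrow> x \<in> S \<Longrightarrow> f differentiable at x"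
  using smooth_on_has_derivative differentiable_def by blast

lemma smooth_on_frechet_derivative:
  assumes "smooth_on S f" shows "smooth_on S (\<lambda>x. frechet_derivative f (at x) v)"
  unfolding smooth_on_def
proof
  fix k
  have "Ck_on (Suc k) S f" using assms by (simp only: smooth_on_def)
  then show "Ck_on k S (\<lambda>x. frechet_derivative f (at x) v)" by simp
qed

lemma smooth_on_continuous: "smooth_on S f \<Longrightarrow> continuous_on S f"
  unfolding smooth_on_def using Ck_on.simps(1) by blast

lemma smooth_on_subset:
  assumes "smooth_on S f" "T \<subseteq> S" shows "smooth_on T f"
proof -
  have "Ck_on k S f \<Longrightarrow> Ck_on k T f" for k
    by (induction k arbitrary: f) (use assms(2) in \<open>auto intro: continuous_on_subset\<close>)
  then show ?thesis using assms(1) by (simp add: smooth_on_def)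
qed

lemma smooth_onI:
  assumes "open S" "\<And>x. x \<in> S \<Longrightarrow> (f has_derivative D x) (at x)" "\<And>v. smooth_on S (\<lambda>x. D x v)"
  shows "smooth_on S f"
proof -
  have "Ck_on (Suc k) S f" for k
    by (rule Ck_on_SucI[OF assms(1,2)]) (use assms(3) in \<open>auto simp: smooth_on_def\<close>)
  then show ?thesis unfolding smooth_on_def using Ck_on_Suc_lower by blast
qed

lemma smooth_on_ln:
  fixes f :: "'a::real_normed_vector \<Rightarrow> real"
  assumes "open S" "\<And>x. x \<in> S \<Longrightarrow> f x > 0" "smooth_on S f"
  shows "smooth_on S (\<lambda>x. ln (f x))"
proof (rule smooth_onI[OF assms(1)])
  fix x assume x: "x \<in> S"
  show "((\<lambda>x. ln (f x)) has_derivative (\<lambda>v. frechet_derivative f (at x) v * inverse (f x))) (at x)"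
    by (rule has_derivative_ln[OF assms(2)[OF x] smooth_on_has_derivative[OF assms(3) x]])
next
  have "f x \<noteq> 0" if "x \<in> S" for x using assms(2)[OF that] by simp
  then show "smooth_on S (\<lambda>x. frechet_derivative f (at x) v * inverse (f x))" for v
    by (intro smooth_on_mult smooth_on_inverse smooth_on_frechet_derivative assms)
qed

lemma smooth_on_sum:
  "open S \<Longrightarrow> (\<And>i. i \<in> I \<Longrightarrow> smooth_on S (f i)) \<Longrightarrow> smooth_on S (\<lambda>x. \<Sum>i\<in>I. f i x)"
  by (induction I rule: infinite_finite_induct) (auto intro: smooth_on_const smooth_on_add)

lemma smooth_on_prod:
  fixes f :: "'i \<Rightarrow> 'a::real_normed_vector \<Rightarrow> 'b::{real_normed_algebra,comm_ring_1}"
  shows "open S \<Longrightarrow> (\<And>i. i \<in> I \<Longrightarrow> smooth_on S (f i)) \<Longrightarrow> smooth_on S (\<lambda>x. \<Prod>i\<in>I. f i x)"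
  by (induction I rule: infinite_finite_induct) (auto intro: smooth_on_const smooth_on_mult)

lemma smooth_on_det:
  fixes h :: "'a::real_normed_vector \<Rightarrow> complex^'n^'n"
  assumes "open S" "\<And>i j. smooth_on S (\<lambda>x. h x $ i $ j)"
  shows "smooth_on S (\<lambda>x. det (h x))"
  unfolding det_def by (intro smooth_on_sum smooth_on_mult smooth_on_prod smooth_on_const assms)

text \<open>Directional derivatives are of the same kind again, so the induction over the order
  closes.\<close>

lemma clin_on_smooth:
  assumes "open S" "clin_on S F" shows "smooth_on S F"
proof -
  have "Ck_on k S F" if "clin_on S F" for k and F :: "complex^'a \<Rightarrow> complex"
    using that
  proof (induction k arbitrary: F)
    case 0
    then show ?case using clin_on_continuous by simp
  next
    case (Suc k)
    show ?case
      by (rule Ck_on_SucI[OF assms(1) clin_onD(1)[OF Suc.prems] Suc.IH[OF clin_on_directional_derivative[OF assms(1) Suc.prems]]])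
  qed
  then show ?thesis using assms(2) by (simp add: smooth_on_def)
qed

section \<open>Wirtinger derivatives\<close>

lemma wirtinger_decomposition:
  fixes F :: "complex^'n \<Rightarrow> complex"
  assumes "(F has_derivative D) (at x)"
  shows "D v = (\<Sum>k\<in>UNIV. dz k F x * v $ k + dzbar k F x * cnj (v $ k))"
proof -
  have D: "frechet_derivative F (at x) = D" by (rule frechet_derivative_at[OF assms, symmetric])
  have lin: "linear D" using assms by (rule has_derivative_linear)
  have "v = (\<Sum>k\<in>UNIV. Re (v $ k) *\<^sub>R axis k 1 + Im (v $ k) *\<^sub>R axis k \<i>)"
    by (simp add: vec_eq_iff axis_def if_distrib sum.If_cases complex_eq_iff cong: if_cong)
  then have "D v = D (\<Sum>k\<in>UNIV. Re (v $ k) *\<^sub>R axis k 1 + Im (v $ k) *\<^sub>R axis k \<i>)" by simp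
  also have "\<dots> = (\<Sum>k\<in>UNIV. Re (v $ k) *\<^sub>R D (axis k 1) + Im (v $ k) *\<^sub>R D (axis k \<i>))"
    by (simp add: linear_sum[OF lin] linear_add[OF lin] linear_scale[OF lin])
  also have "\<dots> = (\<Sum>k\<in>UNIV. dz k F x * v $ k + dzbar k F x * cnj (v $ k))"
    by (rule sum.cong) (auto simp: dz_def dzbar_def D complex_eq_iff field_simps)
  finally show ?thesis .
qed

lemma dz_has_derivative:
  "(F has_derivative D) (at x) \<Longrightarrow> dz j F x = (D (axis j 1) - \<i> * D (axis j \<i>)) / 2"
  "(F has_derivative D) (at x) \<Longrightarrow> dzbar j F x = (D (axis j 1) + \<i> * D (axis j \<i>)) / 2"
  unfolding dz_def dzbar_def by (simp_all add: frechet_derivative_at[symmetric])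

lemma dz_cong:
  assumes "open S" "x \<in> S" "\<And>y. y \<in> S \<Longrightarrow> F y = G y"
  shows "dz j F x = dz j G x" "dzbar j F x = dzbar j G x"
proof -
  have "(F has_derivative D) (at x) \<longleftrightarrow> (G has_derivative D) (at x)" for D
    using has_derivative_transform_within_open[OF _ assms(1,2)] assms(3) by metis
  then have "frechet_derivative F (at x) = frechet_derivative G (at x)"
    unfolding frechet_derivative_def by simp
  then show "dz j F x = dz j G x" "dzbar j F x = dzbar j G x"
    by (simp_all add: dz_def dzbar_def)
qed

lemma dz_add:
  assumes "F differentiable at x" "G differentiable at x"
  shows "dz j (\<lambda>y. F y + G y) x = dz j F x + dz j G x"
    "dzbar j (\<lambda>y. F y + G y) x = dzbar j F x + dzbar j G x"
proof -
  from assms obtain D E where D: "(F has_derivative D) (at x)" and E: "(G has_derivative E) (at x)"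
    unfolding differentiable_def by blast
  show "dz j (\<lambda>y. F y + G y) x = dz j F x + dz j G x"
    "dzbar j (\<lambda>y. F y + G y) x = dzbar j F x + dzbar j G x"
    unfolding dz_has_derivative[OF has_derivative_add[OF D E]] dz_has_derivative[OF D] dz_has_derivative[OF E]
    by (simp_all add: field_simps)
qed

lemma dz_mult:
  assumes "F differentiable at x" "G differentiable at x"
  shows "dz j (\<lambda>y. F y * G y) x = dz j F x * G x + F x * dz j G x"
proof -
  from assms obtain D E where D: "(F has_derivative D) (at x)" and E: "(G has_derivative E) (at x)"
    unfolding differentiable_def by blast
  show "dz j (\<lambda>y. F y * G y) x = dz j F x * G x + F x * dz j G x"
    unfolding dz_has_derivative[OF has_derivative_mult[OF D E]] dz_has_derivative[OF D] dz_has_derivative[OF E]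
    by (simp add: field_simps)
qed

lemma dz_const: "dz j (\<lambda>y. c) x = 0" "dzbar j (\<lambda>y. c) x = 0"
  by (simp_all add: dz_def dzbar_def)

lemma dz_sum:
  assumes "\<And>i. i \<in> I \<Longrightarrow> F i differentiable at x"
  shows "dz j (\<lambda>y. \<Sum>i\<in>I. F i y) x = (\<Sum>i\<in>I. dz j (F i) x)"
  using assms
proof (induction I rule: infinite_finite_induct)
  case (insert a I)
  then show ?case by (simp add: dz_add differentiable_sum)
qed (simp_all add: dz_const)

text \<open>The differential of \<open>T\<close> commutes with \<open>\<i>\<close>, so
  \<open>T\<close> has no conjugate derivatives and the two kinds of derivative of \<open>F\<close>
  do not mix.\<close>

lemma dz_compose:
  fixes F :: "complex^'n \<Rightarrow> complex"
  assumes T: "(T has_derivative D) (at x)" and lin: "Vector_Spaces.linear (*s) (*s) D"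
    and F: "F differentiable at (T x)"
  shows "dz j (\<lambda>y. F (T y)) x = (\<Sum>k\<in>UNIV. dz k F (T x) * D (axis j 1) $ k)"
    and "dzbar j (\<lambda>y. F (T y)) x = (\<Sum>k\<in>UNIV. dzbar k F (T x) * cnj (D (axis j 1) $ k))"
proof -
  obtain E where E: "(F has_derivative E) (at (T x))" using F unfolding differentiable_def by blast
  have c: "((\<lambda>y. F (T y)) has_derivative (\<lambda>v. E (D v))) (at x)"
    using diff_chain_at[OF T E] by (simp add: o_def)
  interpret D: Vector_Spaces.linear "(*s)" "(*s)" D by (rule lin)
  have "axis j \<i> = \<i> *s axis j (1::complex)"
    by (simp add: vec_eq_iff axis_def)
  then have i: "D (axis j \<i>) = \<i> *s D (axis j 1)"
    by (simp add: D.scale)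
  show "dz j (\<lambda>y. F (T y)) x = (\<Sum>k\<in>UNIV. dz k F (T x) * D (axis j 1) $ k)"
    "dzbar j (\<lambda>y. F (T y)) x = (\<Sum>k\<in>UNIV. dzbar k F (T x) * cnj (D (axis j 1) $ k))"
    unfolding dz_has_derivative[OF c] wirtinger_decomposition[OF E] i
    by (simp_all add: sum_distrib_left sum_subtractf[symmetric] sum.distrib[symmetric] sum_divide_distrib)
       (auto intro!: sum.cong simp: field_simps)
qed

lemma dz_cnj_clin:
  assumes "clin_on S F" "x \<in> S"
  shows "dz j (\<lambda>y. cnj (F y)) x = 0" "(\<lambda>y. cnj (F y)) differentiable at x"
proof -
  have c: "((\<lambda>y. cnj (F y)) has_derivative (\<lambda>v. cnj (frechet_derivative F (at x) v))) (at x)"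
    by (rule bounded_linear.has_derivative[OF bounded_linear_cnj clin_onD(1)[OF assms]])
  have "axis j \<i> = \<i> *s axis j (1::complex)"
    by (simp add: vec_eq_iff axis_def)
  then show "dz j (\<lambda>y. cnj (F y)) x = 0"
    unfolding dz_has_derivative[OF c] by (simp add: clin_onD(2)[OF assms])
  show "(\<lambda>y. cnj (F y)) differentiable at x"
    using c unfolding differentiable_def by blast
qed

lemma smooth_on_dz:
  assumes "open S" "smooth_on S F" shows "smooth_on S (dz j F)" "smooth_on S (dzbar j F)"
proof -
  have "smooth_on S (\<lambda>x. (frechet_derivative F (at x) (axis j 1) + (- \<i>) * frechet_derivative F (at x) (axis j \<i>)) * inverse 2)"
    "smooth_on S (\<lambda>x. (frechet_derivative F (at x) (axis j 1) + \<i> * frechet_derivative F (at x) (axis j \<i>)) * inverse 2)"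
    by (intro smooth_on_mult smooth_on_add smooth_on_const smooth_on_frechet_derivative assms)+
  then show "smooth_on S (dz j F)" "smooth_on S (dzbar j F)"
    by (elim smooth_on_cong[OF assms(1)]; simp add: dz_def dzbar_def)+
qed

lemma linear_axis_expansion:
  fixes D :: "complex^'n \<Rightarrow> complex^'m"
  assumes "Vector_Spaces.linear (*s) (*s) D"
  shows "D v $ l = (\<Sum>i\<in>UNIV. D (axis i 1) $ l * v $ i)"
proof -
  interpret D: Vector_Spaces.linear "(*s)" "(*s)" D by (rule assms)
  have "D v = D (\<Sum>i\<in>UNIV. v $ i *s axis i 1)" by (simp add: basis_expansion)
  also have "\<dots> = (\<Sum>i\<in>UNIV. v $ i *s D (axis i 1))" by (simp add: D.sum D.scale)
  finally show ?thesis by (simp add: mult.commute)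
qed

lemma holo_map_onD:
  assumes "holo_map_on V T" "x \<in> V"
  shows "(T has_derivative frechet_derivative T (at x)) (at x)"
    and "Vector_Spaces.linear (*s) (*s) (frechet_derivative T (at x))"
proof -
  obtain D where D: "(T has_derivative D) (at x)" "Vector_Spaces.linear (*s) (*s) D"
    using assms unfolding holo_map_on_def by blast
  with frechet_derivative_at[OF D(1)]
  show "(T has_derivative frechet_derivative T (at x)) (at x)"
    "Vector_Spaces.linear (*s) (*s) (frechet_derivative T (at x))" by simp_all
qed

lemma holo_map_on_component:
  assumes "holo_map_on V T"
  shows "clin_on V (\<lambda>x. T x $ k)"
    and "x \<in> V \<Longrightarrow> frechet_derivative (\<lambda>x. T x $ k) (at x) v = frechet_derivative T (at x) v $ k"
proof -
  have D: "((\<lambda>x. T x $ k) has_derivative (\<lambda>v. frechet_derivative T (at x) v $ k)) (at x)" if "x \<in> V" for x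
    by (rule bounded_linear.has_derivative[OF bounded_linear_vec_nth holo_map_onD(1)[OF assms that]])
  have s: "frechet_derivative T (at x) (c *s v) $ k = c * frechet_derivative T (at x) v $ k" if "x \<in> V" for x c v
  proof -
    interpret D: Vector_Spaces.linear "(*s)" "(*s)" "frechet_derivative T (at x)"
      by (rule holo_map_onD(2)[OF assms that])
    show ?thesis by (simp add: D.scale)
  qed
  show "clin_on V (\<lambda>x. T x $ k)" unfolding clin_on_def using D s by blast
  show "frechet_derivative (\<lambda>x. T x $ k) (at x) v = frechet_derivative T (at x) v $ k" if "x \<in> V"
    by (rule fun_cong[OF frechet_derivative_at[OF D[OF that], symmetric]])
qed

lemma clin_on_jacobian:
  assumes "open V" "holo_map_on V T"
  shows "clin_on V (\<lambda>x. frechet_derivative T (at x) v $ k)"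
  by (rule clin_on_cong[OF assms(1) clin_on_directional_derivative[OF assms(1) holo_map_on_component(1)[OF assms(2)]]
        holo_map_on_component(2)[OF assms(2)]])

section \<open>Complex Hessians and Ricci potentials under holomorphic maps\<close>

lemma sum_swap4:
  "(\<Sum>l\<in>A. \<Sum>k\<in>B. \<Sum>i\<in>C. \<Sum>j\<in>D. f l k i j) = (\<Sum>i\<in>C. \<Sum>j\<in>D. \<Sum>k\<in>B. \<Sum>l\<in>A. f l k i j)"
proof -
  have "(\<Sum>l\<in>A. \<Sum>k\<in>B. \<Sum>i\<in>C. \<Sum>j\<in>D. f l k i j) = (\<Sum>k\<in>B. \<Sum>l\<in>A. \<Sum>i\<in>C. \<Sum>j\<in>D. f l k i j)"
    by (rule sum.swap)
  also have "\<dots> = (\<Sum>k\<in>B. \<Sum>i\<in>C. \<Sum>l\<in>A. \<Sum>j\<in>D. f l k i j)" by (intro sum.cong refl sum.swap)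
  also have "\<dots> = (\<Sum>i\<in>C. \<Sum>k\<in>B. \<Sum>l\<in>A. \<Sum>j\<in>D. f l k i j)" by (rule sum.swap)
  also have "\<dots> = (\<Sum>i\<in>C. \<Sum>k\<in>B. \<Sum>j\<in>D. \<Sum>l\<in>A. f l k i j)" by (intro sum.cong refl sum.swap)
  also have "\<dots> = (\<Sum>i\<in>C. \<Sum>j\<in>D. \<Sum>k\<in>B. \<Sum>l\<in>A. f l k i j)" by (intro sum.cong refl sum.swap)
  finally show ?thesis .
qed

lemma sesq_pullback:
  fixes H :: "complex^'m^'m" and D :: "complex^'n \<Rightarrow> complex^'m"
  assumes "Vector_Spaces.linear (*s) (*s) D"
  shows "sesq H (D v) (D w) = sesq (\<chi> i j. \<Sum>k\<in>UNIV. (\<Sum>l\<in>UNIV. H $ l $ k * D (axis i 1) $ l) * cnj (D (axis j 1) $ k)) v w"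
proof -
  have "sesq H (D v) (D w) = (\<Sum>l\<in>UNIV. \<Sum>k\<in>UNIV. \<Sum>i\<in>UNIV. \<Sum>j\<in>UNIV.
      H $ l $ k * (D (axis i 1) $ l * v $ i) * cnj (D (axis j 1) $ k * w $ j))"
    unfolding sesq_def linear_axis_expansion[OF assms, of v] linear_axis_expansion[OF assms, of w]
    by (simp add: sum_distrib_left sum_distrib_right mult.assoc) (intro sum.cong refl sum.swap)
  also have "\<dots> = (\<Sum>i\<in>UNIV. \<Sum>j\<in>UNIV. \<Sum>k\<in>UNIV. \<Sum>l\<in>UNIV.
      H $ l $ k * (D (axis i 1) $ l * v $ i) * cnj (D (axis j 1) $ k * w $ j))"
    by (rule sum_swap4)
  also have "\<dots> = sesq (\<chi> i j. \<Sum>k\<in>UNIV. (\<Sum>l\<in>UNIV. H $ l $ k * D (axis i 1) $ l) * cnj (D (axis j 1) $ k)) v w"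
    unfolding sesq_def by (simp add: sum_distrib_left sum_distrib_right mult_ac)
  finally show ?thesis .
qed

lemma sesq_axis: "sesq h (axis i 1) (axis j 1) = h $ i $ j"
proof -
  have "(\<Sum>b\<in>UNIV. h $ a $ b * axis i 1 $ a * cnj (axis j 1 $ b)) = (if a = i then h $ a $ j else 0)" for a
    by (simp add: axis_def if_distrib[of cnj] if_distrib[of "(*) _"] cong: if_cong)
  then show ?thesis unfolding sesq_def by simp
qed

text \<open>No second derivatives of \<open>T\<close> appear: the first differentiation produces
  conjugates of the Jacobian entries, and these are killed by \<open>dz\<close>.\<close>

lemma ddbar_compose:
  fixes F :: "complex^'m \<Rightarrow> complex" and T :: "complex^'n \<Rightarrow> complex^'m"
  assumes V: "open V" and W: "open W" and T: "holo_map_on V T" "T ` V \<subseteq> W"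
    and F: "smooth_on W F" and x: "x \<in> V"
  shows "sesq (ddbar (\<lambda>y. F (T y)) x) v w =
    sesq (ddbar F (T x)) (frechet_derivative T (at x) v) (frechet_derivative T (at x) w)"
proof -
  define J where "J = (\<lambda>k j y. frechet_derivative T (at y) (axis j 1) $ k)"
  have J: "clin_on V (J k j)" for k j
    unfolding J_def by (rule clin_on_jacobian[OF V T(1)])
  have dbar: "dzbar j (\<lambda>y. F (T y)) y = (\<Sum>k\<in>UNIV. dzbar k F (T y) * cnj (J k j y))" if "y \<in> V" for j y
    unfolding J_def
    by (rule dz_compose(2)[OF holo_map_onD[OF T(1) that] smooth_on_differentiable[OF F]]) (use T(2) that in auto)
  have sm: "smooth_on W (dzbar k F)" for k by (rule smooth_on_dz(2)[OF W F])
  have Tx: "T x \<in> W" using T(2) x by auto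
  have diff: "(\<lambda>y. dzbar k F (T y)) differentiable at x" for k
  proof -
    have "((\<lambda>y. dzbar k F (T y)) has_derivative (\<lambda>u. frechet_derivative (dzbar k F) (at (T x)) (frechet_derivative T (at x) u))) (at x)"
      using diff_chain_at[OF holo_map_onD(1)[OF T(1) x] smooth_on_has_derivative[OF sm Tx]] by (simp add: o_def)
    then show ?thesis unfolding differentiable_def by blast
  qed
  have "ddbar (\<lambda>y. F (T y)) x $ i $ j = (\<Sum>k\<in>UNIV. (\<Sum>l\<in>UNIV. ddbar F (T x) $ l $ k * J l i x) * cnj (J k j x))" for i j
  proof -
    have "dz i (dzbar j (\<lambda>y. F (T y))) x = dz i (\<lambda>y. \<Sum>k\<in>UNIV. dzbar k F (T y) * cnj (J k j y)) x"
      by (rule dz_cong(1)[OF V x dbar])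
    also have "\<dots> = (\<Sum>k\<in>UNIV. dz i (\<lambda>y. dzbar k F (T y) * cnj (J k j y)) x)"
      by (rule dz_sum, rule differentiable_mult[OF diff dz_cnj_clin(2)[OF J x]])
    also have "\<dots> = (\<Sum>k\<in>UNIV. dz i (\<lambda>y. dzbar k F (T y)) x * cnj (J k j x))"
      by (simp add: dz_mult[OF diff dz_cnj_clin(2)[OF J x]] dz_cnj_clin(1)[OF J x])
    also have "\<dots> = (\<Sum>k\<in>UNIV. (\<Sum>l\<in>UNIV. dz l (dzbar k F) (T x) * J l i x) * cnj (J k j x))"
      unfolding J_def
      by (simp only: dz_compose(1)[OF holo_map_onD[OF T(1) x] smooth_on_differentiable[OF sm Tx]])
    finally show ?thesis by (simp add: ddbar_def)
  qed
  then have "ddbar (\<lambda>y. F (T y)) x = (\<chi> i j. \<Sum>k\<in>UNIV. (\<Sum>l\<in>UNIV. ddbar F (T x) $ l $ k * J l i x) * cnj (J k j x))"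
    by (simp add: vec_eq_iff)
  then show ?thesis
    unfolding sesq_pullback[OF holo_map_onD(2)[OF T(1) x]] J_def by simp
qed

lemma ddbar_add:
  assumes "open V" "smooth_on V F" "smooth_on V G" "x \<in> V"
  shows "ddbar (\<lambda>y. F y + G y) x = ddbar F x + ddbar G x"
proof -
  have "dz i (dzbar j (\<lambda>y. F y + G y)) x = dz i (dzbar j F) x + dz i (dzbar j G) x" for i j
  proof -
    have "dz i (dzbar j (\<lambda>y. F y + G y)) x = dz i (\<lambda>y. dzbar j F y + dzbar j G y) x"
      by (rule dz_cong(1)[OF assms(1,4)])
         (rule dz_add(2)[OF smooth_on_differentiable[OF assms(2)] smooth_on_differentiable[OF assms(3)]])
    then show ?thesis
      by (simp add: dz_add(1)[OF smooth_on_differentiable[OF smooth_on_dz(2)[OF assms(1,2)] assms(4)]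
         smooth_on_differentiable[OF smooth_on_dz(2)[OF assms(1,3)] assms(4)]])
  qed
  then show ?thesis by (simp add: ddbar_def vec_eq_iff)
qed

lemma ddbar_cong:
  assumes "open S" "x \<in> S" "\<And>y. y \<in> S \<Longrightarrow> F y = G y"
  shows "ddbar F x = ddbar G x"
proof -
  have "dz i (dzbar j F) x = dz i (dzbar j G) x" for i j
    by (rule dz_cong(1)[OF assms(1,2)], rule dz_cong(2)[OF assms(1) _ assms(3)])
  then show ?thesis by (simp add: ddbar_def vec_eq_iff)
qed

text \<open>Pluriharmonicity of \<open>ln |F|^2\<close> without choosing a branch of the logarithm:
  its \<open>dzbar\<close> derivative is the conjugate of the logarithmic derivative
  \<open>a j\<close> of \<open>F\<close>, which is holomorphic.\<close>

lemma ddbar_ln_norm_clin: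
  assumes V: "open V" and F: "clin_on V F" and nz: "\<And>y. y \<in> V \<Longrightarrow> F y \<noteq> 0" and x: "x \<in> V"
  shows "ddbar (\<lambda>y. complex_of_real (ln ((cmod (F y))\<^sup>2))) x = 0"
proof -
  define a where "a = (\<lambda>j y. frechet_derivative F (at y) (axis j 1) * inverse (F y))"
  have a: "clin_on V (a j)" for j
    unfolding a_def by (intro clin_on_mult clin_on_inverse clin_on_directional_derivative V F nz)
  have "dzbar j (\<lambda>y. complex_of_real (ln ((cmod (F y))\<^sup>2))) y = cnj (a j y)" if y: "y \<in> V" for j y
  proof -
    let ?D = "frechet_derivative F (at y)"
    have eq: "(cmod (F y))\<^sup>2 = Re (F y) * Re (F y) + Im (F y) * Im (F y)" for y
      unfolding cmod_power2 by (simp only: power2_eq_square)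
    have pos: "Re (F y) * Re (F y) + Im (F y) * Im (F y) > 0"
      using nz[OF y] unfolding eq[symmetric] by simp
    have F': "(F has_derivative ?D) (at y)" by (rule clin_onD(1)[OF F y])
    define m where "m = inverse ((cmod (F y))\<^sup>2)"
    have der: "((\<lambda>y. complex_of_real (ln ((cmod (F y))\<^sup>2))) has_derivative
       (\<lambda>v. complex_of_real ((2 * (Re (F y) * Re (?D v) + Im (F y) * Im (?D v))) * m))) (at y)"
      unfolding m_def eq
      by (rule derivative_eq_intros has_derivative_ln F' bounded_linear.has_derivative[OF bounded_linear_Re]
           bounded_linear.has_derivative[OF bounded_linear_Im] pos refl | simp add: algebra_simps)+
    show ?thesis
    proof -
      have "axis j \<i> = \<i> *s axis j (1::complex)"
        by (simp add: vec_eq_iff axis_def)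
      then have i: "?D (axis j \<i>) = \<i> * ?D (axis j 1)" by (simp add: clin_onD(2)[OF F y])
      have inv: "inverse (F y) = cnj (F y) * of_real m"
        unfolding m_def using nz[OF y] by (simp add: of_real_inverse complex_norm_square field_simps del: of_real_power)
      show ?thesis
        unfolding dz_has_derivative(2)[OF der, of j] i a_def inv
        by (simp add: complex_eq_iff field_simps)
    qed
  qed
  then have "dz i (dzbar j (\<lambda>y. complex_of_real (ln ((cmod (F y))\<^sup>2)))) x = dz i (\<lambda>y. cnj (a j y)) x" for i j
    by (rule dz_cong(1)[OF V x])
  then show ?thesis by (simp add: ddbar_def vec_eq_iff dz_cnj_clin(1)[OF a x])
qed

lemma sesq_eq_imp_matrix_eq: "(\<And>v w. sesq h v w = sesq h' v w) \<Longrightarrow> h = h'"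
  by (simp add: vec_eq_iff flip: sesq_axis)

lemma det_cnj: "det (\<chi> i j. cnj (h $ i $ j)) = cnj (det h)"
  unfolding det_def by simp

text \<open>The two determinants differ by the factor \<open>|det J|^2\<close> with \<open>J\<close>
  the holomorphic Jacobian matrix; its logarithm is pluriharmonic, so the Ricci tensor transforms
  like the metric.\<close>

lemma ddbar_ln_det_transform:
  fixes T :: "complex^'n \<Rightarrow> complex^'n"
  assumes V: "open V" and W: "open W" and T: "holo_map_on V T" "T ` V \<subseteq> W"
    and sm: "\<And>i j. smooth_on W (\<lambda>y. h y $ i $ j)" and sm': "\<And>i j. smooth_on V (\<lambda>y. h' y $ i $ j)"
    and h: "\<And>y. y \<in> W \<Longrightarrow> 0 < Re (det (h y))" and h': "\<And>y. y \<in> V \<Longrightarrow> 0 < Re (det (h' y))"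
    and pull: "\<And>y v w. y \<in> V \<Longrightarrow> sesq (h' y) v w =
        sesq (h (T y)) (frechet_derivative T (at y) v) (frechet_derivative T (at y) w)"
    and x: "x \<in> V"
  shows "sesq (ddbar (\<lambda>y. complex_of_real (ln (Re (det (h' y))))) x) v w =
     sesq (ddbar (\<lambda>y. complex_of_real (ln (Re (det (h y))))) (T x))
       (frechet_derivative T (at x) v) (frechet_derivative T (at x) w)"
proof -
  define Jm :: "complex^'n \<Rightarrow> complex^'n^'n" where
    "Jm = (\<lambda>y. \<chi> k j. frechet_derivative T (at y) (axis j 1) $ k)"
  define \<delta> where "\<delta> = (\<lambda>y. det (Jm y))"
  have \<delta>: "clin_on V \<delta>"
    unfolding \<delta>_def det_def Jm_def
    by (intro clin_on_sum clin_on_mult clin_on_prod clin_on_const)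
       (simp add: clin_on_jacobian[OF V T(1)])
  have det: "det (h' y) = det (h (T y)) * of_real ((cmod (\<delta> y))\<^sup>2)" if "y \<in> V" for y
  proof -
    have "h' y = (\<chi> i j. \<Sum>k\<in>UNIV. (\<Sum>l\<in>UNIV. h (T y) $ l $ k * Jm y $ l $ i) * cnj (Jm y $ k $ j))"
      by (rule sesq_eq_imp_matrix_eq)
         (simp add: pull[OF that] sesq_pullback[OF holo_map_onD(2)[OF T(1) that]] Jm_def)
    also have "\<dots> = transpose (Jm y) ** h (T y) ** (\<chi> i j. cnj (Jm y $ i $ j))"
      by (simp add: matrix_matrix_mult_def transpose_def vec_eq_iff mult.commute)
    finally have "det (h' y) = \<delta> y * det (h (T y)) * cnj (\<delta> y)"
      by (simp add: det_mul det_cnj \<delta>_def)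
    then show ?thesis by (simp only: complex_norm_square mult_ac)
  qed
  have nz: "\<delta> y \<noteq> 0" if "y \<in> V" for y
    using det[OF that] h'[OF that] by auto
  have ln: "complex_of_real (ln (Re (det (h' y)))) =
      complex_of_real (ln (Re (det (h (T y))))) + complex_of_real (ln ((cmod (\<delta> y))\<^sup>2))" if "y \<in> V" for y
  proof -
    have "Re (det (h (T y))) > 0" using h T(2) that by blast
    moreover have "(cmod (\<delta> y))\<^sup>2 > 0" using nz[OF that] by simp
    ultimately show ?thesis
      unfolding det[OF that] by (simp add: ln_mult del: of_real_power)
  qed
  define q where "q = (\<lambda>y. complex_of_real (ln (Re (det (h y)))))"
  have q: "smooth_on W q"
    unfolding q_def
    by (intro smooth_on_bounded_linear[OF W bounded_linear_of_real] smooth_on_ln[OF W] h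
        smooth_on_bounded_linear[OF W bounded_linear_Re] smooth_on_det[OF W] sm)
  have q': "smooth_on V (\<lambda>y. complex_of_real (ln (Re (det (h' y)))))"
    by (intro smooth_on_bounded_linear[OF V bounded_linear_of_real] smooth_on_ln[OF V] h'
        smooth_on_bounded_linear[OF V bounded_linear_Re] smooth_on_det[OF V] sm')
  define p where "p = (\<lambda>y. complex_of_real (ln ((cmod (\<delta> y))\<^sup>2)))"
  have p: "smooth_on V p"
  proof -
    have "smooth_on V (\<lambda>y. Re (\<delta> y) * Re (\<delta> y) + Im (\<delta> y) * Im (\<delta> y))"
      by (intro smooth_on_add smooth_on_mult smooth_on_bounded_linear[OF V bounded_linear_Re]
          smooth_on_bounded_linear[OF V bounded_linear_Im] clin_on_smooth V \<delta>)
    then have "smooth_on V (\<lambda>y. (cmod (\<delta> y))\<^sup>2)"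
      by (elim smooth_on_cong[OF V]) (simp only: cmod_power2, simp only: power2_eq_square)
    then show ?thesis
      unfolding p_def
      by (intro smooth_on_bounded_linear[OF V bounded_linear_of_real] smooth_on_ln[OF V]) (use nz in auto)
  qed
  \<comment> \<open>Smoothness of the composite is read off from the other two terms of
    \<open>ln\<close>, which avoids a chain rule for \<open>smooth_on\<close>.\<close>
  have qT: "smooth_on V (\<lambda>y. q (T y))"
    by (rule smooth_on_cong[OF V smooth_on_add[OF V q' smooth_on_mult[OF V smooth_on_const[of V "-1"] p]]])
       (simp add: ln q_def p_def)
  have "ddbar (\<lambda>y. complex_of_real (ln (Re (det (h' y))))) x = ddbar (\<lambda>y. q (T y) + p y) x"
    by (rule ddbar_cong[OF V x]) (simp only: ln q_def p_def)
  also have "\<dots> = ddbar (\<lambda>y. q (T y)) x"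
    using ddbar_ln_norm_clin[OF V \<delta> nz x] unfolding ddbar_add[OF V qT p x] by (simp add: p_def)
  finally show ?thesis
    using ddbar_compose[OF V W T q x] by (simp add: q_def)
qed

text \<open>The segment \<open>M\<close> from the identity to \<open>h\<close> consists of positive
  definite, hence invertible, Hermitian matrices. Their determinants are real, depend continuously
  on the parameter and never vanish, so the sign at the identity persists.\<close>

lemma det_pos_def:
  fixes h :: "complex^'n^'n"
  assumes herm: "\<And>i j. h $ j $ i = cnj (h $ i $ j)"
    and pos: "\<And>v. v \<noteq> 0 \<Longrightarrow> 0 < Re (sesq h v v)"
  shows "0 < Re (det h)" "Im (det h) = 0"
proof -
  define M :: "real \<Rightarrow> complex^'n^'n" where
    "M = (\<lambda>s. \<chi> i j. of_real (1 - s) * (if i = j then 1 else 0) + of_real s * h $ i $ j)"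
  have real: "Im (det (M s)) = 0" for s
  proof -
    have "transpose (M s) = (\<chi> i j. cnj (M s $ i $ j))"
      by (simp add: M_def transpose_def vec_eq_iff herm[symmetric])
    then have "det (transpose (M s)) = cnj (det (M s))" by (simp only: det_cnj)
    then have "det (M s) = cnj (det (M s))" by (simp only: det_transpose)
    then show ?thesis by (simp add: complex_eq_iff)
  qed
  have sesq_M: "sesq (M s) v v = of_real (1 - s) * of_real ((norm v)\<^sup>2) + of_real s * sesq h v v" for s v
  proof -
    have "complex_of_real ((norm v)\<^sup>2) = (\<Sum>i\<in>UNIV. v $ i * cnj (v $ i))"
      by (simp add: norm_vec_def L2_set_def sum_nonneg complex_norm_square del: of_real_power)
    also have "\<dots> = (\<Sum>i\<in>UNIV. \<Sum>j\<in>UNIV. (if i = j then 1 else 0) * v $ i * cnj (v $ j))"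
      by (simp add: if_distrib[of "\<lambda>x. x * _"] cong: if_cong)
    finally have "complex_of_real ((norm v)\<^sup>2) = \<dots>" .
    then show ?thesis
      unfolding sesq_def M_def
      by (simp only: sum_distrib_left sum.distrib[symmetric] vec_lambda_beta distrib_right mult.assoc)
  qed
  have nz: "det (M s) \<noteq> 0" if s: "0 \<le> s" "s \<le> 1" for s
  proof
    assume "det (M s) = 0"
    then have "\<not> invertible (transpose (M s))" by (simp add: invertible_det_nz)
    then obtain v where v: "v \<noteq> 0" "transpose (M s) *v v = 0"
      using invertible_left_inverse[of "transpose (M s)"] matrix_left_invertible_ker[of "transpose (M s)"] by blast
    have "sesq (M s) v v = (\<Sum>j\<in>UNIV. (transpose (M s) *v v) $ j * cnj (v $ j))"
      unfolding sesq_def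
      by (subst sum.swap) (simp add: matrix_vector_mult_def transpose_def sum_distrib_right)
    also have "\<dots> = 0" using v(2) by simp
    finally have "Re (sesq (M s) v v) = 0" by simp
    moreover have "Re (sesq (M s) v v) > 0"
    proof (cases "s = 0")
      case True
      then show ?thesis using v(1) by (simp add: sesq_M)
    next
      case False
      then have "s * Re (sesq h v v) > 0" using s pos[OF v(1)] by simp
      moreover have "(1 - s) * (norm v)\<^sup>2 \<ge> 0" using s by simp
      ultimately show ?thesis by (simp add: sesq_M flip: of_real_power)
    qed
    ultimately show False by simp
  qed
  have "continuous_on {0..1} (\<lambda>s. Re (det (M s)))"
    unfolding det_def M_def by (intro continuous_intros continuous_on_Re)
  moreover have M0: "M 0 = mat 1" by (simp add: M_def mat_def vec_eq_iff)
  moreover have M1: "M 1 = h" by (simp add: M_def vec_eq_iff)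
  ultimately show "0 < Re (det h)"
  proof -
    have "False" if "Re (det (M 1)) \<le> 0"
    proof -
      have "\<exists>s\<ge>0. s \<le> 1 \<and> Re (det (M s)) = 0"
        by (rule IVT2') (use that M0 \<open>continuous_on _ _\<close> in auto)
      then obtain s where "0 \<le> s" "s \<le> 1" "Re (det (M s)) = 0" by blast
      with nz[of s] real[of s] show False by (simp add: complex_eq_iff)
    qed
    then show ?thesis using M1 by force
  qed
  show "Im (det h) = 0" using real[of 1] M1 by simp
qed

section \<open>Radial profiles\<close>

text \<open>The device by which identities between profile functions are differentiated
  throughout.\<close>

lemma DERIV_eq_on_open:
  fixes f g :: "real \<Rightarrow> real"
  assumes "open J" "t \<in> J" "\<And>t. t \<in> J \<Longrightarrow> f t = g t"
    "(f has_real_derivative a) (at t)" "(g has_real_derivative b) (at t)"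
  shows "a = b"
proof -
  have "(g has_real_derivative a) (at t)"
    by (rule has_field_derivative_transform_within_open[OF assms(4,1,2,3)])
  then show ?thesis using assms(5) DERIV_unique by blast
qed

lemma DERIV_zero_constant_on:
  fixes f :: "real \<Rightarrow> real"
  assumes "connected J" "open J" "\<And>t. t \<in> J \<Longrightarrow> (f has_real_derivative 0) (at t)"
  obtains c where "\<And>t. t \<in> J \<Longrightarrow> f t = c"
proof -
  have "convex J" using assms(1) is_interval_connected_1 is_interval_convex_1 by blast
  then have "\<exists>c. \<forall>t\<in>J. f t = c"
    by (rule has_field_derivative_zero_constant) (use assms(3) has_field_derivative_at_within in blast)
  then show ?thesis using that by blast
qed

text \<open>The variable is \<open>t = ln r\<close>; \<open>y = r f'(r)\<close>, \<open>\<sigma>\<close> is its counterpart for the Ricci tensor, and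
  \<open>y1, y2, \<sigma>1, \<dots>\<close> are derivatives with respect to \<open>t\<close>.  For \<open>n = 1\<close> the sign of \<open>y\<close> is not determined
  by the metric.\<close>
locale radial_profile =
  fixes n :: nat and I :: "real set" and y y1 y2 \<sigma> \<sigma>1 \<sigma>2 \<sigma>3 :: "real \<Rightarrow> real"
  assumes n: "1 \<le> n" and I: "open I" "connected I" "I \<noteq> {}"
    and y: "\<And>t. t \<in> I \<Longrightarrow> (y has_real_derivative y1 t) (at t)"
    and y1: "\<And>t. t \<in> I \<Longrightarrow> (y1 has_real_derivative y2 t) (at t)"
    and \<sigma>: "\<And>t. t \<in> I \<Longrightarrow> (\<sigma> has_real_derivative \<sigma>1 t) (at t)"
    and \<sigma>1: "\<And>t. t \<in> I \<Longrightarrow> (\<sigma>1 has_real_derivative \<sigma>2 t) (at t)"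
    and \<sigma>2: "\<And>t. t \<in> I \<Longrightarrow> (\<sigma>2 has_real_derivative \<sigma>3 t) (at t)"
    and y1_pos: "\<And>t. t \<in> I \<Longrightarrow> y1 t > 0"
    and y_pos: "\<And>t. 2 \<le> n \<Longrightarrow> t \<in> I \<Longrightarrow> y t > 0"
    and \<sigma>_eq: "\<And>t. t \<in> I \<Longrightarrow> \<sigma> t * y1 t = real n * y1 t - (real n - 1) * (y1 t)\<^sup>2 / y t - y2 t"
begin

text \<open>The scalar curvature as a function of \<open>t\<close>: the trace of the Ricci tensor
  with respect to the metric, with tangential ratio \<open>\<sigma> / y\<close> and radial ratio
  \<open>\<sigma>1 / y1\<close>. For \<open>n = 1\<close> the first summand is 0 whatever
  \<open>y t\<close> is.\<close>

definition sc :: "real \<Rightarrow> real" where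
  "sc t = (real n - 1) * \<sigma> t / y t + \<sigma>1 t / y1 t"

text \<open>The two equations compare the radial and the tangential eigenvalues; the latter exist
  from dimension two on.\<close>

definition einstein :: "real \<Rightarrow> bool" where
  "einstein l \<longleftrightarrow> (\<forall>t\<in>I. \<sigma>1 t = l * y1 t \<and> (2 \<le> n \<longrightarrow> \<sigma> t = l * y t))"

text \<open>If the polynomials differed, \<open>y\<close> would map the interval into a finite set
  of roots and be constant, against \<open>y1 > 0\<close>.\<close>

lemma poly_profile_eq:
  assumes J: "open J" "connected J" "J \<noteq> {}" "J \<subseteq> I"
    and eq: "\<And>t. t \<in> J \<Longrightarrow> poly p (y t) = poly q (y t)"
  shows "p = q"
proof (rule ccontr)
  assume "p \<noteq> q"
  then have "finite {x. poly (p - q) x = 0}" by (intro poly_roots_finite) auto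
  moreover have "y ` J \<subseteq> {x. poly (p - q) x = 0}" using eq by auto
  ultimately have "finite (y ` J)" by (rule rev_finite_subset)
  moreover have "continuous_on J y"
    by (intro continuous_at_imp_continuous_on ballI DERIV_isCont[OF y]) (use J(4) in auto)
  ultimately have "y constant_on J" using continuous_finite_range_constant[OF J(2)] by blast
  then obtain c where c: "\<And>t. t \<in> J \<Longrightarrow> y t = c" unfolding constant_on_def by blast
  obtain t where t: "t \<in> J" using J(3) by blast
  have "y1 t = 0"
    by (rule DERIV_eq_on_open[OF J(1) t c y]) (use t J(4) in auto)
  then show False using y1_pos[of t] t J(4) by auto
qed

lemma poly_profile_eqI:
  assumes "\<And>t. t \<in> I \<Longrightarrow> poly p (y t) = poly q (y t)"
  shows "p = q"
  by (rule poly_profile_eq[OF I]) (use assms in auto)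

lemma y2_eq:
  assumes "t \<in> I" "2 \<le> n"
  shows "y2 t * y t = real n * y1 t * y t - (real n - 1) * (y1 t)\<^sup>2 - \<sigma> t * y1 t * y t"
  using \<sigma>_eq[OF assms(1)] y_pos[OF assms(2,1)] by (simp add: field_simps)

lemma einsteinI:
  assumes "2 \<le> n" "\<And>t. t \<in> I \<Longrightarrow> \<sigma> t = l * y t"
  shows "einstein l"
  unfolding einstein_def
proof (intro ballI conjI impI assms(2))
  fix t assume t: "t \<in> I"
  show "\<sigma>1 t = l * y1 t"
    by (rule DERIV_eq_on_open[OF I(1) t assms(2) \<sigma>[OF t]]) (auto intro!: derivative_eq_intros y t)
qed

lemma einsteinI_dim_one:
  assumes "n = 1" "\<And>t. t \<in> I \<Longrightarrow> \<sigma> t = l * y t + e"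
  shows "einstein l"
  unfolding einstein_def
proof (intro ballI conjI impI)
  fix t assume t: "t \<in> I"
  show "\<sigma>1 t = l * y1 t"
    by (rule DERIV_eq_on_open[OF I(1) t assms(2) \<sigma>[OF t]]) (auto intro!: derivative_eq_intros y t)
qed (use assms(1) in auto)

text \<open>A \<open>k\<close>-th root cannot be taken directly, since \<open>\<sigma>\<close> may
  have either sign. But \<open>\<sigma> / y\<close> is continuous on an interval with values among
  the finitely many roots of \<open>x ^ k = c\<close>, hence constant.\<close>

lemma einstein_of_power:
  assumes k: "1 \<le> k" "k \<le> n" and eq: "\<And>t. t \<in> I \<Longrightarrow> \<sigma> t ^ k * y t ^ (n - k) = c * y t ^ n"
  shows "\<exists>l. einstein l"
proof (cases "n = 1")
  case True
  then show ?thesis using k eq by (intro exI[of _ c] einsteinI_dim_one[where e = 0]) auto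
next
  case False
  with n have n2: "2 \<le> n" by auto
  have pow: "(\<sigma> t / y t) ^ k = c" if "t \<in> I" for t
  proof -
    have "y t ^ n = y t ^ k * y t ^ (n - k)" using k by (simp flip: power_add)
    then show ?thesis using eq[OF that] y_pos[OF n2 that] by (simp add: power_divide field_simps)
  qed
  have "[:-c:] + monom 1 k \<noteq> (0 :: real poly)"
  proof
    assume "[:-c:] + monom 1 k = (0 :: real poly)"
    then have "coeff ([:-c:] + monom 1 k) k = (0 :: real)" by simp
    then show False using k by (cases k) (auto simp: coeff_pCons)
  qed
  then have "finite {x. poly ([:-c:] + monom 1 k) x = 0}" by (rule poly_roots_finite)
  then have "finite ((\<lambda>t. \<sigma> t / y t) ` I)"
    by (rule rev_finite_subset) (auto simp: poly_monom pow)
  moreover have "continuous_on I (\<lambda>t. \<sigma> t / y t)"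
  proof (intro continuous_on_divide ballI)
    show "continuous_on I \<sigma>" by (intro continuous_at_imp_continuous_on ballI DERIV_isCont[OF \<sigma>])
    show "continuous_on I y" by (intro continuous_at_imp_continuous_on ballI DERIV_isCont[OF y])
    show "y t \<noteq> 0" if "t \<in> I" for t using y_pos[OF n2 that] by simp
  qed
  ultimately have "(\<lambda>t. \<sigma> t / y t) constant_on I"
    using continuous_finite_range_constant[OF I(2)] by blast
  then obtain l where l: "\<And>t. t \<in> I \<Longrightarrow> \<sigma> t / y t = l" unfolding constant_on_def by blast
  have "einstein l"
  proof (rule einsteinI[OF n2])
    show "\<sigma> t = l * y t" if "t \<in> I" for t using l[OF that] y_pos[OF n2 that] by (simp add: field_simps)
  qed
  then show ?thesis by blast
qed

section \<open>First integrals of the curvature conditions\<close>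

lemma constant_curvature_integral:
  assumes k: "1 \<le> k" "k \<le> n"
    and eq: "\<And>t. t \<in> I \<Longrightarrow> a * y t ^ (n - 1) * y1 t =
      real ((n - 1) choose k) * y t ^ (n - 1 - k) * \<sigma> t ^ k * y1 t
      + real ((n - 1) choose (k - 1)) * y t ^ (n - k) * \<sigma> t ^ (k - 1) * \<sigma>1 t"
  obtains c d where "\<And>t. t \<in> I \<Longrightarrow> \<sigma> t ^ k * y t ^ (n - k) = c * y t ^ n + d"
proof -
  \<comment> \<open>The absorption identities below turn \<open>n\<close> times either binomial
    coefficient into \<open>B\<close> times an exponent of the product
    \<open>\<sigma> ^ k * y ^ (n - k)\<close>, so the right-hand side of \<open>eq\<close> becomes
    an exact derivative.\<close>
  define B where "B = real (n choose k)"
  have B: "B > 0" using k by (simp add: B_def)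
  have b1: "real n * real ((n - 1) choose k) = real (n - k) * B"
  proof -
    have "n * ((n - 1) choose k) = (n - k) * (n choose k)"
      using binomial_absorb_comp[of n k] by simp
    then show ?thesis unfolding B_def by (metis of_nat_mult)
  qed
  have b2: "real n * real ((n - 1) choose (k - 1)) = real k * B"
  proof -
    have "k * (n choose k) = n * ((n - 1) choose (k - 1))"
      using binomial_absorption[of "k - 1" n] k by simp
    then show ?thesis unfolding B_def by (metis of_nat_mult)
  qed
  have "((\<lambda>t. \<sigma> t ^ k * y t ^ (n - k) - a / B * y t ^ n) has_real_derivative 0) (at t)" if t: "t \<in> I" for t
  proof -
    have "B * (real k * \<sigma> t ^ (k - 1) * \<sigma>1 t * y t ^ (n - k) + \<sigma> t ^ k * (real (n - k) * y t ^ (n - k - 1) * y1 t))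
      = real n * (a * y t ^ (n - 1) * y1 t)"
    proof -
      have "real n * (a * y t ^ (n - 1) * y1 t) =
         (real n * real ((n - 1) choose k)) * y t ^ (n - 1 - k) * \<sigma> t ^ k * y1 t
         + (real n * real ((n - 1) choose (k - 1))) * y t ^ (n - k) * \<sigma> t ^ (k - 1) * \<sigma>1 t"
        unfolding eq[OF t] by (simp add: algebra_simps)
      then show ?thesis unfolding b1 b2 by (simp add: algebra_simps)
    qed
    then have e: "real k * \<sigma> t ^ (k - 1) * \<sigma>1 t * y t ^ (n - k) + \<sigma> t ^ k * (real (n - k) * y t ^ (n - k - 1) * y1 t)
       = a / B * (real n * y t ^ (n - 1) * y1 t)"
      using B by (simp add: field_simps)
    show ?thesis
      by (rule derivative_eq_intros \<sigma>[OF t] y[OF t] refl)+ (use e in \<open>simp add: algebra_simps\<close>)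
  qed
  then obtain d where "\<And>t. t \<in> I \<Longrightarrow> \<sigma> t ^ k * y t ^ (n - k) - a / B * y t ^ n = d"
    using DERIV_zero_constant_on[OF I(2,1)] by blast
  then have "\<And>t. t \<in> I \<Longrightarrow> \<sigma> t ^ k * y t ^ (n - k) = a / B * y t ^ n + d" by (simp add: algebra_simps)
  then show ?thesis using that by blast
qed

text \<open>Multiplying by \<open>y ^ (n - 1) * y1\<close> makes \<open>sc\<close> the derivative of
  \<open>\<sigma> * y ^ (n - 1)\<close>. With that known, \<open>\<sigma>_eq\<close> is an exact
  equation for \<open>y1 * y ^ (n - 1)\<close>, giving a second integration. The clause for
  \<open>n = 1\<close> serves the soliton relation that involves \<open>t\<close>
  explicitly.\<close>

lemma extremal_integral:
  assumes "\<And>t. t \<in> I \<Longrightarrow> sc t = \<alpha> * y t + \<beta>"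
  obtains a b c d where
    "\<And>t. t \<in> I \<Longrightarrow> \<sigma> t * y t ^ (n - 1) = a * y t ^ (n + 1) + b * y t ^ n + c"
    "\<And>t. t \<in> I \<Longrightarrow> y1 t * y t ^ (n - 1) =
       y t ^ n - a / (n + 2) * y t ^ (n + 2) - b / (n + 1) * y t ^ (n + 1) - c * y t - d"
    "n = 1 \<longrightarrow> (\<forall>t\<in>I. \<sigma>1 t = (2 * a * y t + b) * y1 t)"
proof -
  \<comment> \<open>The divisors arise from integrating \<open>y ^ n * y1\<close> and
    \<open>y ^ (n - 1) * y1\<close>.\<close>
  define a b where "a = \<alpha> / (n + 1)" and "b = \<beta> / n"
  have "((\<lambda>t. \<sigma> t * y t ^ (n - 1) - (a * y t ^ (n + 1) + b * y t ^ n)) has_real_derivative 0) (at t)"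
    if t: "t \<in> I" for t
  proof -
    have "\<sigma>1 t * y t ^ (n - 1) + \<sigma> t * (real (n - 1) * y t ^ (n - 1 - 1) * y1 t) = y t ^ (n - 1) * y1 t * sc t"
    proof (cases "n = 1")
      case True
      then show ?thesis unfolding sc_def using y1_pos[OF t] by simp
    next
      case False
      then have n2: "2 \<le> n" using n by auto
      then have "y t ^ (n - 1) = y t * y t ^ (n - 1 - 1)" by (cases "n - 1") auto
      then show ?thesis unfolding sc_def using y1_pos[OF t] y_pos[OF n2 t] n by (simp add: field_simps of_nat_diff)
    qed
    also have "\<dots> = y t ^ (n - 1) * y1 t * (a * (n + 1) * y t + b * n)"
      using assms[OF t] n by (simp add: a_def b_def)
    also have "\<dots> = a * (real (n + 1) * y t ^ n * y1 t) + b * (real n * y t ^ (n - 1) * y1 t)"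
    proof -
      have "y t ^ n = y t * y t ^ (n - 1)" using n by (cases n) auto
      then show ?thesis by (simp add: algebra_simps)
    qed
    finally have e: "\<sigma>1 t * y t ^ (n - 1) + \<sigma> t * (real (n - 1) * y t ^ (n - 1 - 1) * y1 t) = \<dots>" .
    show ?thesis
      by (rule derivative_eq_intros \<sigma>[OF t] y[OF t] refl)+ (use e in \<open>simp add: algebra_simps\<close>)
  qed
  then obtain c where "\<And>t. t \<in> I \<Longrightarrow> \<sigma> t * y t ^ (n - 1) - (a * y t ^ (n + 1) + b * y t ^ n) = c"
    using DERIV_zero_constant_on[OF I(2,1)] by blast
  then have u: "\<sigma> t * y t ^ (n - 1) = a * y t ^ (n + 1) + b * y t ^ n + c" if "t \<in> I" for t
    using that by (smt (verit))
  have "((\<lambda>t. y1 t * y t ^ (n - 1) - (y t ^ n - a / (n + 2) * y t ^ (n + 2) - b / (n + 1) * y t ^ (n + 1) - c * y t))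
    has_real_derivative 0) (at t)" if t: "t \<in> I" for t
  proof -
    \<comment> \<open>Start of the second integration: the quadratic term in \<open>y1\<close> of
      \<open>\<sigma>_eq\<close> is the one produced by differentiating
      \<open>y ^ (n - 1)\<close>.\<close>
    have "y2 t * y t ^ (n - 1) + y1 t * (real (n - 1) * y t ^ (n - 1 - 1) * y1 t)
        = y1 t * (n * y t ^ (n - 1) - \<sigma> t * y t ^ (n - 1))"
    proof (cases "n = 1")
      case True
      then show ?thesis using \<sigma>_eq[OF t] by (simp add: algebra_simps)
    next
      case False
      then have n2: "2 \<le> n" using n by auto
      then have *: "y t ^ (n - 1) = y t * y t ^ (n - 1 - 1)" by (cases "n - 1") auto
      have "y2 t * (y t * y t ^ (n - 1 - 1)) = (y2 t * y t) * y t ^ (n - 1 - 1)" by simp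
      also have "\<dots> = (real n * y1 t * y t - (real n - 1) * (y1 t)\<^sup>2 - \<sigma> t * y1 t * y t) * y t ^ (n - 1 - 1)"
        by (simp only: y2_eq[OF t n2])
      finally show ?thesis unfolding * using n by (simp add: of_nat_diff power2_eq_square algebra_simps)
    qed
    also have "\<dots> = y1 t * (n * y t ^ (n - 1) - (a * y t ^ (n + 1) + b * y t ^ n + c))"
      by (simp only: u[OF t])
    also have "\<dots> = n * y t ^ (n - 1) * y1 t - a / (n + 2) * (real (n + 2) * y t ^ (n + 1) * y1 t)
        - b / (n + 1) * (real (n + 1) * y t ^ n * y1 t) - c * y1 t"
    proof -
      have "a / (n + 2) * (real (n + 2) * z) = a * z" "b / (n + 1) * (real (n + 1) * z) = b * z" for z :: real
        by (simp_all add: field_simps)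
      then show ?thesis by (simp only: mult.assoc) (simp add: algebra_simps)
    qed
    finally have e: "y2 t * y t ^ (n - 1) + y1 t * (real (n - 1) * y t ^ (n - 1 - 1) * y1 t) = \<dots>" .
    define a' b' where "a' = a / (n + 2)" and "b' = b / (n + 1)"
    note e = e[folded a'_def b'_def]
    show ?thesis
      unfolding a'_def[symmetric] b'_def[symmetric]
      by (rule derivative_eq_intros y1[OF t] y[OF t] refl)+ (use e in \<open>simp add: algebra_simps\<close>)
  qed
  then obtain d where "\<And>t. t \<in> I \<Longrightarrow> y1 t * y t ^ (n - 1) - (y t ^ n - a / (n + 2) * y t ^ (n + 2) - b / (n + 1) * y t ^ (n + 1) - c * y t) = d"
    using DERIV_zero_constant_on[OF I(2,1)] by blast
  then have v: "y1 t * y t ^ (n - 1) = y t ^ n - a / (n + 2) * y t ^ (n + 2) - b / (n + 1) * y t ^ (n + 1) - c * y t - (- d)" if "t \<in> I" for t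
    using that by (smt (verit))
  have "\<sigma>1 t = (2 * a * y t + b) * y1 t" if "n = 1" "t \<in> I" for t
    using assms[OF that(2), unfolded sc_def] y1_pos[OF that(2)] that(1) by (simp add: a_def b_def field_simps)
  with u v show ?thesis using that by blast
qed

text \<open>Taking the \<open>h\<close>-th power of one integral and the \<open>k\<close>-th power
  of the other eliminates \<open>\<sigma>\<close>. In the resulting identity of polynomials in
  \<open>y\<close> one side carries the surplus power \<open>n * (h - k) > 0\<close>, so at 0 it
  leaves \<open>d ^ h = 0\<close>.\<close>

lemma einstein_of_constant_curvatures:
  assumes hk: "1 \<le> k" "k < h" "h \<le> n"
    and k: "\<And>t. t \<in> I \<Longrightarrow> \<sigma> t ^ k * y t ^ (n - k) = c * y t ^ n + d"
    and h: "\<And>t. t \<in> I \<Longrightarrow> \<sigma> t ^ h * y t ^ (n - h) = c' * y t ^ n + d'"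
  shows "\<exists>l. einstein l"
proof -
  have "poly (([:d:] + monom c n) ^ h) (y t) = poly (monom 1 (n * (h - k)) * ([:d':] + monom c' n) ^ k) (y t)"
    if t: "t \<in> I" for t
  proof -
    have "(c * y t ^ n + d) ^ h = \<sigma> t ^ (k * h) * y t ^ ((n - k) * h)"
      unfolding k[OF t, symmetric] by (simp add: power_mult_distrib power_mult)
    moreover have "(c' * y t ^ n + d') ^ k = \<sigma> t ^ (k * h) * y t ^ ((n - h) * k)"
      unfolding h[OF t, symmetric] by (simp add: power_mult_distrib flip: power_mult) (simp add: mult.commute)
    moreover have "(n - k) * h = n * (h - k) + (n - h) * k"
      using hk by (simp add: diff_mult_distrib diff_mult_distrib2 mult.commute)
    ultimately show ?thesis by (simp add: poly_monom power_add add.commute)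
  qed
  then have "([:d:] + monom c n) ^ h = monom 1 (n * (h - k)) * ([:d':] + monom c' n) ^ k"
    by (rule poly_profile_eqI)
  then have "poly (([:d:] + monom c n) ^ h) 0 = poly (monom 1 (n * (h - k)) * ([:d':] + monom c' n) ^ k) 0" by simp
  then have "d ^ h = 0" using n hk by (simp add: poly_monom power_0_left)
  then have "d = 0" by simp
  then show ?thesis using einstein_of_power[of k c] hk k by simp
qed

text \<open>The \<open>k\<close>-th power of the extremal integral is compared with the curvature
  integral. Because \<open>k > 1\<close> the latter comes with a positive power of \<open>y\<close>,
  which forces \<open>e = 0\<close>; after cancelling common powers of \<open>y\<close> the value at
  0 gives \<open>d = 0\<close>.\<close>

lemma einstein_of_extremal_constant_curvature:
  assumes k: "1 < k" "k \<le> n"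
    and curv: "\<And>t. t \<in> I \<Longrightarrow> \<sigma> t ^ k * y t ^ (n - k) = c * y t ^ n + d"
    and ext: "\<And>t. t \<in> I \<Longrightarrow> sc t = \<alpha> * y t + \<beta>"
  shows "\<exists>l. einstein l"
proof -
  from extremal_integral[OF ext] obtain a b e where
    u: "\<And>t. t \<in> I \<Longrightarrow> \<sigma> t * y t ^ (n - 1) = a * y t ^ (n + 1) + b * y t ^ n + e" by metis
  have *: "(\<sigma> t * y t ^ (n - 1)) ^ k = (c * y t ^ n + d) * y t ^ (n * (k - 1))" if t: "t \<in> I" for t
  proof -
    have "(n - 1) * k = (n - k) + n * (k - 1)"
      using k by (simp add: diff_mult_distrib diff_mult_distrib2 mult.commute) 
    then show ?thesis
      unfolding curv[OF t, symmetric] by (simp add: power_mult_distrib flip: power_mult power_add)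
  qed
  have "poly ((monom a (n + 1) + monom b n + [:e:]) ^ k) (y t) = poly ((monom c n + [:d:]) * monom 1 (n * (k - 1))) (y t)"
    if "t \<in> I" for t
    using *[OF that] unfolding u[OF that] by (simp add: poly_monom add_ac)
  then have "(monom a (n + 1) + monom b n + [:e:]) ^ k = (monom c n + [:d:]) * monom 1 (n * (k - 1))"
    by (rule poly_profile_eqI)
  then have "poly ((monom a (n + 1) + monom b n + [:e:]) ^ k) 0 = poly ((monom c n + [:d:]) * monom 1 (n * (k - 1))) 0" by simp
  then have "e = 0" using n k by (simp add: poly_monom power_0_left)
  have n2: "2 \<le> n" using k by simp
  have "poly (monom 1 n * [:b, a:] ^ k) (y t) = poly (monom c n + [:d:]) (y t)" if t: "t \<in> I" for t
  proof -
    have "\<sigma> t * y t ^ (n - 1) = y t ^ n * (b + a * y t)"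
      using u[OF t] \<open>e = 0\<close> by (simp add: algebra_simps)
    then have "(c * y t ^ n + d) * y t ^ (n * (k - 1)) = y t ^ (n * k) * (b + a * y t) ^ k"
      using *[OF t] by (simp add: power_mult_distrib power_mult)
    also have "n * k = n + n * (k - 1)" using k by (cases k) auto
    finally have "(c * y t ^ n + d) * y t ^ (n * (k - 1)) = (y t ^ n * (b + a * y t) ^ k) * y t ^ (n * (k - 1))"
      by (simp add: power_add mult_ac)
    then have "c * y t ^ n + d = y t ^ n * (b + a * y t) ^ k" using y_pos[OF n2 t] by simp
    then show ?thesis by (simp add: poly_monom mult.commute)
  qed
  then have "monom 1 n * [:b, a:] ^ k = monom c n + [:d:]"
    by (rule poly_profile_eqI)
  then have "poly (monom 1 n * [:b, a:] ^ k) 0 = poly (monom c n + [:d:]) 0" by simp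
  then have "d = 0" using n by (simp add: poly_monom power_0_left)
  then show ?thesis using einstein_of_power[of k c] k curv by simp
qed

text \<open>The two shapes of \<open>\<sigma>\<close> that a soliton can have on an interval.  Nonzero constants \<open>\<sigma>\<close> have to be
  excluded from the first one when \<open>n \<ge> 2\<close>: they do satisfy the radial component of the soliton equation.\<close>
definition affine_profile :: "real set \<Rightarrow> bool" where
  "affine_profile J \<longleftrightarrow> (\<exists>l e. (2 \<le> n \<longrightarrow> l \<noteq> 0 \<or> e = 0) \<and> (\<forall>t\<in>J. \<sigma> t = l * y t + e))"

definition soliton_profile :: "real set \<Rightarrow> bool" where
  "soliton_profile J \<longleftrightarrow>
     (if n = 1 then \<exists>l \<kappa> b c. \<forall>t\<in>J. \<sigma> t = l * y t + y1 t * (\<kappa> * t + b) + c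
      else \<exists>l \<mu>. \<forall>t\<in>J. \<sigma> t = l * y t + \<mu> * y1 t)"

text \<open>The hypothesis says that \<open>1 / y\<close> is affine in \<open>t\<close>. This is the
  exceptional case that \<open>soliton_profile_cases\<close> runs into.\<close>

lemma inverse_affine_profile:
  assumes n2: "2 \<le> n" and J: "open J" "J \<subseteq> I" and t: "t \<in> J" and C: "\<And>t. t \<in> J \<Longrightarrow> y1 t = C * (y t)\<^sup>2"
  shows "\<sigma> t = real n - (real n + 1) * C * y t"
proof -
  have tI: "t \<in> I" using t J by auto
  have "y2 t = C * (2 * y t * y1 t)"
    by (rule DERIV_eq_on_open[OF J(1) t C y1]) (use tI in \<open>auto intro!: derivative_eq_intros y\<close>)
  then have "y2 t = 2 * C * y t * y1 t" by simp
  moreover have "(y1 t)\<^sup>2 / y t = C * y t * y1 t"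
    using y_pos[OF n2 tI] by (simp add: C[OF t] power2_eq_square)
  ultimately have "\<sigma> t * y1 t = y1 t * (real n - (real n + 1) * C * y t)"
    using \<sigma>_eq[OF tI] by (simp only: times_divide_eq_right[symmetric]) (simp add: algebra_simps)
  then show ?thesis using y1_pos[OF tI] by simp
qed

text \<open>Here \<open>\<kappa> * t + b\<close> is the rate at which \<open>X\<close> changes
  \<open>t\<close>, and \<open>m\<close> is twice the real part of its divergence. The first
  equation integrates to a formula for \<open>\<sigma>\<close> with a constant \<open>c\<close>. For
  \<open>n \<ge> 2\<close> the second then says that \<open>y\<close> times an affine function of
  \<open>t\<close> is constant: either \<open>\<kappa> = c = 0\<close>, the soliton shape, or
  \<open>1 / y\<close> is affine, which makes \<open>\<sigma>\<close> affine in
  \<open>y\<close>.\<close>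

lemma soliton_profile_cases:
  assumes J: "open J" "connected J" "J \<noteq> {}" "J \<subseteq> I"
    and eq1: "\<And>t. t \<in> J \<Longrightarrow> \<sigma>1 t = l * y1 t + (\<kappa> * t + b) * y2 t + 2 * \<kappa> * y1 t"
    and eq2: "\<And>t. 2 \<le> n \<Longrightarrow> t \<in> J \<Longrightarrow> m = \<sigma> t * (\<kappa> * t + b) + sc t - real n * l"
  shows "affine_profile J \<or> soliton_profile J"
proof -
  have "((\<lambda>t. \<sigma> t - (l + \<kappa>) * y t - y1 t * (\<kappa> * t + b)) has_real_derivative 0) (at t)" if t: "t \<in> J" for t
  proof -
    have "t \<in> I" using t J by auto
    then show ?thesis
      using eq1[OF t] by (auto intro!: derivative_eq_intros \<sigma> y y1 simp: algebra_simps)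
  qed
  then obtain c where "\<And>t. t \<in> J \<Longrightarrow> \<sigma> t - (l + \<kappa>) * y t - y1 t * (\<kappa> * t + b) = c"
    using DERIV_zero_constant_on[OF J(2,1)] by blast
  then have c: "\<sigma> t = (l + \<kappa>) * y t + y1 t * (\<kappa> * t + b) + c" if "t \<in> J" for t
    using that by (smt (verit))
  show ?thesis
  proof (cases "n = 1")
    case True
    then show ?thesis unfolding soliton_profile_def if_P[OF True] using c by blast
  next
    case False
    then have n2: "2 \<le> n" using n by simp
    \<comment> \<open>\<open>y2\<close> is eliminated by \<open>\<sigma>_eq\<close> and then
      \<open>\<sigma>\<close> by the first integral; the terms with \<open>y1\<close> cancel, and
      only \<open>y\<close> and \<open>t\<close> remain.\<close>
    have key: "y t * (m - (real n + 1) * \<kappa> - real n * (\<kappa> * t + b)) = (real n - 1) * c" if t: "t \<in> J" for t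
    proof -
      have tI: "t \<in> I" using t J by auto
      have pos: "y t > 0" "y1 t > 0" using y_pos[OF n2 tI] y1_pos[OF tI] by auto
      define L where "L = \<kappa> * t + b"
      have y2: "y2 t = (real n - \<sigma> t) * y1 t - (real n - 1) * (y1 t)\<^sup>2 / y t"
        using \<sigma>_eq[OF tI] by (simp add: algebra_simps)
      have "\<sigma>1 t / y1 t = l + 2 * \<kappa> + L * (y2 t / y1 t)"
        using eq1[OF t] pos by (simp add: L_def field_simps)
      also have "y2 t / y1 t = real n - \<sigma> t - (real n - 1) * y1 t / y t"
        unfolding y2 using pos by (simp add: field_simps power2_eq_square)
      finally have "m = \<sigma> t * L + (real n - 1) * \<sigma> t / y t + (l + 2 * \<kappa> + L * (real n - \<sigma> t - (real n - 1) * y1 t / y t)) - real n * l"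
        using eq2[OF n2 t] by (simp add: sc_def L_def)
      then have "m = (real n - 1) * (\<sigma> t - y1 t * L) / y t + l + 2 * \<kappa> + real n * L - real n * l"
        by (simp add: algebra_simps diff_divide_distrib add_divide_distrib)
      also have "\<sigma> t - y1 t * L = (l + \<kappa>) * y t + c" using c[OF t] by (simp add: L_def)
      finally have "m * y t = (real n - 1) * ((l + \<kappa>) * y t + c) + (l + 2 * \<kappa> + real n * L - real n * l) * y t"
        using pos by (simp add: field_simps)
      then show ?thesis unfolding L_def[symmetric] by (simp add: algebra_simps)
    qed
    have key': "y1 t * (m - (real n + 1) * \<kappa> - real n * (\<kappa> * t + b)) = real n * \<kappa> * y t" if t: "t \<in> J" for t
    proof -
      have tI: "t \<in> I" using t J by auto
      have "y1 t * (m - (real n + 1) * \<kappa> - real n * (\<kappa> * t + b)) + (- (real n * \<kappa>)) * y t = 0"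
        by (rule DERIV_eq_on_open[OF J(1) t key]) (use tI in \<open>auto intro!: derivative_eq_intros y\<close>)
      then show ?thesis by simp
    qed
    obtain t0 where t0: "t0 \<in> J" using J(3) by blast
    have pos0: "y t0 > 0" "y1 t0 > 0" using y_pos[OF n2] y1_pos t0 J(4) by auto
    show ?thesis
    proof (cases "\<kappa> = 0")
      case True
      then have "m - real n * b = 0" using key'[OF t0] pos0 by simp
      then have "c = 0" using key[OF t0] True n2 by simp
      then have "\<forall>t\<in>J. \<sigma> t = l * y t + b * y1 t" using c True by simp
      then show ?thesis unfolding soliton_profile_def using False by auto
    next
      case \<kappa>: False
      have "c \<noteq> 0"
      proof
        assume "c = 0"
        then have "m - (real n + 1) * \<kappa> - real n * (\<kappa> * t0 + b) = 0" using key[OF t0] pos0 by simp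
        then show False using key'[OF t0] pos0 \<kappa> n2 by simp
      qed
      define C where "C = real n * \<kappa> / ((real n - 1) * c)"
      have C: "y1 t = C * (y t)\<^sup>2" if t: "t \<in> J" for t
      proof -
        have "y1 t * ((real n - 1) * c) = real n * \<kappa> * (y t)\<^sup>2"
          using key'[OF t] unfolding key[OF t, symmetric] by (simp add: power2_eq_square mult_ac)
        then show ?thesis using \<open>c \<noteq> 0\<close> n2 by (simp add: C_def field_simps)
      qed
      have "C \<noteq> 0" using \<kappa> \<open>c \<noteq> 0\<close> n2 by (simp add: C_def)
      moreover have "\<forall>t\<in>J. \<sigma> t = (- ((real n + 1) * C)) * y t + real n"
        using inverse_affine_profile[OF n2 J(1,4) _ C] by simp
      ultimately show ?thesis
        unfolding affine_profile_def using n2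
        by (intro disjI1 exI[of _ "- ((real n + 1) * C)"] exI[of _ "real n"]) auto
    qed
  qed
qed

text \<open>The first hypothesis makes \<open>\<sigma>1 / y1\<close> constant. The second, needed
  only to exclude a nonzero constant \<open>\<sigma>\<close>, says that \<open>1 / y\<close> is
  affine in \<open>t\<close>; with \<open>\<sigma>_eq\<close> it would make \<open>y\<close> an
  exponential, whose reciprocal is affine only if \<open>y1 = 0\<close>.\<close>

lemma affine_profileI:
  assumes J: "open J" "connected J" "J \<noteq> {}" "J \<subseteq> I"
    and eq1: "\<And>t. t \<in> J \<Longrightarrow> \<sigma>2 t * y1 t = \<sigma>1 t * y2 t"
    and eq2: "\<And>e t. 2 \<le> n \<Longrightarrow> e \<noteq> 0 \<Longrightarrow> (\<And>t. t \<in> J \<Longrightarrow> \<sigma> t = e) \<Longrightarrow> t \<in> J \<Longrightarrow> y2 t * y t = 2 * (y1 t)\<^sup>2"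
  shows "affine_profile J"
proof -
  have "((\<lambda>t. \<sigma>1 t / y1 t) has_real_derivative 0) (at t)" if t: "t \<in> J" for t
  proof -
    have tI: "t \<in> I" using t J by auto
    then have "y1 t \<noteq> 0" using y1_pos by force
    then show ?thesis
      using eq1[OF t] tI by (auto intro!: derivative_eq_intros \<sigma>1 y1)
  qed
  then obtain l where l: "\<And>t. t \<in> J \<Longrightarrow> \<sigma>1 t / y1 t = l"
    using DERIV_zero_constant_on[OF J(2,1)] by blast
  have "((\<lambda>t. \<sigma> t - l * y t) has_real_derivative 0) (at t)" if t: "t \<in> J" for t
  proof -
    have tI: "t \<in> I" using t J by auto
    then have "\<sigma>1 t = l * y1 t" using l[OF t] y1_pos[OF tI] by (simp add: field_simps)
    then show ?thesis using tI by (auto intro!: derivative_eq_intros \<sigma> y)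
  qed
  then obtain e where "\<And>t. t \<in> J \<Longrightarrow> \<sigma> t - l * y t = e"
    using DERIV_zero_constant_on[OF J(2,1)] by blast
  then have e: "\<And>t. t \<in> J \<Longrightarrow> \<sigma> t = l * y t + e" by (smt (verit))
  have "l \<noteq> 0 \<or> e = 0" if n2: "2 \<le> n"
  proof (rule ccontr)
    assume "\<not> (l \<noteq> 0 \<or> e = 0)"
    then have le: "l = 0" "e \<noteq> 0" by auto
    have y2: "y2 t * y t = 2 * (y1 t)\<^sup>2" if "t \<in> J" for t
      by (rule eq2[OF n2 le(2) _ that]) (use e le in simp)
    have D: "(real n - e) * y t = (real n + 1) * y1 t" if t: "t \<in> J" for t
    proof -
      have tI: "t \<in> I" using t J by auto
      have "2 * (y1 t)\<^sup>2 = real n * y1 t * y t - (real n - 1) * (y1 t)\<^sup>2 - e * y1 t * y t"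
        using y2_eq[OF tI n2] y2[OF t] e[OF t] le by simp
      then have "y1 t * ((real n - e) * y t) = y1 t * ((real n + 1) * y1 t)"
        by (simp add: algebra_simps power2_eq_square)
      then show ?thesis using y1_pos[OF tI] by simp
    qed
    obtain t where t: "t \<in> J" using J(3) by blast
    have tI: "t \<in> I" using t J by auto
    have "(real n - e) * y1 t = (real n + 1) * y2 t"
      by (rule DERIV_eq_on_open[OF J(1) t D]) (use tI in \<open>auto intro!: derivative_eq_intros y y1\<close>)
    then have "(real n - e) * y t * y1 t = (real n + 1) * (y2 t * y t)" by (simp add: mult_ac)
    then have "(real n + 1) * (y1 t * y1 t) = 0" unfolding y2[OF t] D[OF t] by (simp add: power2_eq_square)
    then show False using y1_pos[OF tI] by simp
  qed
  then show ?thesis unfolding affine_profile_def using e by blast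
qed

text \<open>Only \<open>d = 0\<close> is at stake, and it is decided by polynomial identities in
  \<open>y\<close> on the subinterval \<open>J\<close>. In the soliton shape \<open>\<sigma>\<close>
  is not a polynomial in \<open>y\<close>, so the curvature integral is differentiated and
  \<open>\<sigma>\<close> eliminated by a power; degrees then exclude \<open>c \<noteq> 0\<close>,
  and low order terms give \<open>d = 0\<close>.\<close>

lemma einstein_of_soliton_constant_curvature:
  assumes k: "1 \<le> k" "k \<le> n"
    and curv: "\<And>t. t \<in> I \<Longrightarrow> \<sigma> t ^ k * y t ^ (n - k) = c * y t ^ n + d"
    and J: "open J" "connected J" "J \<noteq> {}" "J \<subseteq> I"
    and krs: "affine_profile J \<or> soliton_profile J"
  shows "\<exists>l. einstein l"
proof (cases "n = 1")
  case True
  then show ?thesis using k curv by (intro exI[of _ c] einsteinI_dim_one[where e = d]) auto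
next
  case False
  with n have n2: "2 \<le> n" by simp
  define P where "P = monom c n + [:d:]"
  have P: "poly P x = c * x ^ n + d" for x by (simp add: P_def poly_monom)
  from krs have "d = 0"
  proof
    assume "affine_profile J"
    then obtain l e where le: "l \<noteq> 0 \<or> e = 0" and \<sigma>_J: "\<And>t. t \<in> J \<Longrightarrow> \<sigma> t = l * y t + e"
      unfolding affine_profile_def using n2 by blast
    have eq: "[:e, l:] ^ k * monom 1 (n - k) = P"
    proof (rule poly_profile_eq[OF J])
      fix t assume t: "t \<in> J"
      then have "(l * y t + e) ^ k * y t ^ (n - k) = c * y t ^ n + d"
        using curv[of t] \<sigma>_J[OF t] J(4) by auto
      then show "poly ([:e, l:] ^ k * monom 1 (n - k)) (y t) = poly P (y t)"
        by (simp add: P poly_monom add.commute[of e] mult.commute[of "y t" l])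
    qed
    \<comment> \<open>For \<open>k = n\<close> the factor \<open>0 ^ (n - k)\<close> is 1, and the
      value at 0 yields only \<open>d = e ^ n\<close>; that case needs the linear
      coefficient.\<close>
    have eq0: "e ^ k * 0 ^ (n - k) = d"
      using arg_cong[OF eq, of "\<lambda>p. poly p 0"] n by (simp add: P poly_monom power_0_left)
    show "d = 0"
    proof (cases "k < n \<or> e = 0")
      case True
      then show ?thesis using eq0 k by (auto simp: power_0_left split: if_splits)
    next
      case False
      then have kn: "k = n" "e \<noteq> 0" "l \<noteq> 0" using k le by auto
      \<comment> \<open>\<open>P\<close> has no linear term because \<open>n \<ge> 2\<close>,
        whereas the power has linear coefficient \<open>n * e ^ (n - 1) * l\<close>.\<close>
      have "pderiv ([:e, l:] ^ n) = pderiv P" using eq kn by simp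
      then have "poly (pderiv ([:e, l:] ^ n)) 0 = poly (pderiv P) 0" by simp
      then have "real n * (e ^ (n - 1) * l) = 0"
        using n2 by (simp add: P_def pderiv_power pderiv_add pderiv_monom poly_monom pderiv_pCons power_0_left) auto
      then show ?thesis using kn n2 by simp
    qed
  next
    assume "soliton_profile J"
    then obtain l \<mu> where \<sigma>_J: "\<And>t. t \<in> J \<Longrightarrow> \<sigma> t = l * y t + \<mu> * y1 t"
      unfolding soliton_profile_def if_not_P[OF False] by blast
    show "d = 0"
    proof (cases "\<mu> = 0")
      case True
      have eq: "monom (l ^ k) n = P"
      proof (rule poly_profile_eq[OF J])
        fix t assume t: "t \<in> J"
        have "y t ^ n = y t ^ k * y t ^ (n - k)" using k by (simp flip: power_add)
        then show "poly (monom (l ^ k) n) (y t) = poly P (y t)"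
          using curv[of t] \<sigma>_J[OF t] True t J(4) by (auto simp: P poly_monom power_mult_distrib)
      qed
      show ?thesis
        using arg_cong[OF eq, of "\<lambda>p. poly p 0"] n by (simp add: P poly_monom power_0_left)
    next
      case \<mu>: False
      \<comment> \<open>Differentiating the curvature integral and inserting
        \<open>\<sigma>1\<close> from the soliton relation leaves a term
        \<open>K * \<sigma> ^ (k - 1) * y ^ (n - k + 1)\<close>; all other terms contain
        \<open>\<sigma>\<close> only through \<open>\<sigma> ^ k * y ^ (n - k)\<close>, which is
        \<open>P\<close>. So \<open>q\<close> is that term written as a polynomial in
        \<open>y\<close>.\<close>
      define q where "q = monom (c * n) n + [:real n * (real k - 1), real k * \<mu>:] * P"
      define K where "K = real k * real n * (l + \<mu>)"
      have q: "poly q (y t) = K * \<sigma> t ^ (k - 1) * y t ^ (n - k + 1)" if t: "t \<in> J" for t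
      proof -
        have tI: "t \<in> I" using t J by auto
        have pos: "y t > 0" "y1 t > 0" using y_pos[OF n2 tI] y1_pos[OF tI] by auto
        have "\<sigma>1 t = l * y1 t + \<mu> * y2 t"
          by (rule DERIV_eq_on_open[OF J(1) t \<sigma>_J \<sigma>[OF tI]]) (use tI in \<open>auto intro!: derivative_eq_intros y y1\<close>)
        then have "\<sigma>1 t * y t = l * y1 t * y t + \<mu> * (y2 t * y t)" by (simp add: algebra_simps)
        also have "\<dots> = l * y1 t * y t + real n * \<mu> * y1 t * y t - (real n - 1) * y1 t * (\<mu> * y1 t) - \<mu> * \<sigma> t * y1 t * y t"
          unfolding y2_eq[OF tI n2] by (simp add: algebra_simps power2_eq_square)
        also have "\<mu> * y1 t = \<sigma> t - l * y t" using \<sigma>_J[OF t] by simp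
        finally have "\<sigma>1 t * y t = y1 t * (real n * (l + \<mu>) * y t - \<mu> * \<sigma> t * y t - (real n - 1) * \<sigma> t)"
          by (simp add: algebra_simps)
        moreover define B where "B = real n * (l + \<mu>) * y t - \<mu> * \<sigma> t * y t - (real n - 1) * \<sigma> t"
        ultimately have s1: "\<sigma>1 t * y t = y1 t * B" by simp
        have der: "real k * \<sigma> t ^ (k - 1) * \<sigma>1 t * y t ^ (n - k) + \<sigma> t ^ k * (real (n - k) * y t ^ (n - k - 1) * y1 t)
          = c * (real n * y t ^ (n - 1) * y1 t)"
          by (rule DERIV_eq_on_open[OF I(1) tI curv])
             (auto intro!: derivative_eq_intros \<sigma> y tI)
        have e1: "\<sigma> t ^ (k - 1) * \<sigma> t = \<sigma> t ^ k" using k by (cases k) auto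
        have e2: "y t ^ (n - 1) * y t = y t ^ n" using n by (cases n) auto
        have e3: "real (n - k) * (y t ^ (n - k - 1) * y t) = real (n - k) * y t ^ (n - k)"
          by (cases "n - k") auto
        have "y1 t * (real k * \<sigma> t ^ (k - 1) * B * y t ^ (n - k)
            + real (n - k) * y t ^ (n - k) * \<sigma> t ^ k)
          = y t * (real k * \<sigma> t ^ (k - 1) * \<sigma>1 t * y t ^ (n - k)) + \<sigma> t ^ k * (real (n - k) * (y t ^ (n - k - 1) * y t) * y1 t)"
        proof -
          have "y1 t * (s * B * p + r) = s * (y1 t * B) * p + y1 t * r" for s p r
            by (simp add: algebra_simps)
          from this[of "real k * \<sigma> t ^ (k - 1)" "y t ^ (n - k)" "real (n - k) * y t ^ (n - k) * \<sigma> t ^ k"]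
          show ?thesis unfolding e3 s1[symmetric] by (simp only: mult_ac)
        qed
        also have "\<dots> = y t * (c * (real n * y t ^ (n - 1) * y1 t))"
          unfolding der[symmetric] by (simp add: algebra_simps)
        also have "\<dots> = y1 t * (c * real n * y t ^ n)"
          unfolding e2[symmetric] by (simp add: algebra_simps)
        finally have "real k * \<sigma> t ^ (k - 1) * B * y t ^ (n - k)
            + real (n - k) * y t ^ (n - k) * \<sigma> t ^ k = c * real n * y t ^ n"
          using pos by simp
        then have "K * \<sigma> t ^ (k - 1) * y t ^ (n - k + 1) =
            c * real n * y t ^ n + (real k * \<mu> * y t + real k * (real n - 1) - real (n - k)) * ((\<sigma> t ^ (k - 1) * \<sigma> t) * y t ^ (n - k))"
          unfolding e1[symmetric] K_def B_def by (simp add: algebra_simps)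
        also have "(\<sigma> t ^ (k - 1) * \<sigma> t) * y t ^ (n - k) = poly P (y t)"
          unfolding e1 using curv[OF tI] by (simp add: P)
        also have "real k * \<mu> * y t + real k * (real n - 1) - real (n - k) = real k * \<mu> * y t + real n * (real k - 1)"
          using k by (simp add: of_nat_diff algebra_simps)
        finally show ?thesis by (simp add: q_def poly_monom algebra_simps)
      qed
      \<comment> \<open>The \<open>k\<close>-th power of \<open>\<sigma> ^ (k - 1)\<close> consists
        of \<open>k - 1\<close> copies of \<open>\<sigma> ^ k\<close>, all of which \<open>P\<close>
        absorbs; a factor \<open>y ^ n\<close> is left over.\<close>
      have qk: "q ^ k = monom (K ^ k) n * P ^ (k - 1)"
      proof (rule poly_profile_eq[OF J])
        fix t assume t: "t \<in> J"
        then have tI: "t \<in> I" using J by auto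
        have "poly P (y t) = \<sigma> t ^ k * y t ^ (n - k)" using curv[OF tI] by (simp add: P)
        moreover have "(n - k + 1) * k = n + (n - k) * (k - 1)"
        proof -
          have "(n - k + 1) * k = (n - k) * k + k" by simp
          also have "(n - k) * k = (n - k) * (k - 1) + (n - k)" using k by (cases k) auto
          finally show ?thesis using k by simp
        qed
        ultimately show "poly (q ^ k) (y t) = poly (monom (K ^ k) n * P ^ (k - 1)) (y t)"
          by (simp add: q[OF t] poly_monom power_mult_distrib mult_ac flip: power_mult power_add)
      qed
      \<comment> \<open>Otherwise \<open>q\<close> has degree at least \<open>n + 1\<close>, so the
        left-hand side of \<open>qk\<close> has degree at least \<open>(n + 1) * k\<close>, the
        right-hand side at most \<open>n * k\<close>.\<close>
      have "c = 0"
      proof (rule ccontr)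
        assume "c \<noteq> 0"
        have degP: "degree P \<le> n" unfolding P_def by (intro degree_add_le degree_monom_le) simp
        have "coeff q (Suc n) = real k * \<mu> * c"
          unfolding q_def P_def using n by (simp add: coeff_pCons split: nat.splits)
        then have "coeff q (Suc n) \<noteq> 0" using k \<mu> \<open>c \<noteq> 0\<close> by simp
        then have "Suc n \<le> degree q" "q \<noteq> 0" using le_degree[of q "Suc n"] by auto
        then have "Suc n * k \<le> degree (q ^ k)"
          using mult_le_mono1[of "Suc n" "degree q" k] by (simp add: degree_power_eq mult.commute)
        also have "degree (q ^ k) \<le> n + n * (k - 1)"
          unfolding qk
          by (rule order_trans[OF degree_mult_le add_mono[OF degree_monom_le order_trans[OF degree_power_le]]])
             (use degP in simp)
        also have "\<dots> = n * k" using k by (cases k) auto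
        finally show False using k by simp
      qed
      then have q': "q = [:d * real n * (real k - 1), d * (real k * \<mu>):]" and P': "P = [:d:]"
        by (simp_all add: q_def P_def)
      show ?thesis
      proof (cases "k = 1")
        case True
        then have "[:0, d * \<mu>:] = monom K n" using qk q' by simp
        then have "poly [:0, d * \<mu>:] x = poly (monom K n) x" for x by simp
        \<comment> \<open>Proportionality of \<open>x\<close> and \<open>x ^ n\<close> with
          \<open>n \<ge> 2\<close> is refuted by two values of \<open>x\<close>.\<close>
        from this[of 1] this[of 2] have "d * \<mu> = K" "2 * (d * \<mu>) = K * 2 ^ n"
          by (simp_all add: poly_monom)
        moreover have "(2::real) ^ n \<noteq> 2" using power_strict_increasing[of 1 n "2::real"] n2 by simp
        ultimately show ?thesis using \<mu> by auto
      next
        case False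
        have "poly (q ^ k) 0 = 0" unfolding qk using n by (simp add: poly_monom power_0_left)
        then show ?thesis unfolding q' using False k n2 by simp
      qed
    qed
  qed
  then show ?thesis using einstein_of_power[of k c] k curv by simp
qed

text \<open>For an extremal profile both \<open>\<sigma> * y ^ (n - 1)\<close> and
  \<open>y1 * y ^ (n - 1)\<close> are polynomials in \<open>y\<close>, namely \<open>U\<close> and
  \<open>V\<close>. The soliton shape becomes an identity between them, whose extreme coefficients
  force \<open>a = 0\<close> and, for \<open>n \<ge> 2\<close>, also \<open>c = 0\<close>.\<close>

lemma einstein_of_extremal_soliton:
  assumes ext: "\<And>t. t \<in> I \<Longrightarrow> sc t = \<alpha> * y t + \<beta>"
    and J: "open J" "connected J" "J \<noteq> {}" "J \<subseteq> I"
    and krs: "affine_profile J \<or> soliton_profile J"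
  shows "\<exists>l. einstein l"
proof -
  from extremal_integral[OF ext] obtain a b c d where
    u: "\<And>t. t \<in> I \<Longrightarrow> \<sigma> t * y t ^ (n - 1) = a * y t ^ (n + 1) + b * y t ^ n + c" and
    v: "\<And>t. t \<in> I \<Longrightarrow> y1 t * y t ^ (n - 1) =
       y t ^ n - a / (n + 2) * y t ^ (n + 2) - b / (n + 1) * y t ^ (n + 1) - c * y t - d" and
    s1: "n = 1 \<longrightarrow> (\<forall>t\<in>I. \<sigma>1 t = (2 * a * y t + b) * y1 t)" by metis
  define U where "U = monom a (n + 1) + monom b n + [:c:]"
  define V where "V = monom 1 n - monom (a / (n + 2)) (n + 2) - monom (b / (n + 1)) (n + 1) - [:d, c:]"
  have U: "poly U (y t) = \<sigma> t * y t ^ (n - 1)" if "t \<in> I" for t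
    using u[OF that] by (simp add: U_def poly_monom)
  have V: "poly V (y t) = y1 t * y t ^ (n - 1)" if "t \<in> I" for t
    using v[OF that] by (simp add: V_def poly_monom algebra_simps)
  have pow: "y t ^ n = y t * y t ^ (n - 1)" for t using n by (cases n) auto
  show ?thesis
  proof (cases "n = 1")
    case True
    have "a = 0"
      using krs
    proof
      assume "affine_profile J"
      then obtain l e where \<sigma>_J: "\<And>t. t \<in> J \<Longrightarrow> \<sigma> t = l * y t + e" unfolding affine_profile_def by blast
      have "U = [:e, l:]"
        by (rule poly_profile_eq[OF J]) (use U \<sigma>_J J(4) True in \<open>auto simp: mult.commute\<close>)
      then have "coeff U 2 = coeff [:e, l:] 2" by simp
      then show ?thesis using True by (simp add: U_def coeff_pCons numeral_2_eq_2)
    next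
      assume "soliton_profile J"
      then obtain l \<kappa> b' e where \<sigma>_J: "\<And>t. t \<in> J \<Longrightarrow> \<sigma> t = l * y t + y1 t * (\<kappa> * t + b') + e"
        unfolding soliton_profile_def if_P[OF True] by blast
      \<comment> \<open>The soliton relation contains \<open>t\<close> explicitly. So does its
        derivative, but only through \<open>y1 * (\<kappa> * t + b')\<close>, and the relation
        itself expresses this product by \<open>y\<close> and \<open>\<sigma>\<close>.\<close>
      have eq: "[:b - l - \<kappa>, 2 * a:] * V = ([:1:] - U) * (U - [:e, l:])"
      proof (rule poly_profile_eq[OF J])
        fix t assume t: "t \<in> J"
        then have tI: "t \<in> I" using J by auto
        have "\<sigma>1 t = l * y1 t + y2 t * (\<kappa> * t + b') + \<kappa> * y1 t"
          by (rule DERIV_eq_on_open[OF J(1) t \<sigma>_J \<sigma>[OF tI]]) (use tI in \<open>auto intro!: derivative_eq_intros y y1\<close>)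
        moreover have "y2 t = (1 - \<sigma> t) * y1 t" using \<sigma>_eq[OF tI] True by (simp add: algebra_simps)
        ultimately have "(2 * a * y t + b - l - \<kappa>) * y1 t = (1 - \<sigma> t) * (y1 t * (\<kappa> * t + b'))"
          using s1 True tI by (simp add: algebra_simps)
        also have "y1 t * (\<kappa> * t + b') = \<sigma> t - l * y t - e" using \<sigma>_J[OF t] by simp
        finally show "poly ([:b - l - \<kappa>, 2 * a:] * V) (y t) = poly (([:1:] - U) * (U - [:e, l:])) (y t)"
          using True by (simp add: U[OF tI] V[OF tI] algebra_simps)
      qed
      \<comment> \<open>In degree 4 the two sides of \<open>eq\<close> have coefficients
        \<open>-2 a^2 / 3\<close> and \<open>-a^2\<close>.\<close>
      have VU: "V = [:-d, 1 - c, - (b / 2), - (a / 3):]" "U = [:c, b, a:]"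
        using True by (simp_all add: U_def V_def monom_altdef numeral_2_eq_2 numeral_3_eq_3)
      from eq[unfolded VU] show ?thesis by auto
    qed
    then have "einstein b"
      using u True by (intro einsteinI_dim_one[where e = c]) auto
    then show ?thesis by blast
  next
    case False
    then have n2: "2 \<le> n" using n by simp
    have "a = 0 \<and> c = 0"
      using krs
    proof
      assume "affine_profile J"
      then obtain l e where \<sigma>_J: "\<And>t. t \<in> J \<Longrightarrow> \<sigma> t = l * y t + e" unfolding affine_profile_def by blast
      have "U = monom l n + monom e (n - 1)"
        by (rule poly_profile_eq[OF J]) (use U \<sigma>_J J(4) pow in \<open>auto simp: poly_monom algebra_simps\<close>)
      then have "coeff U (n + 1) = coeff (monom l n + monom e (n - 1)) (n + 1)"
        "coeff U 0 = coeff (monom l n + monom e (n - 1)) 0" by simp_all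
      then show ?thesis using n2 by (simp_all add: U_def)
    next
      assume "soliton_profile J"
      then obtain l \<mu> where \<sigma>_J: "\<And>t. t \<in> J \<Longrightarrow> \<sigma> t = l * y t + \<mu> * y1 t"
        unfolding soliton_profile_def if_not_P[OF False] by blast
      have UV: "U = monom l n + smult \<mu> V"
        by (rule poly_profile_eq[OF J]) (use U V \<sigma>_J J(4) pow in \<open>auto simp: poly_monom algebra_simps\<close>)
      then have "coeff U (n + 2) = coeff (monom l n + smult \<mu> V) (n + 2)"
        "coeff U 1 = coeff (monom l n + smult \<mu> V) 1"
        "coeff U 0 = coeff (monom l n + smult \<mu> V) 0"
        "coeff U (n + 1) = coeff (monom l n + smult \<mu> V) (n + 1)" by simp_all
      then have "\<mu> * (a / (n + 2)) = 0" "\<mu> * c = 0" "c = - (\<mu> * d)" "a = - (\<mu> * (b / (n + 1)))"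
        using n2 by (auto simp: U_def V_def coeff_pCons numeral_2_eq_2 split: nat.splits)
      then show ?thesis by auto
    qed
    then have "einstein b"
      using u pow y_pos[OF n2] by (intro einsteinI[OF n2]) force
    then show ?thesis by blast
  qed
qed

end

section \<open>Radial metrics in coordinates\<close>

lemma has_real_derivative_Re:
  assumes "(f has_field_derivative f') (at (of_real x))"
  shows "((\<lambda>x. Re (f (of_real x))) has_real_derivative Re f') (at x)"
proof -
  have "((\<lambda>x. f (of_real x)) has_vector_derivative 1 * f') (at x)"
    using field_vector_diff_chain_at[OF has_vector_derivative_of_real[OF DERIV_ident] assms]
    by (simp only: o_def of_real_1)
  then show ?thesis
    using bounded_linear.has_vector_derivative[OF bounded_linear_Re]
    by (simp add: has_real_derivative_iff_has_vector_derivative)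
qed

text \<open>\<open>Re k\<close> and its product with the translation invariant function \<open>\<tau> (Re w)\<close> are both harmonic: the
  conclusion is the Laplacian of the product.\<close>
lemma harmonic_product_translation_invariant:
  fixes \<tau> \<tau>1 :: "real \<Rightarrow> real"
  assumes k: "k holomorphic_on ball 0 \<delta>" and d: "d holomorphic_on ball 0 \<delta>"
    and eq: "\<And>w. w \<in> ball 0 \<delta> \<Longrightarrow> Re (d w) = \<tau> (Re w) * Re (k w)"
    and \<tau>: "\<And>x. \<bar>x\<bar> < \<delta> \<Longrightarrow> (\<tau> has_real_derivative \<tau>1 x) (at x)"
    and x: "\<bar>x\<bar> < \<delta>" and \<tau>1: "(\<tau>1 has_real_derivative \<tau>2) (at x)"
  shows "\<tau>2 * Re (k (of_real x)) + 2 * \<tau>1 x * Re (deriv k (of_real x)) = 0"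
proof -
  define B where "B = ball (0::complex) \<delta>"
  have hol: "(deriv ^^ m) k holomorphic_on B" "(deriv ^^ m) d holomorphic_on B" for m
    unfolding B_def by (intro holomorphic_higher_deriv k d open_ball)+
  have D: "((deriv ^^ m) k has_field_derivative (deriv ^^ Suc m) k w) (at w)"
    "((deriv ^^ m) d has_field_derivative (deriv ^^ Suc m) d w) (at w)" if "w \<in> B" for m w
    using holomorphic_derivI[OF hol(1), of w m] holomorphic_derivI[OF hol(2), of w m] that
    by (auto simp: B_def)
  define kr dr where "kr = (\<lambda>m x. Re ((deriv ^^ m) k (of_real x)))" and "dr = (\<lambda>m x. Re ((deriv ^^ m) d (of_real x)))"
  have inB: "of_real x \<in> B" if "\<bar>x\<bar> < \<delta>" for x using that by (simp add: B_def)
  have Dr: "(kr m has_real_derivative kr (Suc m) x) (at x)" "(dr m has_real_derivative dr (Suc m) x) (at x)"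
    if "\<bar>x\<bar> < \<delta>" for m x
    unfolding kr_def dr_def by (rule has_real_derivative_Re, rule D, rule inB, rule that)+
  have e1: "dr 1 x = \<tau>1 x * kr 0 x + \<tau> x * kr 1 x" if x: "\<bar>x\<bar> < \<delta>" for x
  proof (rule DERIV_eq_on_open[where J = "{-\<delta><..<\<delta>}" and t = x and f = "dr 0" and g = "\<lambda>x. \<tau> x * kr 0 x"])
    show "dr 0 t = \<tau> t * kr 0 t" if "t \<in> {-\<delta><..<\<delta>}" for t
      using eq[of "of_real t"] that by (simp add: kr_def dr_def abs_less_iff)
    show "(dr 0 has_real_derivative dr 1 x) (at x)" using Dr(2)[OF x, of 0] by simp
    show "((\<lambda>x. \<tau> x * kr 0 x) has_real_derivative \<tau>1 x * kr 0 x + \<tau> x * kr 1 x) (at x)"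
      using DERIV_mult[OF \<tau>[OF x] Dr(1)[OF x, of 0]] by (simp add: add.commute mult.commute)
  qed (use x in auto)
  have e2: "dr 2 x = \<tau>2 * kr 0 x + 2 * \<tau>1 x * kr 1 x + \<tau> x * kr 2 x"
  proof (rule DERIV_eq_on_open[where J = "{-\<delta><..<\<delta>}" and t = x and f = "dr 1" and g = "\<lambda>x. \<tau>1 x * kr 0 x + \<tau> x * kr 1 x"])
    show "dr 1 t = \<tau>1 t * kr 0 t + \<tau> t * kr 1 t" if "t \<in> {-\<delta><..<\<delta>}" for t
      by (rule e1) (use that in auto)
    show "(dr 1 has_real_derivative dr 2 x) (at x)" using Dr(2)[OF x, of 1] by (simp add: numeral_2_eq_2)
    show "((\<lambda>x. \<tau>1 x * kr 0 x + \<tau> x * kr 1 x) has_real_derivative \<tau>2 * kr 0 x + 2 * \<tau>1 x * kr 1 x + \<tau> x * kr 2 x) (at x)"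
      by (rule derivative_eq_intros Dr(1)[OF x] \<tau>1 \<tau>[OF x] refl)+ (simp add: numeral_2_eq_2)
  qed (use x in auto)
  \<comment> \<open>Derivatives in the imaginary direction. There \<open>\<tau>\<close> is constant,
    so \<open>d\<close> and \<open>k\<close> stay proportional to all orders considered.\<close>
  define ki di where "ki = (\<lambda>m s. Re (\<i> ^ m * (deriv ^^ m) k (of_real x + \<i> * of_real s)))"
    and "di = (\<lambda>m s. Re (\<i> ^ m * (deriv ^^ m) d (of_real x + \<i> * of_real s)))"
  define S where "S = {s. of_real x + \<i> * of_real s \<in> B}"
  have S: "open S" "0 \<in> S"
  proof -
    have "continuous_on UNIV (\<lambda>s::real. complex_of_real x + \<i> * of_real s)" by (intro continuous_intros)
    then have "open ((\<lambda>s::real. complex_of_real x + \<i> * of_real s) -` B)"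
      by (intro open_vimage) (simp_all add: B_def)
    then show "open S" by (simp add: S_def vimage_def)
    show "0 \<in> S" using inB[OF x] by (simp add: S_def)
  qed
  have im: "((\<lambda>s. Re (c * f (of_real x + \<i> * of_real s))) has_real_derivative Re (\<i> * c * f')) (at s)"
    if "(f has_field_derivative f') (at (of_real x + \<i> * of_real s))" for f :: "complex \<Rightarrow> complex" and f' c s
  proof -
    have "((\<lambda>w. c * f (of_real x + \<i> * w)) has_field_derivative \<i> * c * f') (at (of_real s))"
      by (rule derivative_eq_intros DERIV_chain2[where f = f and g = "\<lambda>w. of_real x + \<i> * w", OF that] refl | simp)+
    from has_real_derivative_Re[OF this] show ?thesis by simp
  qed
  have Di: "(ki m has_real_derivative ki (Suc m) s) (at s)" "(di m has_real_derivative di (Suc m) s) (at s)"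
    if "s \<in> S" for m s
    unfolding ki_def di_def power_Suc by (rule im, rule D, use that in \<open>simp add: S_def\<close>)+
  have f0: "di 0 s = \<tau> x * ki 0 s" if "s \<in> S" for s
    using eq[of "of_real x + \<i> * of_real s"] that by (simp add: di_def ki_def S_def B_def)
  have f1: "di 1 s = \<tau> x * ki 1 s" if s: "s \<in> S" for s
    by (rule DERIV_eq_on_open[OF S(1) s f0])
       (use Di[OF s, of 0] in \<open>auto intro!: derivative_eq_intros\<close>)
  have "di 2 0 = \<tau> x * ki 2 0"
    by (rule DERIV_eq_on_open[OF S f1])
       (use Di[OF S(2), of 1] in \<open>auto intro!: derivative_eq_intros simp: numeral_2_eq_2\<close>)
  \<comment> \<open>The factor \<open>\<i> ^ 2 = -1\<close> on both sides carries the relation over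
    to the real direction; this is the harmonicity of both real parts.\<close>
  then have "dr 2 x = \<tau> x * kr 2 x" by (simp add: di_def ki_def dr_def kr_def)
  with e2 show ?thesis by (simp add: kr_def)
qed

text \<open>\<open>exp (d z)\<close> and \<open>exp (- d z)\<close> have moduli given by
  \<open>Re (d z)\<close>, constant on circles around 0. The maximum principle for both gives the
  two inequalities at the centre.\<close>

lemma radial_real_part_constant:
  assumes d: "d holomorphic_on ball 0 \<rho>" and rad: "\<And>w w'. w \<in> ball 0 \<rho> \<Longrightarrow> cmod w = cmod w' \<Longrightarrow> Re (d w) = Re (d w')"
    and w: "w \<in> ball 0 \<rho>"
  shows "Re (d w) = Re (d 0)"
proof (cases "w = 0")
  case False
  define S where "S = cball (0::complex) (cmod w)"
  have S: "S \<subseteq> ball 0 \<rho>" using w by (auto simp: S_def)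
  have *: "cmod (exp (c * d 0)) \<le> cmod (exp (c * d w))" if "Im c = 0" for c
  proof (rule maximum_modulus_frontier[where S = S and f = "\<lambda>z. exp (c * d z)"])
    have hol: "(\<lambda>z. exp (c * d z)) holomorphic_on S"
      by (intro holomorphic_intros holomorphic_on_subset[OF d S])
    then show "(\<lambda>z. exp (c * d z)) holomorphic_on interior S"
      by (rule holomorphic_on_subset) (rule interior_subset)
    show "continuous_on (closure S) (\<lambda>z. exp (c * d z))"
      using hol by (simp add: S_def holomorphic_on_imp_continuous_on)
    show "cmod (exp (c * d z)) \<le> cmod (exp (c * d w))" if "z \<in> frontier S" for z
    proof -
      have "cmod w = cmod z" using that False by (simp add: S_def frontier_cball dist_norm)
      from rad[OF w this] have "Re (d z) = Re (d w)" by (rule sym)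
      then show ?thesis using \<open>Im c = 0\<close> by simp
    qed
  qed (auto simp: S_def)
  have "Re (d 0) \<le> Re (d w)" "Re (d w) \<le> Re (d 0)" using *[of 1] *[of "-1"] by simp_all
  then show ?thesis by (rule antisym[rotated])
qed simp

text \<open>Proved over an arbitrary commutative ring because it is applied to matrices of numbers
  and of polynomials in \<open>s\<close>; hence the argument uses multilinearity in the rows and no
  division.\<close>

lemma det_scalar_plus_rank_one:
  fixes a :: "'a::comm_ring_1" and b c :: "'n::finite \<Rightarrow> 'a"
  shows "det (\<chi> i j. (if i = j then a else 0) + b i * c j :: 'a^'n^'n)
    = a ^ (CARD('n) - 1) * (a + (\<Sum>i\<in>UNIV. b i * c i))"
proof -
  define e :: "'n \<Rightarrow> 'a^'n" where "e = (\<lambda>i. \<chi> j. if i = j then a else 0)"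
  define C :: "'a^'n" where "C = (\<chi> j. c j)"
  \<comment> \<open>Row \<open>k\<close> is replaced by \<open>C\<close>. For
    \<open>k \<notin> S\<close> the multiples of \<open>C\<close> in the other rows do not matter,
    so this is independent of \<open>S\<close>.\<close>
  define row_C where "row_C = (\<lambda>S k. det ((\<chi> i. if i = k then C else if i \<in> S then e i + b i *s C else e i) :: 'a^'n^'n))"
  define M where "M = (\<lambda>S. det ((\<chi> i. if i \<in> S then e i + b i *s C else e i) :: 'a^'n^'n))"
  have base: "row_C {} k = a ^ (CARD('n) - 1) * c k" for k
  proof -
    let ?A = "(\<chi> i. if i = k then C else e i) :: 'a^'n^'n"
    let ?PU = "{p. p permutes (UNIV :: 'n set)}"
    let ?pp = "\<lambda>p. of_int (sign p) * (\<Prod>i\<in>UNIV. ?A $ i $ p i)"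
    have "det ?A = (\<Sum>p\<in>{id}. ?pp p)"
      unfolding det_def
    proof (rule sum.mono_neutral_right)
      show "\<forall>p\<in>?PU - {id}. ?pp p = 0"
      proof
        fix p assume p: "p \<in> ?PU - {id}"
        have "\<exists>i. i \<noteq> k \<and> p i \<noteq> i"
        proof (rule ccontr)
          assume "\<not> ?thesis"
          then have fixed: "\<And>i. i \<noteq> k \<Longrightarrow> p i = i" by auto
          have "inj p" using p permutes_inj by auto
          then have "p k = k" using fixed[of "p k"] by (metis injD)
          then have "p = id" using fixed by (metis eq_id_iff)
          then show False using p by simp
        qed
        then obtain i where "i \<noteq> k" "p i \<noteq> i" by blast
        then have "?A $ i $ p i = 0" by (simp add: e_def)
        then have "(\<Prod>i\<in>UNIV. ?A $ i $ p i) = 0" by (intro prod_zero bexI[of _ i]) auto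
        then show "?pp p = 0" by simp
      qed
    qed (auto simp: finite_permutations permutes_id)
    also have "\<dots> = (\<Prod>i\<in>UNIV. if i = k then c k else a)"
      by (simp add: sign_id) (intro prod.cong, auto simp: C_def e_def)
    also have "\<dots> = c k * (\<Prod>i\<in>UNIV - {k}. a)"
      by (subst prod.remove[of _ k]) (auto intro!: prod.cong)
    finally show ?thesis
      unfolding row_C_def empty_iff if_False by (simp add: card_Diff_singleton mult.commute)
  qed
  have step: "row_C S k = a ^ (CARD('n) - 1) * c k" if "finite S" "k \<notin> S" for S k
    using that
  proof (induction S rule: finite_induct)
    case empty
    show ?case by (rule base)
  next
    case (insert m S)
    have mk: "m \<noteq> k" using insert.prems by auto
    let ?R = "\<lambda>i. if i = k then C else if i \<in> S then e i + b i *s C else e i"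
    have "row_C (insert m S) k = det (\<chi> i. if i = m then e m + b m *s C else ?R i)"
      unfolding row_C_def by (rule arg_cong[of _ _ det]) (auto simp: vec_eq_iff mk)
    also have "\<dots> = det (\<chi> i. if i = m then e m else ?R i) + b m * det (\<chi> i. if i = m then C else ?R i)"
      by (simp only: det_row_add det_row_mul)
    also have "det (\<chi> i. if i = m then C else ?R i) = 0"
      by (rule det_identical_rows[OF mk]) (simp add: row_def mk)
    also have "det (\<chi> i. if i = m then e m else ?R i) = row_C S k"
      unfolding row_C_def using insert.hyps(2) mk by (intro arg_cong[of _ _ det]) (auto simp: vec_eq_iff)
    also have "row_C S k = a ^ (CARD('n) - 1) * c k"
      using insert.IH insert.prems by auto
    finally show ?case by simp
  qed
  have "M S = a ^ (CARD('n) - 1) * (a + (\<Sum>i\<in>S. b i * c i))" if "finite S" for S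
    using that
  proof (induction S rule: finite_induct)
    case empty
    have "M {} = (\<Prod>i\<in>(UNIV::'n set). a)"
      unfolding M_def by (subst det_diagonal) (auto simp: e_def)
    also have "\<dots> = a ^ (CARD('n) - 1) * a"
      by (simp flip: power_Suc2)
    finally show ?case by simp
  next
    case (insert m S)
    let ?R = "\<lambda>i. if i \<in> S then e i + b i *s C else e i"
    have "M (insert m S) = det (\<chi> i. if i = m then e m + b m *s C else ?R i)"
      unfolding M_def by (rule arg_cong[of _ _ det]) (auto simp: vec_eq_iff)
    also have "\<dots> = det (\<chi> i. if i = m then e m else ?R i) + b m * det (\<chi> i. if i = m then C else ?R i)"
      by (simp only: det_row_add det_row_mul)
    also have "det (\<chi> i. if i = m then C else ?R i) = row_C S m"
      unfolding row_C_def ..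
    also have "det (\<chi> i. if i = m then e m else ?R i) = M S"
      unfolding M_def using insert.hyps(2) by (intro arg_cong[of _ _ det]) (auto simp: vec_eq_iff)
    finally show ?case
      using insert step[OF insert.hyps] by (simp add: algebra_simps)
  qed
  from this[of UNIV] have "M UNIV = a ^ (CARD('n) - 1) * (a + (\<Sum>i\<in>UNIV. b i * c i))" by simp
  moreover have "M UNIV = det (\<chi> i j. (if i = j then a else 0) + b i * c j :: 'a^'n^'n)"
    unfolding M_def by (intro arg_cong[of _ _ det]) (auto simp: vec_eq_iff e_def C_def)
  ultimately show ?thesis by simp
qed

section \<open>Hermitian matrices of radial shape\<close>

definition cip :: "complex^'n \<Rightarrow> complex^'n \<Rightarrow> complex" where
  "cip v w = (\<Sum>i\<in>UNIV. v $ i * cnj (w $ i))"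

text \<open>The complex Hessian of a radial function has this shape: \<open>p\<close> is the
  eigenvalue on vectors orthogonal to \<open>x\<close>, and \<open>p + q * |x|^2\<close> the one in
  the direction of \<open>x\<close>.\<close>

definition rmat :: "complex \<Rightarrow> complex \<Rightarrow> complex^'n \<Rightarrow> complex^'n^'n" where
  "rmat p q x = (\<chi> i j. (if i = j then p else 0) + q * cnj (x $ i) * x $ j)"

lemma cip_add_left: "cip (v + v') w = cip v w + cip v' w"
  by (simp add: cip_def sum.distrib distrib_right)

lemma cip_scale_left: "cip (c *s v) w = c * cip v w"
  by (simp add: cip_def sum_distrib_left mult.assoc)

lemma cip_scale_right: "cip v (c *s w) = cnj c * cip v w"
  by (simp add: cip_def sum_distrib_left mult_ac)

lemma cip_axis: "cip v (axis i 1) = v $ i" "cip (axis i 1) v = cnj (v $ i)"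
proof -
  have "cip v (axis i 1) = (\<Sum>j\<in>UNIV. if j = i then v $ j else 0)"
    "cip (axis i 1) v = (\<Sum>j\<in>UNIV. if j = i then cnj (v $ j) else 0)"
    unfolding cip_def by (intro sum.cong refl; simp add: axis_def)+
  then show "cip v (axis i 1) = v $ i" "cip (axis i 1) v = cnj (v $ i)" by simp_all
qed

lemma cnj_cip: "cnj (cip v w) = cip w v"
  by (simp add: cip_def mult.commute)

lemma cip_self: "cip v v = of_real ((norm v)\<^sup>2)"
  by (simp add: cip_def norm_vec_def L2_set_def sum_nonneg complex_norm_square del: of_real_power)

lemma Re_cip: "Re (cip v w) = inner v w"
  by (simp add: cip_def inner_vec_def inner_complex_def)

lemma sesq_rmat: "sesq (rmat p q x) v w = p * cip v w + q * cip v x * cip x w"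
proof -
  have "sesq (rmat p q x) v w = (\<Sum>i\<in>UNIV. \<Sum>j\<in>UNIV. (if i = j then p else 0) * v $ i * cnj (w $ j))
      + (\<Sum>i\<in>UNIV. \<Sum>j\<in>UNIV. q * (v $ i * cnj (x $ i)) * (x $ j * cnj (w $ j)))"
    unfolding sesq_def rmat_def by (simp add: sum.distrib[symmetric] algebra_simps)
  also have "(\<Sum>i\<in>UNIV. \<Sum>j\<in>UNIV. (if i = j then p else 0) * v $ i * cnj (w $ j)) = p * cip v w"
    unfolding cip_def by (simp add: if_distrib[of "\<lambda>x. x * _"] sum_distrib_left mult.assoc cong: if_cong)
  also have "(\<Sum>i\<in>UNIV. \<Sum>j\<in>UNIV. q * (v $ i * cnj (x $ i)) * (x $ j * cnj (w $ j))) = q * cip v x * cip x w"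
    unfolding cip_def mult.assoc[of q] sum_product by (simp only: sum_distrib_left)
  finally show ?thesis .
qed

lemma det_rmat:
  "det (rmat p q x :: complex^'n^'n) = p ^ (CARD('n) - 1) * (p + q * of_real ((norm x)\<^sup>2))"
proof -
  have "rmat p q x = (\<chi> i j. (if i = j then p else 0) + (q * cnj (x $ i)) * x $ j)" by (simp add: rmat_def)
  moreover have "(\<Sum>i\<in>UNIV. (q * cnj (x $ i)) * x $ i) = q * of_real ((norm x)\<^sup>2)"
    unfolding cip_self[symmetric] cip_def by (simp add: sum_distrib_left mult_ac)
  ultimately show ?thesis by (simp only: det_scalar_plus_rank_one)
qed

text \<open>Over the polynomials in \<open>s\<close> the pencil is again scalar plus rank one. Its
  determinant is the tangential linear factor to the power \<open>n - 1\<close> times the radial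
  one.\<close>

lemma coeff_det_rmat_pencil:
  assumes k: "1 \<le> k" "k \<le> CARD('n)"
  shows "coeff (det (\<chi> i j. [: rmat p q x $ i $ j, rmat p' q' x $ i $ j :] :: complex poly^'n^'n)) k =
    of_nat ((CARD('n) - 1) choose k) * p' ^ k * p ^ (CARD('n) - 1 - k) * (p + q * of_real ((norm x)\<^sup>2))
    + of_nat ((CARD('n) - 1) choose (k - 1)) * p' ^ (k - 1) * p ^ (CARD('n) - k) * (p' + q' * of_real ((norm x)\<^sup>2))"
proof -
  let ?n = "CARD('n) - 1"
  have "(\<chi> i j. [: rmat p q x $ i $ j, rmat p' q' x $ i $ j :] :: complex poly^'n^'n) =
     (\<chi> i j. (if i = j then [:p, p':] else 0) + (smult (cnj (x $ i)) [:q, q':]) * [:x $ j:])"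
    by (simp add: vec_eq_iff rmat_def mult_ac)
  then have "det (\<chi> i j. [: rmat p q x $ i $ j, rmat p' q' x $ i $ j :] :: complex poly^'n^'n)
     = [:p, p':] ^ ?n * ([:p, p':] + (\<Sum>i\<in>UNIV. (smult (cnj (x $ i)) [:q, q':]) * [:x $ i:]))"
    by (simp only: det_scalar_plus_rank_one)
  also have "(\<Sum>i\<in>UNIV. (smult (cnj (x $ i)) [:q, q':]) * [:x $ i:]) = smult (of_real ((norm x)\<^sup>2)) [:q, q':]"
  proof -
    have "(\<Sum>i\<in>UNIV. (smult (cnj (x $ i)) [:q, q':]) * [:x $ i:]) = (\<Sum>i\<in>UNIV. smult (x $ i * cnj (x $ i)) [:q, q':])"
      by (simp add: mult_ac)
    also have "\<dots> = smult (\<Sum>i\<in>UNIV. x $ i * cnj (x $ i)) [:q, q':]"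
      by (simp only: smult_sum)
    finally show ?thesis unfolding cip_self[symmetric] cip_def .
  qed
  also have "[:p, p':] + smult (of_real ((norm x)\<^sup>2)) [:q, q':] = [:p + q * of_real ((norm x)\<^sup>2), p' + q' * of_real ((norm x)\<^sup>2):]"
    by (simp add: mult.commute)
  finally have det: "det (\<chi> i j. [: rmat p q x $ i $ j, rmat p' q' x $ i $ j :] :: complex poly^'n^'n)
     = [:p, p':] ^ ?n * [:p + q * of_real ((norm x)\<^sup>2), p' + q' * of_real ((norm x)\<^sup>2):]" .
  have c: "coeff ([:p, p':] ^ ?n) i = of_nat (?n choose i) * p' ^ i * p ^ (?n - i)" for i
  proof (cases "i \<le> ?n")
    case True
    then show ?thesis by (rule coeff_linear_poly_power)
  next
    case False
    have "degree ([:p, p':] ^ ?n) \<le> degree [:p, p':] * ?n" by (rule degree_power_le)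
    also have "\<dots> \<le> 1 * ?n" by (intro mult_right_mono) auto
    finally show ?thesis using False by (simp add: coeff_eq_0 binomial_eq_0)
  qed
  have prod: "coeff (P * [:A, B:]) k = coeff P k * A + coeff P (k - 1) * B" for P :: "complex poly" and A B
  proof -
    have "P * [:A, B:] = smult A P + pCons 0 (smult B P)" by (simp add: mult_pCons_right)
    then show ?thesis using k by (cases k) (auto simp: mult.commute)
  qed
  have "?n - (k - 1) = CARD('n) - k" using k by simp
  then show ?thesis unfolding det prod c by (simp only:)
qed

lemma has_derivative_radial:
  fixes y :: "complex^'n"
  assumes \<psi>: "(\<psi> has_real_derivative \<psi>') (at (ln ((norm y)\<^sup>2)))" and y: "y \<noteq> 0"
  shows "((\<lambda>y. \<psi> (ln ((norm y)\<^sup>2))) has_derivative (\<lambda>v. \<psi>' * (2 * Re (cip v y) / (norm y)\<^sup>2))) (at y)"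
proof -
  have pos: "0 < inner y y" using y by simp
  have "((\<lambda>y. ln (inner y y)) has_derivative (\<lambda>v. (inner y v + inner v y) * inverse (inner y y))) (at y)"
    by (rule has_derivative_ln[where g = "\<lambda>y. inner y y", OF pos]) (auto intro!: derivative_eq_intros)
  from has_derivative_compose[OF this, of \<psi> "(*) \<psi>'"] \<psi>
  show ?thesis
    by (simp add: has_field_derivative_def power2_norm_eq_inner Re_cip inner_commute divide_inverse)
qed

lemma dz_radial:
  fixes y :: "complex^'n"
  assumes \<psi>: "(\<psi> has_real_derivative \<psi>') (at (ln ((norm y)\<^sup>2)))" and y: "y \<noteq> 0"
  shows "dz i (\<lambda>y. complex_of_real (\<psi> (ln ((norm y)\<^sup>2)))) y = of_real (\<psi>' / (norm y)\<^sup>2) * cnj (y $ i)"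
    and "dzbar i (\<lambda>y. complex_of_real (\<psi> (ln ((norm y)\<^sup>2)))) y = of_real (\<psi>' / (norm y)\<^sup>2) * y $ i"
    and "(\<lambda>y. complex_of_real (\<psi> (ln ((norm y)\<^sup>2)))) differentiable at y"
proof -
  have D: "((\<lambda>y. complex_of_real (\<psi> (ln ((norm y)\<^sup>2)))) has_derivative
      (\<lambda>v. complex_of_real (\<psi>' * (2 * Re (cip v y) / (norm y)\<^sup>2)))) (at y)"
    by (rule bounded_linear.has_derivative[OF bounded_linear_of_real has_derivative_radial[OF \<psi> y]])
  have "axis i \<i> = \<i> *s axis i (1::complex)"
    by (simp add: vec_eq_iff axis_def)
  then have c: "cip (axis i \<i>) y = \<i> * cnj (y $ i)" "cip (axis i 1) y = cnj (y $ i)"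
    by (simp_all add: cip_scale_left cip_axis)
  show "dz i (\<lambda>y. complex_of_real (\<psi> (ln ((norm y)\<^sup>2)))) y = of_real (\<psi>' / (norm y)\<^sup>2) * cnj (y $ i)"
    "dzbar i (\<lambda>y. complex_of_real (\<psi> (ln ((norm y)\<^sup>2)))) y = of_real (\<psi>' / (norm y)\<^sup>2) * y $ i"
    unfolding dz_has_derivative[OF D] c by (simp_all add: complex_eq_iff field_simps)
  show "(\<lambda>y. complex_of_real (\<psi> (ln ((norm y)\<^sup>2)))) differentiable at y"
    using D unfolding differentiable_def by blast
qed

lemma dz_component: "dz i (\<lambda>y. y $ j) x = (if i = j then 1 else 0)" "(\<lambda>y::complex^'n. y $ j) differentiable at x"
proof -
  have D: "((\<lambda>y::complex^'n. y $ j) has_derivative (\<lambda>v. v $ j)) (at x)"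
    by (rule bounded_linear.has_derivative[OF bounded_linear_vec_nth has_derivative_ident])
  show "dz i (\<lambda>y. y $ j) x = (if i = j then 1 else 0)"
    unfolding dz_has_derivative[OF D] by (simp add: axis_def)
  show "(\<lambda>y::complex^'n. y $ j) differentiable at x"
    using D unfolding differentiable_def by blast
qed

lemma ddbar_radial:
  fixes x :: "complex^'n"
  assumes V: "open V" "x \<in> V" "0 \<notin> V"
    and \<phi>: "\<And>y. y \<in> V \<Longrightarrow> (\<phi> has_real_derivative \<phi>1 (ln ((norm y)\<^sup>2))) (at (ln ((norm y)\<^sup>2)))"
    and \<phi>1: "(\<phi>1 has_real_derivative \<phi>2) (at (ln ((norm x)\<^sup>2)))"
  shows "ddbar (\<lambda>y. complex_of_real (\<phi> (ln ((norm y)\<^sup>2)))) x =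
    rmat (of_real (\<phi>1 (ln ((norm x)\<^sup>2)) / (norm x)\<^sup>2)) (of_real ((\<phi>2 - \<phi>1 (ln ((norm x)\<^sup>2))) / ((norm x)\<^sup>2)\<^sup>2)) x"
proof -
  have nz: "y \<noteq> 0" if "y \<in> V" for y using that V by auto
  \<comment> \<open>The factor \<open>exp (- t)\<close> absorbs \<open>1 / |y|^2\<close>, so that
    the first derivative is a radial function times \<open>y $ j\<close> and
    \<open>dz_radial\<close> applies once more.\<close>
  define \<psi> where "\<psi> = (\<lambda>t. \<phi>1 t * exp (- t))"
  define t where "t = ln ((norm x)\<^sup>2)"
  have e: "exp (- ln ((norm y)\<^sup>2)) = inverse ((norm y)\<^sup>2)" if "y \<noteq> 0" for y :: "complex^'n"
    using that by (simp add: exp_minus)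
  have \<psi>: "(\<psi> has_real_derivative (\<phi>2 - \<phi>1 t) * exp (- t)) (at (ln ((norm x)\<^sup>2)))"
    unfolding \<psi>_def t_def by (rule derivative_eq_intros \<phi>1 refl | simp add: algebra_simps)+
  have "dz i (dzbar j (\<lambda>y. complex_of_real (\<phi> (ln ((norm y)\<^sup>2))))) x =
      (if i = j then of_real (\<phi>1 t / (norm x)\<^sup>2) else 0) + of_real ((\<phi>2 - \<phi>1 t) / ((norm x)\<^sup>2)\<^sup>2) * cnj (x $ i) * x $ j" for i j
  proof -
    have "dz i (dzbar j (\<lambda>y. complex_of_real (\<phi> (ln ((norm y)\<^sup>2))))) x =
        dz i (\<lambda>y. complex_of_real (\<psi> (ln ((norm y)\<^sup>2))) * y $ j) x"
    proof (rule dz_cong(1)[OF V(1,2)])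
      fix y assume y: "y \<in> V"
      show "dzbar j (\<lambda>y. complex_of_real (\<phi> (ln ((norm y)\<^sup>2)))) y = complex_of_real (\<psi> (ln ((norm y)\<^sup>2))) * y $ j"
        unfolding dz_radial(2)[OF \<phi>[OF y] nz[OF y]] \<psi>_def e[OF nz[OF y]] divide_inverse ..
    qed
    also have "\<dots> = of_real ((\<phi>2 - \<phi>1 t) * exp (- t) / (norm x)\<^sup>2) * cnj (x $ i) * x $ j
        + complex_of_real (\<psi> t) * (if i = j then 1 else 0)"
      unfolding dz_mult[OF dz_radial(3)[OF \<psi> nz[OF V(2)]] dz_component(2)] dz_radial(1)[OF \<psi> nz[OF V(2)]] dz_component(1) t_def ..
    also have "(\<phi>2 - \<phi>1 t) * exp (- t) / (norm x)\<^sup>2 = (\<phi>2 - \<phi>1 t) / ((norm x)\<^sup>2)\<^sup>2"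
      unfolding t_def e[OF nz[OF V(2)]] by (simp add: divide_simps power2_eq_square)
    also have "\<psi> t = \<phi>1 t / (norm x)\<^sup>2"
      unfolding \<psi>_def unfolding t_def e[OF nz[OF V(2)]] divide_inverse ..
    finally show ?thesis by simp
  qed
  then show ?thesis by (simp add: ddbar_def rmat_def vec_eq_iff t_def)
qed

section \<open>The profile of a radial potential\<close>

lemma smooth_on_real_deriv:
  fixes g :: "real \<Rightarrow> real"
  assumes "open S" "smooth_on S g"
  shows "t \<in> S \<Longrightarrow> (g has_real_derivative deriv g t) (at t)" and "smooth_on S (deriv g)"
proof -
  have D: "(g has_real_derivative frechet_derivative g (at t) 1) (at t)" if "t \<in> S" for t
  proof -
    have "linear (frechet_derivative g (at t))"
      using smooth_on_has_derivative[OF assms(2) that] has_derivative_linear by blast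
    then have lin: "frechet_derivative g (at t) v = frechet_derivative g (at t) 1 * v" for v
      using linear_scale[of "frechet_derivative g (at t)" v 1] by simp
    show ?thesis
      unfolding has_field_derivative_def
      by (rule has_derivative_eq_rhs[OF smooth_on_has_derivative[OF assms(2) that]]) (rule ext, rule lin)
  qed
  have eq: "frechet_derivative g (at t) 1 = deriv g t" if "t \<in> S" for t
    using DERIV_imp_deriv[OF D[OF that]] by simp
  show "(g has_real_derivative deriv g t) (at t)" if "t \<in> S"
    using D[OF that] unfolding eq[OF that] .
  show "smooth_on S (deriv g)"
    by (rule smooth_on_cong[OF assms(1) smooth_on_frechet_derivative[OF assms(2)] eq])
qed

text \<open>The operator \<open>d/dt\<close> for \<open>t = ln r\<close>, written in the variable
  \<open>r\<close>.\<close>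

definition euler :: "(real \<Rightarrow> real) \<Rightarrow> real \<Rightarrow> real" where
  "euler g r = r * deriv g r"

lemma smooth_on_ident: "open S \<Longrightarrow> smooth_on S (\<lambda>x. x)"
  by (rule smooth_onI[where D = "\<lambda>x v. v"]) (auto intro: smooth_on_const)

lemma smooth_on_euler: "open S \<Longrightarrow> smooth_on S g \<Longrightarrow> smooth_on S (euler g)"
  unfolding euler_def by (intro smooth_on_mult smooth_on_ident smooth_on_real_deriv(2))

lemma euler_exp:
  assumes "open S" "smooth_on S g" "exp t \<in> S"
  shows "((\<lambda>t. g (exp t)) has_real_derivative euler g (exp t)) (at t)"
  using DERIV_chain2[OF smooth_on_real_deriv(1)[OF assms] DERIV_exp]
  by (simp add: euler_def mult.commute)

text \<open>Replacing \<open>w\<close> by \<open>\<i> *s w\<close> multiplies the two halves of the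
  form by \<open>- \<i>\<close> and \<open>\<i>\<close>, so one half can be isolated. Identities of
  2-forms thereby become identities of matrices, without any symmetry assumption.\<close>

lemma sesq_form11:
  "sesq h v w = - \<i> * (form11 h v w + \<i> * form11 h v (\<i> *s w))"
proof -
  define A B where "A = (\<Sum>i\<in>UNIV. \<Sum>j\<in>UNIV. h $ i $ j * (v $ i * cnj (w $ j)))"
    and "B = (\<Sum>i\<in>UNIV. \<Sum>j\<in>UNIV. h $ i $ j * (w $ i * cnj (v $ j)))"
  have "sesq h v w = A" by (simp add: sesq_def A_def mult.assoc)
  moreover have "form11 h v w = \<i> / 2 * (A - B)"
    by (simp add: form11_def A_def B_def right_diff_distrib sum_subtractf)
  moreover have "form11 h v (\<i> *s w) = \<i> / 2 * (- \<i> * A - \<i> * B)"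
    by (simp add: form11_def A_def B_def right_diff_distrib sum_subtractf sum_distrib_left mult_ac)
  ultimately show ?thesis by (simp only:) (simp add: complex_eq_iff field_simps)
qed

lemma form11_sesq:
  "form11 h v w = \<i> / 2 * (sesq h v w - sesq h w v)"
  by (simp add: form11_def sesq_def right_diff_distrib sum_subtractf mult.assoc)

lemma form11_eq_imp_eq: "(\<And>v w. form11 h v w = form11 h' v w) \<Longrightarrow> h = h'"
  by (rule sesq_eq_imp_matrix_eq) (simp add: sesq_form11)

lemma orthogonal_vector:
  fixes x :: "complex^'n"
  assumes "2 \<le> CARD('n)"
  obtains v where "v \<noteq> 0" "cip v x = 0"
proof (cases "\<exists>k. x $ k = 0")
  case True
  then obtain k where "x $ k = 0" by blast
  then show ?thesis using that[of "axis k 1"] by (simp add: cip_axis)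
next
  case False
  have "\<exists>i j :: 'n. i \<noteq> j"
    using assms card_2_iff'[of "UNIV :: 'n set"] ex_card[of 2 "UNIV :: 'n set"] by (metis card_2_iff)
  then obtain i j :: 'n where ij: "i \<noteq> j" by blast
  define v where "v = cnj (x $ j) *s axis i 1 + (- cnj (x $ i)) *s axis j 1"
  have "v $ i = cnj (x $ j)" using ij by (simp add: v_def axis_def)
  then have "v \<noteq> 0" using False by force
  moreover have "cip v x = 0"
    by (simp only: v_def cip_add_left cip_scale_left cip_axis) simp
  ultimately show ?thesis by (rule that)
qed

text \<open>The situation in the global coordinates: \<open>U\<close> is their image,
  \<open>h\<close> the metric. Only nonzero points must have \<open>|x|^2\<close> in
  \<open>J\<close>, as \<open>f\<close> need not be smooth at the end \<open>r = 0\<close>.\<close>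

locale radial_geometry =
  fixes U :: "(complex^'n) set" and h :: "complex^'n \<Rightarrow> complex^'n^'n" and f :: "real \<Rightarrow> real" and J :: "real set"
  assumes U: "open U" "connected U" "U \<noteq> {}"
    and J: "open J" "smooth_on J f"
    and dom: "\<And>x. x \<in> U \<Longrightarrow> x \<noteq> 0 \<Longrightarrow> (norm x)\<^sup>2 \<in> J"
    and potential: "\<And>x. x \<in> U \<Longrightarrow> h x = ddbar (\<lambda>y. complex_of_real (f ((norm y)\<^sup>2))) x"
    and herm: "\<And>x i j. x \<in> U \<Longrightarrow> h x $ j $ i = cnj (h x $ i $ j)"
    and pos: "\<And>x v. x \<in> U \<Longrightarrow> v \<noteq> 0 \<Longrightarrow> 0 < Re (sesq (h x) v v)"
    and smooth: "\<And>i j. smooth_on U (\<lambda>x. h x $ i $ j)"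
begin

definition ric :: "complex^'n \<Rightarrow> complex^'n^'n" where
  "ric x = - ddbar (\<lambda>y. complex_of_real (ln (Re (det (h y))))) x"

definition I :: "real set" where "I = (\<lambda>x. ln ((norm x)\<^sup>2)) ` (U - {0})"

definition n :: nat where "n = CARD('n)"

text \<open>Indexed so that \<open>Y 0\<close> is \<open>r * f'(r)\<close> and \<open>Y k\<close>
  its \<open>k\<close>-th derivative in \<open>t\<close>.\<close>

definition Y :: "nat \<Rightarrow> real \<Rightarrow> real" where "Y k = (euler ^^ Suc k) f"

definition S :: "nat \<Rightarrow> real \<Rightarrow> real" where
  "S k = (euler ^^ k) (\<lambda>r. real n - (real n - 1) * Y 1 r / Y 0 r - Y 2 r / Y 1 r)"

definition y :: "nat \<Rightarrow> real \<Rightarrow> real" where "y k t = Y k (exp t)"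

definition \<sigma> :: "nat \<Rightarrow> real \<Rightarrow> real" where "\<sigma> k t = S k (exp t)"

text \<open>The values of \<open>r\<close> at which the quotients in \<open>S\<close> make sense.
  For \<open>n = 1\<close> the quotient by \<open>Y 0\<close> is multiplied by 0, so no sign of
  \<open>Y 0\<close> is demanded.\<close>

definition E :: "real set" where
  "E = {r \<in> J. 0 < r \<and> 0 < Y 1 r \<and> (2 \<le> n \<longrightarrow> 0 < Y 0 r)}"

lemma smooth_Y: "smooth_on (J \<inter> {0<..}) (Y k)"
proof (induction k)
  case 0
  have "smooth_on (J \<inter> {0<..}) f" by (rule smooth_on_subset[OF J(2)]) auto
  then show ?case unfolding Y_def using J(1) by (simp add: smooth_on_euler open_Int)
next
  case (Suc k)
  have "Y (Suc k) = euler (Y k)" by (simp add: Y_def)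
  then show ?case using Suc J(1) by (simp add: smooth_on_euler open_Int)
qed

lemma open_E: "open E"
proof -
  let ?J = "J \<inter> {0<..}"
  have c: "continuous_on ?J (Y k)" for k by (rule smooth_on_continuous[OF smooth_Y])
  have o: "open (?J \<inter> Y k -` {0<..})" for k
    by (rule continuous_open_preimage[OF c]) (use J in auto)
  have "E = (?J \<inter> Y 1 -` {0<..}) \<inter> (if 2 \<le> n then ?J \<inter> Y 0 -` {0<..} else UNIV)"
    by (auto simp: E_def)
  then show ?thesis using o by auto
qed

lemma smooth_S: "smooth_on E (S k)"
proof (induction k)
  case 0
  have Y: "smooth_on E (Y k)" for k by (rule smooth_on_subset[OF smooth_Y]) (auto simp: E_def)
  have Y1: "Y 1 r \<noteq> 0" if "r \<in> E" for r using that by (auto simp: E_def)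
  have "smooth_on E (\<lambda>r. real n + (- (real n - 1)) * (Y 1 r * inverse (Y 0 r)) + (- 1) * (Y 2 r * inverse (Y 1 r)))"
  proof (cases "2 \<le> n")
    case True
    then have "Y 0 r \<noteq> 0" if "r \<in> E" for r using that by (auto simp: E_def)
    then show ?thesis by (intro smooth_on_add smooth_on_mult smooth_on_const smooth_on_inverse Y Y1 open_E)
  next
    case False
    then have "n = 1" using zero_less_card_finite[where 'a = 'n] unfolding n_def by linarith
    have "smooth_on E (\<lambda>r. 1 + (- 1) * (Y 2 r * inverse (Y 1 r)))"
      by (intro smooth_on_add smooth_on_mult smooth_on_const smooth_on_inverse Y Y1 open_E)
    then show ?thesis by (simp add: \<open>n = 1\<close>)
  qed
  then show ?case
    unfolding S_def funpow_0
    by (rule smooth_on_cong[OF open_E]) (simp add: divide_inverse algebra_simps)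
next
  case (Suc k)
  have "S (Suc k) = euler (S k)" by (simp add: S_def)
  then show ?case using Suc by (simp add: smooth_on_euler open_E)
qed

lemma y_deriv:
  assumes "exp t \<in> J" shows "(y k has_real_derivative y (Suc k) t) (at t)"
  using euler_exp[OF _ smooth_Y, of t k] J(1) assms
  by (simp add: y_def[abs_def] Y_def open_Int)

lemma \<sigma>_deriv:
  assumes "exp t \<in> E" shows "(\<sigma> k has_real_derivative \<sigma> (Suc k) t) (at t)"
  using euler_exp[OF open_E smooth_S assms, of k] by (simp add: \<sigma>_def[abs_def] S_def)

lemma h_eq:
  assumes x: "x \<in> U" "x \<noteq> 0"
  shows "h x = rmat (of_real (y 0 (ln ((norm x)\<^sup>2)) / (norm x)\<^sup>2))
     (of_real ((y 1 (ln ((norm x)\<^sup>2)) - y 0 (ln ((norm x)\<^sup>2))) / ((norm x)\<^sup>2)\<^sup>2)) x"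
proof -
  have V: "open (U - {0})" "x \<in> U - {0}" "0 \<notin> U - {0}" using U x by (auto intro: open_delete)
  have J': "exp (ln ((norm y)\<^sup>2)) \<in> J" if "y \<in> U - {0}" for y
    using dom[of y] that by simp
  have "h x = ddbar (\<lambda>y. complex_of_real ((\<lambda>t. f (exp t)) (ln ((norm y)\<^sup>2)))) x"
    unfolding potential[OF x(1)] by (rule ddbar_cong[OF V(1,2)]) simp
  also have "\<dots> = rmat (of_real (y 0 (ln ((norm x)\<^sup>2)) / (norm x)\<^sup>2))
     (of_real ((y 1 (ln ((norm x)\<^sup>2)) - y 0 (ln ((norm x)\<^sup>2))) / ((norm x)\<^sup>2)\<^sup>2)) x"
  proof (rule ddbar_radial[OF V])
    fix z assume z: "z \<in> U - {0}"
    show "((\<lambda>t. f (exp t)) has_real_derivative y 0 (ln ((norm z)\<^sup>2))) (at (ln ((norm z)\<^sup>2)))"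
      using euler_exp[OF J J'[OF z]] by (simp add: y_def Y_def)
  next
    show "(y 0 has_real_derivative y 1 (ln ((norm x)\<^sup>2))) (at (ln ((norm x)\<^sup>2)))"
      using y_deriv[OF J'[OF V(2)], of 0] by simp
  qed
  finally show ?thesis .
qed

text \<open>Positivity of the metric is tested on \<open>x\<close> itself for \<open>y 1\<close>,
  and on a vector orthogonal to \<open>x\<close>, available for \<open>n \<ge> 2\<close>, for
  \<open>y 0\<close>.\<close>

lemma norm_in_E:
  assumes x: "x \<in> U" "x \<noteq> 0" shows "exp (ln ((norm x)\<^sup>2)) \<in> E"
proof -
  define r where "r = (norm x)\<^sup>2"
  have r: "0 < r" using x by (simp add: r_def)
  define t where "t = ln r"
  have h: "h x = rmat (of_real (y 0 t / r)) (of_real ((y 1 t - y 0 t) / r\<^sup>2)) x"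
    using h_eq[OF x] by (simp add: t_def r_def)
  have "sesq (h x) x x = of_real (y 1 t)"
    unfolding h sesq_rmat cip_self r_def[symmetric] using r
    by (simp add: field_simps power2_eq_square flip: of_real_mult of_real_add)
  then have "0 < y 1 t" using pos[OF x(1,2)] by simp
  moreover have "0 < y 0 t" if n2: "2 \<le> n"
  proof -
    obtain v where v: "v \<noteq> 0" "cip v x = 0" using orthogonal_vector n2 unfolding n_def by blast
    have "sesq (h x) v v = of_real (y 0 t / r * (norm v)\<^sup>2)"
      unfolding h sesq_rmat cip_self v(2) by simp
    then have "0 < y 0 t / r * (norm v)\<^sup>2" using pos[OF x(1) v(1)] by simp
    then show ?thesis using r v(1) by (simp add: zero_less_mult_iff zero_less_divide_iff)
  qed
  ultimately show ?thesis
    using dom[OF x] r by (simp add: E_def y_def t_def r_def)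
qed

lemma I_in_E: "t \<in> I \<Longrightarrow> exp t \<in> E"
  unfolding I_def using norm_in_E by blast

lemma ln_norm_in_I: "x \<in> U \<Longrightarrow> x \<noteq> 0 \<Longrightarrow> ln ((norm x)\<^sup>2) \<in> I"
  unfolding I_def by blast

text \<open>The shift by \<open>2 * Re w\<close> is the source of the factors 2 and 4 in the
  equations along these curves.\<close>

lemma ln_norm_exp:
  assumes "a \<noteq> (0::complex^'n)" shows "ln ((norm (exp w *s a))\<^sup>2) = ln ((norm a)\<^sup>2) + 2 * Re w"
proof -
  have "ln ((norm (exp w *s a))\<^sup>2) = ln (exp (2 * Re w) * (norm a)\<^sup>2)"
    by (simp add: norm_vector_smult power_mult_distrib flip: exp_double)
  also have "\<dots> = 2 * Re w + ln ((norm a)\<^sup>2)" using assms by (subst ln_mult) auto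
  finally show ?thesis by simp
qed

lemma open_exp_preimage:
  fixes a :: "complex^'n"
  assumes "open V" shows "open {w. exp w *s a \<in> V}"
proof -
  have "continuous_on UNIV (\<lambda>w. exp w *s a)"
    by (intro continuous_intros bounded_linear.continuous_on[OF bounded_linear_smult_left])
  then show ?thesis using open_vimage[OF assms, of "\<lambda>w. exp w *s a"] by (simp add: vimage_def)
qed

text \<open>Removing the origin keeps \<open>U\<close> connected since its real dimension is at
  least 2. Openness comes from moving a point along \<open>exp w *s x\<close> with real
  \<open>w\<close>, which changes \<open>t\<close> freely.\<close>

lemma I_open_connected: "open I" "connected I" "I \<noteq> {}"
proof -
  have ne: "U - {0} \<noteq> {}"
  proof
    assume "U - {0} = {}"
    then have "U = {0}" using U(3) by auto
    then show False using U(1) not_open_singleton by metis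
  qed
  then show "I \<noteq> {}" by (simp add: I_def)
  have "2 \<le> DIM(complex^'n)" by simp
  then have "connected (U - {0})" by (rule connected_open_delete[OF U(1,2)])
  then show "connected I"
    unfolding I_def by (rule connected_continuous_image[rotated]) (auto intro!: continuous_intros)
  show "open I"
    unfolding open_contains_ball
  proof
    fix t assume "t \<in> I"
    then obtain x where x: "x \<in> U" "x \<noteq> 0" "t = ln ((norm x)\<^sup>2)" unfolding I_def by auto
    have "(0::complex) \<in> {w. exp w *s x \<in> U}" using x by simp
    then obtain e where e: "e > 0" "ball 0 e \<subseteq> {w. exp w *s x \<in> U}"
      using open_exp_preimage[OF U(1), of x] open_contains_ball by blast
    have "ball t (2 * e) \<subseteq> I"
    proof
      fix s assume "s \<in> ball t (2 * e)"
      then have "complex_of_real ((s - t) / 2) \<in> ball 0 e" by (simp add: dist_norm norm_divide flip: of_real_diff)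
      then have "exp (complex_of_real ((s - t) / 2)) *s x \<in> U" using e(2) by blast
      moreover have "exp (complex_of_real ((s - t) / 2)) *s x \<noteq> 0" using x by (simp add: vector_mul_eq_0)
      moreover have "s = ln ((norm (exp (complex_of_real ((s - t) / 2)) *s x))\<^sup>2)"
        unfolding ln_norm_exp[OF x(2)] using x(3) by (simp add: field_simps)
      ultimately show "s \<in> I" unfolding I_def by blast
    qed
    then show "\<exists>e>0. ball t e \<subseteq> I" using e(1) by (intro exI[of _ "2 * e"]) simp
  qed
qed

sublocale radial_profile n I "y 0" "y 1" "y 2" "\<sigma> 0" "\<sigma> 1" "\<sigma> 2" "\<sigma> 3"
proof
  fix t assume t: "t \<in> I"
  have E: "exp t \<in> E" by (rule I_in_E[OF t])
  then have J: "exp t \<in> J" by (simp add: E_def)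
  show "(y 0 has_real_derivative y 1 t) (at t)" using y_deriv[OF J, of 0] by simp
  show "(y 1 has_real_derivative y 2 t) (at t)" using y_deriv[OF J, of 1] by (simp add: numeral_2_eq_2)
  show "(\<sigma> 0 has_real_derivative \<sigma> 1 t) (at t)" using \<sigma>_deriv[OF E, of 0] by simp
  show "(\<sigma> 1 has_real_derivative \<sigma> 2 t) (at t)" using \<sigma>_deriv[OF E, of 1] by (simp add: numeral_2_eq_2)
  show "(\<sigma> 2 has_real_derivative \<sigma> 3 t) (at t)" using \<sigma>_deriv[OF E, of 2] by (simp add: numeral_eq_Suc)
  show y1: "0 < y 1 t" using E by (simp add: E_def y_def)
  show "0 < y 0 t" if "2 \<le> n" using E that by (simp add: E_def y_def)
  show "\<sigma> 0 t * y 1 t = real n * y 1 t - (real n - 1) * (y 1 t)\<^sup>2 / y 0 t - y 2 t"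
    using y1 unfolding \<sigma>_def y_def S_def by (simp add: divide_simps power2_eq_square algebra_simps)
qed (use I_open_connected in \<open>auto simp: n_def Suc_le_eq\<close>)

end

section \<open>Ricci tensor and generalized scalar curvatures of a radial metric\<close>

lemma scaleR_matrix_nth: "(c *\<^sub>R (H :: complex^'n^'m)) $ i $ j = of_real c * H $ i $ j"
  unfolding vector_scaleR_component by (rule scaleR_conv_of_real)

lemma ln_power_mult: "0 < a \<Longrightarrow> 0 < b \<Longrightarrow> ln (a ^ m * b) = real m * ln a + ln (b :: real)"
  by (simp add: ln_mult ln_realpow)

lemma Re_mult_of_real: "Re (c * of_real x) = Re c * x"
  by simp

lemma rmat_scale: "rmat (of_real (l * p)) (of_real (l * q)) x = l *\<^sub>R rmat (of_real p) (of_real q) x"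
  by (simp only: vec_eq_iff scaleR_matrix_nth) (simp add: rmat_def algebra_simps)

context radial_geometry
begin

declare One_nat_def [simp del]

lemma nz_open: "open (U - {0})" "0 \<notin> U - {0}"
  using U(1) by (auto intro: open_delete)

lemma det_h:
  assumes x: "x \<in> U" "x \<noteq> 0"
  defines "t \<equiv> ln ((norm x)\<^sup>2)"
  shows "det (h x) = of_real ((y 0 t / (norm x)\<^sup>2) ^ (n - 1) * (y 1 t / (norm x)\<^sup>2))"
proof -
  define r where "r = (norm x)\<^sup>2"
  have r: "0 < r" using x by (simp add: r_def)
  have "h x = rmat (of_real (y 0 t / r)) (of_real ((y 1 t - y 0 t) / r\<^sup>2)) x"
    using h_eq[OF x] by (simp add: t_def r_def)
  then have "det (h x) = of_real (y 0 t / r) ^ (n - 1) * (of_real (y 0 t / r) + of_real ((y 1 t - y 0 t) / r\<^sup>2) * of_real r)"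
    unfolding n_def r_def by (simp only: det_rmat)
  also have "of_real (y 0 t / r) + of_real ((y 1 t - y 0 t) / r\<^sup>2) * of_real r = complex_of_real (y 1 t / r)"
    using r by (simp add: field_simps power2_eq_square flip: of_real_mult of_real_add)
  finally show ?thesis by (simp add: r_def)
qed

text \<open>The origin of \<open>\<sigma>\<close>: it is the \<open>t\<close>-derivative of the
  Ricci potential \<open>- ln det h\<close>, as \<open>y\<close> is that of the Kaehler potential.
  For \<open>n = 1\<close> the power with exponent 0 removes \<open>y 0\<close>, whose sign is
  unknown.\<close>

lemma ln_det_h_deriv:
  assumes t: "t \<in> I"
  shows "((\<lambda>t. ln ((y 0 t * exp (- t)) ^ (n - 1) * (y 1 t * exp (- t)))) has_real_derivative - \<sigma> 0 t) (at t)"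
proof -
  have y1p: "0 < y 1 t" by (rule y1_pos[OF t])
  have D: "((\<lambda>t. ln (y 1 t * exp (- t))) has_real_derivative y 2 t / y 1 t - 1) (at t)"
    using y1p by (auto intro!: derivative_eq_intros y1 t simp: field_simps)
  show ?thesis
  proof (cases "2 \<le> n")
    case False
    then have "n = 1" using n by simp
    then have "y 2 t / y 1 t - 1 = - \<sigma> 0 t" using \<sigma>_eq[OF t] y1p by (simp add: field_simps)
    then show ?thesis using D \<open>n = 1\<close> by simp
  next
    case True
    have y0: "0 < y 0 s" if "s \<in> I" for s by (rule y_pos[OF True that])
    have "((\<lambda>t. real (n - 1) * ln (y 0 t * exp (- t)) + ln (y 1 t * exp (- t)))
        has_real_derivative real (n - 1) * (y 1 t / y 0 t - 1) + (y 2 t / y 1 t - 1)) (at t)"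
    proof (rule DERIV_add[OF DERIV_cmult D])
      show "((\<lambda>t. ln (y 0 t * exp (- t))) has_real_derivative y 1 t / y 0 t - 1) (at t)"
        using y0[OF t] by (auto intro!: derivative_eq_intros y t simp: field_simps)
    qed
    moreover have "real (n - 1) * (y 1 t / y 0 t - 1) + (y 2 t / y 1 t - 1) = - \<sigma> 0 t"
    proof -
      have "\<sigma> 0 t = (real n * y 1 t - (real n - 1) * (y 1 t)\<^sup>2 / y 0 t - y 2 t) / y 1 t"
        using \<sigma>_eq[OF t] y1p by (simp add: field_simps)
      then show ?thesis using y1p y0[OF t] n by (simp add: of_nat_diff field_simps power2_eq_square)
    qed
    ultimately have "((\<lambda>t. real (n - 1) * ln (y 0 t * exp (- t)) + ln (y 1 t * exp (- t)))
        has_real_derivative - \<sigma> 0 t) (at t)" by simp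
    then show ?thesis
    proof (rule has_field_derivative_transform_within_open[OF _ I(1) t])
      fix s assume "s \<in> I"
      then have "0 < y 0 s * exp (- s)" "0 < y 1 s * exp (- s)" using y0 y1_pos by simp_all
      then show "real (n - 1) * ln (y 0 s * exp (- s)) + ln (y 1 s * exp (- s)) =
          ln ((y 0 s * exp (- s)) ^ (n - 1) * (y 1 s * exp (- s)))"
        by (rule ln_power_mult[symmetric])
    qed
  qed
qed

lemma ric_eq:
  assumes x: "x \<in> U" "x \<noteq> 0"
  shows "ric x = rmat (of_real (\<sigma> 0 (ln ((norm x)\<^sup>2)) / (norm x)\<^sup>2))
     (of_real ((\<sigma> 1 (ln ((norm x)\<^sup>2)) - \<sigma> 0 (ln ((norm x)\<^sup>2))) / ((norm x)\<^sup>2)\<^sup>2)) x"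
proof -
  define P where "P = (\<lambda>t. ln ((y 0 t * exp (- t)) ^ (n - 1) * (y 1 t * exp (- t))))"
  have V: "open (U - {0})" "x \<in> U - {0}" "0 \<notin> U - {0}" using nz_open x by auto
  have "ddbar (\<lambda>y. complex_of_real (ln (Re (det (h y))))) x = ddbar (\<lambda>y. complex_of_real (P (ln ((norm y)\<^sup>2)))) x"
  proof (rule ddbar_cong[OF V(1,2)])
    fix z assume z: "z \<in> U - {0}"
    then have e: "exp (- ln ((norm z)\<^sup>2)) = inverse ((norm z)\<^sup>2)" by (simp add: exp_minus)
    show "complex_of_real (ln (Re (det (h z)))) = complex_of_real (P (ln ((norm z)\<^sup>2)))"
      using z unfolding P_def e by (subst det_h) (auto simp: divide_inverse simp del: of_real_mult of_real_power)
  qed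
  also have "\<dots> = rmat (of_real (- \<sigma> 0 (ln ((norm x)\<^sup>2)) / (norm x)\<^sup>2))
     (of_real ((- \<sigma> 1 (ln ((norm x)\<^sup>2)) - - \<sigma> 0 (ln ((norm x)\<^sup>2))) / ((norm x)\<^sup>2)\<^sup>2)) x"
  proof (rule ddbar_radial[OF V])
    show "(P has_real_derivative - \<sigma> 0 (ln ((norm z)\<^sup>2))) (at (ln ((norm z)\<^sup>2)))" if "z \<in> U - {0}" for z
      unfolding P_def by (rule ln_det_h_deriv, rule ln_norm_in_I) (use that in auto)
    show "((\<lambda>t. - \<sigma> 0 t) has_real_derivative - \<sigma> 1 (ln ((norm x)\<^sup>2))) (at (ln ((norm x)\<^sup>2)))"
      by (rule DERIV_minus[OF \<sigma>[OF ln_norm_in_I[OF x]]])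
  qed
  finally show ?thesis
    by (simp add: ric_def rmat_def vec_eq_iff) (simp add: diff_divide_distrib algebra_simps)
qed

lemma det_h_pos: "x \<in> U \<Longrightarrow> 0 < Re (det (h x))"
  by (rule det_pos_def(1)[OF herm pos])

lemma continuous_ric: "continuous_on U (\<lambda>x. ric x $ i $ j)"
proof -
  have "smooth_on U (\<lambda>y. complex_of_real (ln (Re (det (h y)))))"
    by (intro smooth_on_bounded_linear[OF U(1) bounded_linear_of_real] smooth_on_ln[OF U(1)] det_h_pos
        smooth_on_bounded_linear[OF U(1) bounded_linear_Re] smooth_on_det[OF U(1)] smooth)
  then have "continuous_on U (dz i (dzbar j (\<lambda>y. complex_of_real (ln (Re (det (h y)))))))"
    by (intro smooth_on_continuous smooth_on_dz U(1))
  then show ?thesis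
    by (simp add: ric_def ddbar_def continuous_on_minus)
qed

text \<open>Away from the origin the eigenvalues are compared; at the origin, where the profile is
  not defined, both tensors are continuous.\<close>

lemma einstein_imp_ric:
  assumes "einstein l" "x \<in> U"
  shows "ric x = l *\<^sub>R h x"
proof -
  have off: "ric z = l *\<^sub>R h z" if z: "z \<in> U" "z \<noteq> 0" for z
  proof -
    define t where "t = ln ((norm z)\<^sup>2)"
    define r where "r = (norm z)\<^sup>2"
    have r: "0 < r" using z by (simp add: r_def)
    have t: "t \<in> I" unfolding t_def by (rule ln_norm_in_I[OF z])
    have e: "\<sigma> 1 t = l * y 1 t" "2 \<le> n \<longrightarrow> \<sigma> 0 t = l * y 0 t"
      using assms(1) t by (auto simp: einstein_def)
    have hz: "h z = rmat (of_real (y 0 t / r)) (of_real ((y 1 t - y 0 t) / r\<^sup>2)) z"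
      using h_eq[OF z] by (simp add: t_def r_def)
    have rz: "ric z = rmat (of_real (\<sigma> 0 t / r)) (of_real ((\<sigma> 1 t - \<sigma> 0 t) / r\<^sup>2)) z"
      using ric_eq[OF z] by (simp add: t_def r_def)
    show ?thesis
    proof (cases "2 \<le> n")
      case True
      have "\<sigma> 0 t / r = l * (y 0 t / r)" "(\<sigma> 1 t - \<sigma> 0 t) / r\<^sup>2 = l * ((y 1 t - y 0 t) / r\<^sup>2)"
        using e True by (simp_all add: right_diff_distrib)
      then show ?thesis unfolding hz rz by (simp only: rmat_scale)
    next
      \<comment> \<open>With a single matrix entry, \<open>p\<close> and \<open>q\<close> combine to
        the radial eigenvalue, so the equation for \<open>\<sigma> 1\<close> decides alone.\<close>
      case False
      then have "CARD('n) = 1" using n by (simp add: n_def)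
      then obtain k :: 'n where k: "UNIV = {k}" using card_1_singletonE by blast
      have ij: "i = k" "j = k" for i j :: 'n using k by auto
      have "complex_of_real r = z $ k * cnj (z $ k)"
        unfolding r_def cip_self[symmetric] cip_def k by simp
      then have zz: "cnj (z $ k) * z $ k = complex_of_real r" by (simp add: mult.commute)
      have "rmat (of_real (a / r)) (of_real ((b - a) / r\<^sup>2)) z $ k $ k = of_real (b / r)" for a b
      proof -
        have "rmat (of_real (a / r)) (of_real ((b - a) / r\<^sup>2)) z $ k $ k = of_real (a / r) + of_real ((b - a) / r\<^sup>2) * of_real r"
          by (simp only: rmat_def vec_lambda_beta refl if_True mult.assoc zz)
        also have "\<dots> = of_real (a / r + (b - a) / r\<^sup>2 * r)" by simp
        also have "a / r + (b - a) / r\<^sup>2 * r = b / r" using r by (simp add: field_simps power2_eq_square)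
        finally show ?thesis .
      qed
      note kk = this
      have "ric z $ k $ k = of_real l * h z $ k $ k" unfolding hz rz e(1) kk by simp
      then have "ric z $ i $ j = (l *\<^sub>R h z) $ i $ j" for i j
        by (simp only: scaleR_matrix_nth ij(1)[of i] ij(1)[of j])
      then show ?thesis unfolding vec_eq_iff by blast
    qed
  qed
  show ?thesis
  proof (cases "x = 0")
    case False
    then show ?thesis using off assms(2) by blast
  next
    case True
    have "ric 0 $ i $ j = of_real l * h 0 $ i $ j" for i j
    proof -
      define D where "D = (\<lambda>z. ric z $ i $ j - of_real l * h z $ i $ j)"
      have "continuous_on U D"
        unfolding D_def by (intro continuous_intros continuous_ric smooth_on_continuous smooth)
      then have "isCont D 0"
        using continuous_on_eq_continuous_at[OF U(1)] assms(2) True by blast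
      then have lim: "(D \<longlongrightarrow> D 0) (at 0)" by (simp add: isCont_def)
      have "eventually (\<lambda>z. z \<in> U - {0}) (at 0)"
        using eventually_at_in_open[OF U(1), of 0] assms(2) True by simp
      moreover have "D z = 0" if "z \<in> U - {0}" for z
      proof -
        have z: "z \<in> U" "z \<noteq> 0" using that by auto
        show ?thesis unfolding D_def off[OF z] scaleR_matrix_nth by simp
      qed
      ultimately have "eventually (\<lambda>z. D z = 0) (at 0)"
        by (rule eventually_mono)
      then have "(D \<longlongrightarrow> 0) (at 0)" by (rule tendsto_eventually)
      with lim have "D 0 = 0" using tendsto_unique[of "at 0"] by (metis trivial_limit_at)
      then show ?thesis by (simp add: D_def)
    qed
    then have "ric 0 $ i $ j = (l *\<^sub>R h 0) $ i $ j" for i j by (simp only: scaleR_matrix_nth)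
    then show ?thesis unfolding True vec_eq_iff by blast
  qed
qed

text \<open>All eigenvalues carry the factor \<open>1 / r\<close>, so numerator and denominator both
  scale by \<open>r ^ n\<close>. Multiplying by \<open>y ^ (n - 1) * y1\<close> brings the
  coefficient into the form that \<open>constant_curvature_integral\<close> integrates.\<close>

lemma curvature_coeff:
  assumes x: "x \<in> U" "x \<noteq> 0" and k: "1 \<le> k" "k \<le> n"
  defines "t \<equiv> ln ((norm x)\<^sup>2)"
  shows "coeff (det (\<chi> i j. [: h x $ i $ j, ric x $ i $ j :])) k / det (h x) * of_real (y 0 t ^ (n - 1) * y 1 t) =
    of_real (real ((n - 1) choose k) * y 0 t ^ (n - 1 - k) * \<sigma> 0 t ^ k * y 1 t
      + real ((n - 1) choose (k - 1)) * y 0 t ^ (n - k) * \<sigma> 0 t ^ (k - 1) * \<sigma> 1 t)"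
proof -
  define r where "r = (norm x)\<^sup>2"
  have r: "0 < r" using x by (simp add: r_def)
  have t: "t \<in> I" unfolding t_def by (rule ln_norm_in_I[OF x])
  have hx: "h x = rmat (of_real (y 0 t / r)) (of_real ((y 1 t - y 0 t) / r\<^sup>2)) x"
    using h_eq[OF x] by (simp add: t_def r_def)
  have rx: "ric x = rmat (of_real (\<sigma> 0 t / r)) (of_real ((\<sigma> 1 t - \<sigma> 0 t) / r\<^sup>2)) x"
    using ric_eq[OF x] by (simp add: t_def r_def)
  define D where "D = (y 0 t / r) ^ (n - 1) * (y 1 t / r)"
  have det: "det (h x) = of_real D" unfolding D_def r_def t_def by (rule det_h[OF x])
  have D: "D \<noteq> 0" using det_h_pos[OF x(1)] unfolding det by auto
  have e: "of_real (a / r) + of_real ((b - a) / r\<^sup>2) * of_real r = complex_of_real (b / r)" for a b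
    using r by (simp add: field_simps power2_eq_square flip: of_real_mult of_real_add)
  define c where "c = real ((n - 1) choose k) * (\<sigma> 0 t / r) ^ k * (y 0 t / r) ^ (n - 1 - k) * (y 1 t / r)
      + real ((n - 1) choose (k - 1)) * (\<sigma> 0 t / r) ^ (k - 1) * (y 0 t / r) ^ (n - k) * (\<sigma> 1 t / r)"
  have coeff: "coeff (det (\<chi> i j. [: h x $ i $ j, ric x $ i $ j :])) k = of_real c"
    unfolding hx rx coeff_det_rmat_pencil[OF k[unfolded n_def]] r_def[symmetric] e c_def n_def
    by simp
  have rn: "r ^ n = r ^ (n - 1) * r" using n by (cases n) auto
  have "D * r ^ n = y 0 t ^ (n - 1) * y 1 t"
    unfolding D_def rn using r by (simp add: power_divide)
  moreover have "c * r ^ n = real ((n - 1) choose k) * y 0 t ^ (n - 1 - k) * \<sigma> 0 t ^ k * y 1 t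
      + real ((n - 1) choose (k - 1)) * y 0 t ^ (n - k) * \<sigma> 0 t ^ (k - 1) * \<sigma> 1 t"
  proof -
    \<comment> \<open>For \<open>k = n\<close> the exponent \<open>n - 1 - k\<close> is truncated to
      0 and the powers of \<open>r\<close> would not match, but the binomial coefficient
      vanishes.\<close>
    have "real ((n - 1) choose k) * ((\<sigma> 0 t / r) ^ k * (y 0 t / r) ^ (n - 1 - k) * (y 1 t / r) * r ^ n)
        = real ((n - 1) choose k) * (y 0 t ^ (n - 1 - k) * \<sigma> 0 t ^ k * y 1 t)"
    proof (cases "k \<le> n - 1")
      case True
      then have "r ^ n = r ^ k * r ^ (n - 1 - k) * r" using n by (simp flip: power_add power_Suc2)
      then show ?thesis using r by (simp add: power_divide)
    next
      case False
      then show ?thesis by (simp add: binomial_eq_0)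
    qed
    moreover have "(\<sigma> 0 t / r) ^ (k - 1) * (y 0 t / r) ^ (n - k) * (\<sigma> 1 t / r) * r ^ n = y 0 t ^ (n - k) * \<sigma> 0 t ^ (k - 1) * \<sigma> 1 t"
    proof -
      have "r ^ n = r ^ (k - 1) * r ^ (n - k) * r" using k by (simp flip: power_add power_Suc2)
      then show ?thesis using r by (simp add: power_divide)
    qed
    ultimately show ?thesis unfolding c_def by (simp only: distrib_right mult.assoc)
  qed
  ultimately have "c / D * (y 0 t ^ (n - 1) * y 1 t) = real ((n - 1) choose k) * y 0 t ^ (n - 1 - k) * \<sigma> 0 t ^ k * y 1 t
      + real ((n - 1) choose (k - 1)) * y 0 t ^ (n - k) * \<sigma> 0 t ^ (k - 1) * \<sigma> 1 t"
    using D by (metis (no_types, lifting) nonzero_divide_eq_eq mult.assoc mult.commute)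
  then show ?thesis unfolding coeff det by (simp only: of_real_divide[symmetric] of_real_mult[symmetric])
qed

lemma scalar_curvature_coeff:
  assumes x: "x \<in> U" "x \<noteq> 0"
  shows "coeff (det (\<chi> i j. [: h x $ i $ j, ric x $ i $ j :])) 1 / det (h x) = of_real (sc (ln ((norm x)\<^sup>2)))"
proof -
  define t where "t = ln ((norm x)\<^sup>2)"
  have t: "t \<in> I" unfolding t_def by (rule ln_norm_in_I[OF x])
  define C where "C = coeff (det (\<chi> i j. [: h x $ i $ j, ric x $ i $ j :])) 1 / det (h x)"
  have C: "C * of_real (y 0 t ^ (n - 1) * y 1 t) =
    of_real (real (n - 1) * y 0 t ^ (n - 1 - 1) * \<sigma> 0 t * y 1 t + y 0 t ^ (n - 1) * \<sigma> 1 t)"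
    using curvature_coeff[OF x, of 1] n unfolding C_def t_def by (simp add: choose_one)
  have y1p: "0 < y 1 t" by (rule y1_pos[OF t])
  have "real (n - 1) * y 0 t ^ (n - 1 - 1) * \<sigma> 0 t * y 1 t + y 0 t ^ (n - 1) * \<sigma> 1 t = sc t * (y 0 t ^ (n - 1) * y 1 t)
    \<and> y 0 t ^ (n - 1) * y 1 t \<noteq> 0"
  proof (cases "2 \<le> n")
    case True
    then have "y 0 t ^ (n - 1) = y 0 t * y 0 t ^ (n - 1 - 1)" by (cases "n - 1") auto
    then show ?thesis using y1p y_pos[OF True t] n by (simp add: sc_def of_nat_diff field_simps)
  next
    case False
    then have "n = 1" using n by simp
    then show ?thesis unfolding sc_def using y1p by simp
  qed
  with C have CC: "C * of_real (y 0 t ^ (n - 1) * y 1 t) = of_real (sc t) * of_real (y 0 t ^ (n - 1) * y 1 t)"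
    "complex_of_real (y 0 t ^ (n - 1) * y 1 t) \<noteq> 0"
    by (simp_all only: of_real_mult[symmetric] of_real_eq_0_iff) simp_all
  have "C = of_real (sc t)" using mult_right_cancel[OF CC(2)] CC(1) by blast
  then show ?thesis by (simp add: C_def t_def)
qed

lemma constant_curvature_profile:
  assumes k: "1 \<le> k" "k \<le> n"
    and const: "\<And>x. x \<in> U \<Longrightarrow> Re (coeff (det (\<chi> i j. [: h x $ i $ j, ric x $ i $ j :])) k / det (h x)) = a"
  obtains c d where "\<And>t. t \<in> I \<Longrightarrow> \<sigma> 0 t ^ k * y 0 t ^ (n - k) = c * y 0 t ^ n + d"
proof (rule constant_curvature_integral[OF k])
  fix t assume "t \<in> I"
  then obtain x where x: "x \<in> U" "x \<noteq> 0" "t = ln ((norm x)\<^sup>2)" unfolding I_def by auto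
  have "Re (coeff (det (\<chi> i j. [: h x $ i $ j, ric x $ i $ j :])) k / det (h x) * of_real (y 0 t ^ (n - 1) * y 1 t)) =
     a * (y 0 t ^ (n - 1) * y 1 t)"
    unfolding const[OF x(1), symmetric] by (rule Re_mult_of_real)
  then show "a * y 0 t ^ (n - 1) * y 1 t = real ((n - 1) choose k) * y 0 t ^ (n - 1 - k) * \<sigma> 0 t ^ k * y 1 t
      + real ((n - 1) choose (k - 1)) * y 0 t ^ (n - k) * \<sigma> 0 t ^ (k - 1) * \<sigma> 1 t"
    unfolding x(3) curvature_coeff[OF x(1,2) k] by simp
qed (rule that)

text \<open>The radial component of \<open>X\<close> along the complex curve \<open>w \<mapsto> e\<^sup>w a\<close>, on which \<open>ln r\<close> is \<open>ln |a|\<^sup>2 + 2 Re w\<close>.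
  It is holomorphic in \<open>w\<close>.\<close>
definition line_fun :: "(complex^'n \<Rightarrow> complex^'n) \<Rightarrow> complex^'n \<Rightarrow> complex \<Rightarrow> complex" where
  "line_fun X a w = cip (X (exp w *s a)) a * exp (- w) / of_real ((norm a)\<^sup>2)"

section \<open>Holomorphic fields along complex curves, and extremal metrics\<close>

lemma line_fun_eq:
  assumes "a \<noteq> 0"
  shows "cip v a * exp (- w) / of_real ((norm a)\<^sup>2) = cip v (exp w *s a) / of_real ((norm (exp w *s a))\<^sup>2)"
proof -
  have "complex_of_real ((norm (exp w *s a))\<^sup>2) = exp w * cnj (exp w) * of_real ((norm a)\<^sup>2)"
    unfolding cip_self[symmetric] cip_scale_left cip_scale_right by simp
  then show ?thesis
    unfolding cip_scale_right using assms by (simp add: exp_minus field_simps)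
qed

lemma line_fun_deriv:
  assumes X: "holo_map_on U X" and a: "a \<noteq> 0" and w: "exp w *s a \<in> U"
  defines "x \<equiv> exp w *s a"
  shows "(line_fun X a has_field_derivative
    (cip (frechet_derivative X (at x) x) x - cip (X x) x) / of_real ((norm x)\<^sup>2)) (at w)"
proof -
  have comp: "((\<lambda>w. X (exp w *s a) $ k) has_field_derivative frechet_derivative X (at x) x $ k) (at w)" for k
  proof -
    have "((\<lambda>w. X (exp w *s a) $ k) has_field_derivative
       frechet_derivative (\<lambda>x. X x $ k) (at (exp w *s a)) (exp w *s a)) (at w)"
    proof (rule clin_on_curve[where \<gamma> = "\<lambda>w. exp w *s a", OF holo_map_on_component(1)[OF X] w])
      show "((\<lambda>w. exp w *s a) has_derivative (\<lambda>h. h *s (exp w *s a))) (at w)"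
        by (auto intro!: derivative_eq_intros simp: vector_smult_assoc mult.commute)
    qed
    then show ?thesis unfolding holo_map_on_component(2)[OF X w] x_def .
  qed
  have c: "((\<lambda>w. cip (X (exp w *s a)) a) has_field_derivative cip (frechet_derivative X (at x) x) a) (at w)"
    unfolding cip_def by (intro DERIV_sum DERIV_cmult_right comp)
  have "((\<lambda>w. cip (X (exp w *s a)) a * exp (- w) / of_real ((norm a)\<^sup>2)) has_field_derivative
     (cip (frechet_derivative X (at x) x) a * exp (- w) / of_real ((norm a)\<^sup>2) - cip (X x) a * exp (- w) / of_real ((norm a)\<^sup>2))) (at w)"
    using a by (auto intro!: derivative_eq_intros c simp: x_def field_simps)
  then show ?thesis
    unfolding line_fun_def[abs_def] line_fun_eq[OF a] x_def diff_divide_distrib .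
qed

lemma line_fun_holomorphic:
  assumes X: "holo_map_on U X" and a: "a \<noteq> 0"
  shows "line_fun X a holomorphic_on {w. exp w *s a \<in> U}"
  by (rule holomorphic_onI, rule field_differentiable_at_within)
     (use line_fun_deriv[OF X a] in \<open>auto simp: field_differentiable_def\<close>)

lemma exp_line:
  assumes "a \<noteq> (0::complex^'n)"
  shows "exp w *s a \<noteq> 0" using assms by (simp add: vector_mul_eq_0)

lemma sc_differentiable:
  assumes t: "t \<in> I" obtains D where "(sc has_real_derivative D) (at t)"
proof (cases "2 \<le> n")
  case True
  have "y 0 t \<noteq> 0" "y 1 t \<noteq> 0" using y_pos[OF True t] y1_pos[OF t] by auto
  then have "((\<lambda>t. (real n - 1) * \<sigma> 0 t / y 0 t + \<sigma> 1 t / y 1 t) has_real_derivative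
      ((real n - 1) * \<sigma> 1 t * y 0 t - (real n - 1) * \<sigma> 0 t * y 1 t) / (y 0 t * y 0 t)
      + (\<sigma> 2 t * y 1 t - \<sigma> 1 t * y 2 t) / (y 1 t * y 1 t)) (at t)"
    by (intro DERIV_add DERIV_divide DERIV_cmult \<sigma>[OF t] \<sigma>1[OF t] y[OF t] y1[OF t])
  then show ?thesis using that by (simp add: sc_def[abs_def])
next
  case False
  then have "n = 1" using n by simp
  have "y 1 t \<noteq> 0" using y1_pos[OF t] by auto
  then have "((\<lambda>t. \<sigma> 1 t / y 1 t) has_real_derivative (\<sigma> 2 t * y 1 t - \<sigma> 1 t * y 2 t) / (y 1 t * y 1 t)) (at t)"
    by (intro DERIV_divide \<sigma>1[OF t] y1[OF t])
  then have "(sc has_real_derivative (\<sigma> 2 t * y 1 t - \<sigma> 1 t * y 2 t) / (y 1 t * y 1 t)) (at t)"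
    unfolding sc_def[abs_def] by (simp add: \<open>n = 1\<close>)
  then show ?thesis by (rule that)
qed

text \<open>The Hamiltonian equation makes the holomorphic function \<open>line_fun X a\<close>
  purely imaginary, so by the Cauchy-Riemann equations it is locally constant. Its value is a
  multiple of \<open>sc' / y1\<close>, hence \<open>sc\<close> is affine in
  \<open>y\<close>.\<close>

lemma extremal_profile:
  assumes X: "holo_map_on U X"
    and ham: "\<And>x v. x \<in> U \<Longrightarrow> form11 (h x) (X x) v = of_real (frechet_derivative u (at x) v)"
    and u: "\<And>x. x \<in> U \<Longrightarrow> x \<noteq> 0 \<Longrightarrow> u x = sc (ln ((norm x)\<^sup>2))"
  obtains \<alpha> \<beta> where "\<And>t. t \<in> I \<Longrightarrow> sc t = \<alpha> * y 0 t + \<beta>"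
proof -
  have "\<exists>sc'. \<forall>t\<in>I. (sc has_real_derivative sc' t) (at t)"
    using sc_differentiable by (intro bchoice) blast
  then obtain sc' where sc': "\<And>t. t \<in> I \<Longrightarrow> (sc has_real_derivative sc' t) (at t)" by blast
  \<comment> \<open>The equation is tested on \<open>x\<close> and on \<open>\<i> *s x\<close>: a
    radial function does not change in the second direction, which removes the real part.\<close>
  have \<Phi>: "cip (X x) x / of_real ((norm x)\<^sup>2) = - 2 * \<i> * of_real (sc' (ln ((norm x)\<^sup>2)) / y 1 (ln ((norm x)\<^sup>2)))"
    if x: "x \<in> U" "x \<noteq> 0" for x
  proof -
    define r where "r = (norm x)\<^sup>2"
    have r: "0 < r" using x by (simp add: r_def)
    define t where "t = ln r"
    have t: "t \<in> I" unfolding t_def r_def by (rule ln_norm_in_I[OF x])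
    have hx: "h x = rmat (of_real (y 0 t / r)) (of_real ((y 1 t - y 0 t) / r\<^sup>2)) x"
      using h_eq[OF x] by (simp add: t_def r_def)
    have D: "frechet_derivative u (at x) v = sc' t * (2 * Re (cip v x) / r)" for v
    proof -
      have "((\<lambda>y. sc (ln ((norm y)\<^sup>2))) has_derivative (\<lambda>v. sc' t * (2 * Re (cip v x) / r))) (at x)"
        unfolding r_def by (rule has_derivative_radial[OF _ x(2)]) (use sc'[OF t] in \<open>simp add: t_def r_def\<close>)
      then have "(u has_derivative (\<lambda>v. sc' t * (2 * Re (cip v x) / r))) (at x)"
        by (rule has_derivative_transform_within_open[OF _ nz_open(1)]) (use x u in auto)
      from frechet_derivative_at[OF this] show ?thesis by (metis (no_types))
    qed
    have s1: "sesq (h x) v x = of_real (y 1 t / r) * cip v x" for v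
      unfolding hx sesq_rmat cip_self r_def[symmetric] using r
      by (simp add: field_simps power2_eq_square)
    have "sesq (h x) (X x) x = - \<i> * (form11 (h x) (X x) x + \<i> * form11 (h x) (X x) (\<i> *s x))"
      by (rule sesq_form11)
    also have "\<dots> = - \<i> * of_real (2 * sc' t)"
      unfolding ham[OF x(1)] D cip_scale_left cip_self r_def[symmetric] using r by simp
    finally have "of_real (y 1 t / r) * cip (X x) x = - \<i> * of_real (2 * sc' t)" unfolding s1 .
    then have "of_real (y 1 t) * (cip (X x) x / of_real r) = - \<i> * of_real (2 * sc' t)" by simp
    then show ?thesis
      using y1_pos[OF t] unfolding r_def[symmetric] t_def[symmetric] by (simp add: field_simps)
  qed
  define g where "g = (\<lambda>t. sc' t / y 1 t)"
  have "(g has_real_derivative 0) (at t)" if "t \<in> I" for t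
  proof -
    from that obtain a where a: "a \<in> U" "a \<noteq> 0" "t = ln ((norm a)\<^sup>2)" unfolding I_def by auto
    have L: "line_fun X a w = - 2 * \<i> * of_real (g (t + 2 * Re w))" if "exp w *s a \<in> U" for w
      unfolding line_fun_def line_fun_eq[OF a(2)] \<Phi>[OF that exp_line[OF a(2)]] ln_norm_exp[OF a(2)] a(3) g_def ..
    have o: "open {w. exp w *s a \<in> U}" by (rule open_exp_preimage[OF U(1)])
    have "0 \<in> {w. exp w *s a \<in> U}" using a by simp
    then obtain \<delta> where \<delta>: "\<delta> > 0" "ball 0 \<delta> \<subseteq> {w. exp w *s a \<in> U}"
      using o open_contains_ball by blast
    define d where "d = deriv (line_fun X a) 0"
    have d: "(line_fun X a has_field_derivative d) (at 0)"
      unfolding d_def using \<open>0 \<in> _\<close> by (intro holomorphic_derivI[OF line_fun_holomorphic[OF X a(2)] o])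
    \<comment> \<open>This is the derivative of the vanishing real part in the imaginary direction;
      by holomorphy it equals the derivative of \<open>Re (\<i> * line_fun X a)\<close> in the real
      direction.\<close>
    have "Re (\<i> * d) = 0"
    proof (rule DERIV_eq_on_open[where J = "{-\<delta><..<\<delta>}" and t = 0])
      have "((\<lambda>w. line_fun X a (w * \<i>)) has_field_derivative d * \<i>) (at 0)"
        by (rule DERIV_chain2[where f = "line_fun X a"]) (use d in \<open>auto intro!: derivative_eq_intros\<close>)
      then show "((\<lambda>s. Re (line_fun X a (of_real s * \<i>))) has_real_derivative Re (\<i> * d)) (at 0)"
        using has_real_derivative_Re[where f = "\<lambda>w. line_fun X a (w * \<i>)" and x = 0 and f' = "d * \<i>"] by (simp add: mult.commute[of d])
      show "Re (line_fun X a (of_real s * \<i>)) = 0" if "s \<in> {-\<delta><..<\<delta>}" for s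
      proof -
        have "of_real s * \<i> \<in> ball 0 \<delta>" using that by (simp add: norm_mult abs_less_iff)
        then have "exp (of_real s * \<i>) *s a \<in> U" using \<delta>(2) by blast
        from L[OF this] show ?thesis by simp
      qed
    qed (use \<delta>(1) in auto)
    moreover have "((\<lambda>x. Re (\<i> * line_fun X a (of_real x))) has_real_derivative Re (\<i> * d)) (at 0)"
      by (rule has_real_derivative_Re[where f = "\<lambda>w. \<i> * line_fun X a w"])
         (use d in \<open>auto intro!: derivative_eq_intros\<close>)
    ultimately have D0: "((\<lambda>x. Re (\<i> * line_fun X a (of_real x))) has_real_derivative 0) (at ((t - t) / 2))"
      by simp
    have "((\<lambda>s. Re (\<i> * line_fun X a (of_real ((s - t) / 2)))) has_real_derivative 0 * (1/2)) (at t)"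
      by (rule DERIV_chain2[where g = "\<lambda>s. (s - t) / 2", OF D0]) (auto intro!: derivative_eq_intros)
    from DERIV_cdivide[OF this, of 2]
    have "((\<lambda>s. Re (\<i> * line_fun X a (of_real ((s - t) / 2))) / 2) has_real_derivative 0) (at t)"
      by (rule DERIV_cong) simp
    then show ?thesis
    proof (rule has_field_derivative_transform_within_open)
      show "open (ball t (2 * \<delta>))" "t \<in> ball t (2 * \<delta>)" using \<delta>(1) by auto
      fix s assume s: "s \<in> ball t (2 * \<delta>)"
      have "complex_of_real ((s - t) / 2) \<in> ball 0 \<delta>"
        using s by (simp only: mem_ball dist_norm norm_of_real diff_0 norm_minus_cancel) (simp add: abs_minus_commute)
      then have "exp (complex_of_real ((s - t) / 2)) *s a \<in> U" using \<delta>(2) by blast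
      from L[OF this] have "line_fun X a (of_real ((s - t) / 2)) = - 2 * \<i> * of_real (g (t + 2 * ((s - t) / 2)))" by (simp only: Re_complex_of_real)
      also have "t + 2 * ((s - t) / 2) = s" by (simp add: field_simps)
      finally show "Re (\<i> * line_fun X a (of_real ((s - t) / 2))) / 2 = g s" by simp
    qed
  qed
  then obtain \<alpha> where \<alpha>: "\<And>t. t \<in> I \<Longrightarrow> g t = \<alpha>"
    using DERIV_zero_constant_on[OF I_open_connected(2,1)] by blast
  have "((\<lambda>t. sc t - \<alpha> * y 0 t) has_real_derivative 0) (at t)" if t: "t \<in> I" for t
  proof -
    have "sc' t = \<alpha> * y 1 t" using \<alpha>[OF t] y1_pos[OF t] by (simp add: g_def field_simps)
    then show ?thesis by (auto intro!: derivative_eq_intros sc' y t)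
  qed
  then obtain \<beta> where "\<And>t. t \<in> I \<Longrightarrow> sc t - \<alpha> * y 0 t = \<beta>"
    using DERIV_zero_constant_on[OF I_open_connected(2,1)] by blast
  then have "\<And>t. t \<in> I \<Longrightarrow> sc t = \<alpha> * y 0 t + \<beta>" by (simp add: diff_eq_eq add.commute)
  then show ?thesis by (rule that)
qed

end

section \<open>The soliton equation for a radial metric\<close>

lemma has_derivative_cip:
  fixes v x :: "complex^'n"
  shows "((\<lambda>y. cip v y) has_derivative (\<lambda>u. cip v u)) (at x)"
  "((\<lambda>y. cip y v) has_derivative (\<lambda>u. cip u v)) (at x)"
proof -
  have k: "((\<lambda>y::complex^'n. y $ k) has_derivative (\<lambda>u. u $ k)) (at x)" for k
    by (rule bounded_linear.has_derivative[OF bounded_linear_vec_nth has_derivative_ident])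
  show "((\<lambda>y. cip v y) has_derivative (\<lambda>u. cip v u)) (at x)"
    unfolding cip_def
    by (intro has_derivative_sum has_derivative_mult_right bounded_linear.has_derivative[OF bounded_linear_cnj] k)
  show "((\<lambda>y. cip y v) has_derivative (\<lambda>u. cip u v)) (at x)"
    unfolding cip_def by (intro has_derivative_sum has_derivative_mult_left k)
qed

lemma norm_axis_sq: "(norm (axis a 1 :: complex^'n))\<^sup>2 = 1"
  using cip_self[of "axis a 1 :: complex^'n"] unfolding cip_axis by (simp flip: of_real_power)

text \<open>The bookkeeping of a trace: the soliton equation tested on each basis vector
  \<open>axis a 1\<close> is summed over \<open>a\<close>.\<close>

lemma sum_affine_eq:
  fixes b c d e :: "'n::finite \<Rightarrow> real"
  assumes "\<And>a. A + B * b a = l * (C + E * b a) + (F + G * b a + E * (2 * c a)) + 2 * (C * d a + E * e a)"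
  shows "real CARD('n) * A + B * sum b UNIV = l * (real CARD('n) * C + E * sum b UNIV)
    + (real CARD('n) * F + G * sum b UNIV + E * (2 * sum c UNIV)) + 2 * (C * sum d UNIV + E * sum e UNIV)"
proof -
  have "(\<Sum>a\<in>UNIV. A + B * b a) = (\<Sum>a\<in>UNIV. l * (C + E * b a) + (F + G * b a + E * (2 * c a)) + 2 * (C * d a + E * e a))"
    by (simp only: assms)
  then show ?thesis
    by (simp add: sum.distrib flip: sum_distrib_left)
qed

lemma clear_denominators:
  fixes r :: real
  assumes r: "0 < r" and eq: "m * (s / r) + S / r\<^sup>2 * r = l * (m * (u / r) + A / r\<^sup>2 * r)
    + (m * (A / r * N) + B / r\<^sup>2 * N * r + A / r\<^sup>2 * (2 * (r * N / 2))) + 2 * (u / r * D + A / r\<^sup>2 * (r * E / 2))"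
  shows "m * s + S = l * (m * u + A) + (m * A * N + B * N + A * N) + 2 * u * D + A * E"
proof -
  have "m * s + S = (m * (s / r) + S / r\<^sup>2 * r) * r"
    using r by (simp add: field_simps power2_eq_square)
  also have "\<dots> = l * (m * u + A) + (m * A * N + B * N + A * N) + 2 * u * D + A * E"
    unfolding eq using r by (simp add: field_simps power2_eq_square)
  finally show ?thesis .
qed

context radial_geometry
begin

declare One_nat_def [simp del]

text \<open>The derivative of \<open>ln |x|\<^sup>2\<close> in the direction \<open>X\<close>.\<close>
definition radial_rate :: "(complex^'n \<Rightarrow> complex^'n) \<Rightarrow> complex^'n \<Rightarrow> real" where
  "radial_rate X x = 2 * Re (cip (X x) x) / (norm x)\<^sup>2"

text \<open>It is holomorphic when \<open>X\<close> is, so an equation for its real part carries the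
  information of harmonicity.\<close>

definition divergence :: "(complex^'n \<Rightarrow> complex^'n) \<Rightarrow> complex^'n \<Rightarrow> complex" where
  "divergence X x = (\<Sum>a\<in>UNIV. frechet_derivative X (at x) (axis a 1) $ a)"

lemma cnj_sesq_h: "x \<in> U \<Longrightarrow> cnj (sesq (h x) v w) = sesq (h x) w v"
proof -
  assume x: "x \<in> U"
  have "cnj (sesq (h x) v w) = (\<Sum>i\<in>UNIV. \<Sum>j\<in>UNIV. h x $ j $ i * cnj (v $ i) * w $ j)"
    by (simp add: sesq_def herm[OF x, symmetric])
  also have "\<dots> = (\<Sum>j\<in>UNIV. \<Sum>i\<in>UNIV. h x $ j $ i * cnj (v $ i) * w $ j)"
    by (rule sum.swap)
  finally show ?thesis by (simp add: sesq_def mult_ac)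
qed

lemma smooth_sesq_h: "smooth_on U (\<lambda>x. sesq (h x) v w)"
  unfolding sesq_def by (intro smooth_on_sum smooth_on_mult smooth_on_const smooth U(1))

text \<open>The polarisation of \<open>sesq_form11\<close> commutes with the Lie derivative because
  the differential of a holomorphic field is complex linear.\<close>

lemma soliton_sesq:
  assumes X: "holo_map_on U X" and x: "x \<in> U"
    and sol: "\<And>v w. form11 (ric x) v w = of_real l * form11 (h x) v w + lie_form X (\<lambda>x. form11 (h x)) x v w"
  defines "DX \<equiv> frechet_derivative X (at x)"
  shows "sesq (ric x) v w = of_real l * sesq (h x) v w + frechet_derivative (\<lambda>y. sesq (h y) v w) (at x) (X x)
    + sesq (h x) (DX v) w + sesq (h x) v (DX w)"
proof -
  have DXi: "DX (\<i> *s w) = \<i> *s DX w"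
  proof -
    interpret D: Vector_Spaces.linear "(*s)" "(*s)" DX
      unfolding DX_def by (rule holo_map_onD(2)[OF X x])
    show ?thesis by (rule D.scale)
  qed
  have F: "((\<lambda>y. form11 (h y) v w) has_derivative frechet_derivative (\<lambda>y. form11 (h y) v w) (at x)) (at x)" for v w
  proof (rule smooth_on_has_derivative[OF _ x])
    have "smooth_on U (\<lambda>y. \<i> / 2 * (sesq (h y) v w + (-1) * sesq (h y) w v))"
      by (intro smooth_on_mult smooth_on_add smooth_on_const smooth_sesq_h U(1))
    then show "smooth_on U (\<lambda>y. form11 (h y) v w)"
      by (simp add: form11_sesq)
  qed
  have "((\<lambda>y. sesq (h y) v w) has_derivative (\<lambda>u. - \<i> * (frechet_derivative (\<lambda>y. form11 (h y) v w) (at x) u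
      + \<i> * frechet_derivative (\<lambda>y. form11 (h y) v (\<i> *s w)) (at x) u))) (at x)"
    unfolding sesq_form11[of _ v w] by (intro has_derivative_mult_right has_derivative_add F)
  then have D: "frechet_derivative (\<lambda>y. sesq (h y) v w) (at x) u = - \<i> * (frechet_derivative (\<lambda>y. form11 (h y) v w) (at x) u
      + \<i> * frechet_derivative (\<lambda>y. form11 (h y) v (\<i> *s w)) (at x) u)" for u
    by (rule fun_cong[OF frechet_derivative_at[symmetric]])
  show ?thesis
    unfolding D unfolding sesq_form11[of _ v w] sesq_form11[of _ "DX v" w] sesq_form11[of _ v "DX w"] sol lie_form_def
      DX_def[symmetric] DXi
    by (simp add: algebra_simps)
qed

lemma h_deriv:
  fixes X :: "complex^'n \<Rightarrow> complex^'n"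
  assumes x: "x \<in> U" "x \<noteq> 0"
  defines "r \<equiv> (norm x)\<^sup>2" and "t \<equiv> ln ((norm x)\<^sup>2)" and "N \<equiv> radial_rate X x"
  shows "Re (frechet_derivative (\<lambda>y. sesq (h y) v v) (at x) (X x)) =
    (y 1 t - y 0 t) / r * N * (norm v)\<^sup>2 + (y 2 t - 3 * y 1 t + 2 * y 0 t) / r\<^sup>2 * N * Re (cip v x * cip x v)
    + (y 1 t - y 0 t) / r\<^sup>2 * (2 * Re (cip v x * cip (X x) v))"
proof -
  have r: "0 < r" using x by (simp add: r_def)
  have t: "t \<in> I" unfolding t_def by (rule ln_norm_in_I[OF x])
  \<comment> \<open>The two coefficients of \<open>h\<close>, as functions of \<open>t\<close>. The
    numbers 3 and 2 in the statement come from differentiating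
    \<open>(y 1 - y 0) * exp (- 2 * t)\<close>.\<close>
  define f1 f2 where "f1 = (\<lambda>t. y 0 t * exp (- t))" and "f2 = (\<lambda>t. (y 1 t - y 0 t) * exp (- 2 * t))"
  have et: "exp (- t) = inverse r" "exp (- 2 * t) = inverse (r\<^sup>2)"
  proof -
    show e: "exp (- t) = inverse r" using r by (simp add: t_def r_def exp_minus)
    have "exp (- 2 * t) = exp (- t) * exp (- t)" by (simp flip: exp_add)
    then show "exp (- 2 * t) = inverse (r\<^sup>2)" by (simp add: e power2_eq_square)
  qed
  have "(f1 has_real_derivative (y 1 t - y 0 t) * exp (- t)) (at t)"
    unfolding f1_def by (rule derivative_eq_intros y[OF t] refl | simp add: algebra_simps)+
  then have D1: "((\<lambda>z. complex_of_real (f1 (ln ((norm z)\<^sup>2)))) has_derivative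
      (\<lambda>u. complex_of_real ((y 1 t - y 0 t) * exp (- t) * (2 * Re (cip u x) / r)))) (at x)"
    unfolding r_def t_def
    by (intro bounded_linear.has_derivative[OF bounded_linear_of_real] has_derivative_radial x(2))
  have "(f2 has_real_derivative (y 2 t - 3 * y 1 t + 2 * y 0 t) * exp (- 2 * t)) (at t)"
    unfolding f2_def by (rule derivative_eq_intros y[OF t] y1[OF t] refl | simp add: algebra_simps)+
  then have D2: "((\<lambda>z. complex_of_real (f2 (ln ((norm z)\<^sup>2)))) has_derivative
      (\<lambda>u. complex_of_real ((y 2 t - 3 * y 1 t + 2 * y 0 t) * exp (- 2 * t) * (2 * Re (cip u x) / r)))) (at x)"
    unfolding r_def t_def
    by (intro bounded_linear.has_derivative[OF bounded_linear_of_real] has_derivative_radial x(2))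
  have "((\<lambda>z. complex_of_real (f1 (ln ((norm z)\<^sup>2))) * cip v v + complex_of_real (f2 (ln ((norm z)\<^sup>2))) * (cip v z * cip z v)) has_derivative
     (\<lambda>u. complex_of_real ((y 1 t - y 0 t) * exp (- t) * (2 * Re (cip u x) / r)) * cip v v
       + (complex_of_real (f2 (ln ((norm x)\<^sup>2))) * (cip v x * cip u v + cip v u * cip x v)
        + complex_of_real ((y 2 t - 3 * y 1 t + 2 * y 0 t) * exp (- 2 * t) * (2 * Re (cip u x) / r)) * (cip v x * cip x v)))) (at x)"
    by (intro has_derivative_add has_derivative_mult_left D1 has_derivative_mult D2 has_derivative_cip)
  then have "((\<lambda>z. sesq (h z) v v) has_derivative
     (\<lambda>u. complex_of_real ((y 1 t - y 0 t) * exp (- t) * (2 * Re (cip u x) / r)) * cip v v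
       + (complex_of_real (f2 (ln ((norm x)\<^sup>2))) * (cip v x * cip u v + cip v u * cip x v)
        + complex_of_real ((y 2 t - 3 * y 1 t + 2 * y 0 t) * exp (- 2 * t) * (2 * Re (cip u x) / r)) * (cip v x * cip x v)))) (at x)"
  proof (rule has_derivative_transform_within_open[OF _ nz_open(1)])
    show "x \<in> U - {0}" using x by simp
    fix z assume "z \<in> U - {0}"
    then have z: "z \<in> U" "z \<noteq> 0" by auto
    have e: "exp (- ln ((norm z)\<^sup>2)) = inverse ((norm z)\<^sup>2)" using z by (simp add: exp_minus)
    have "exp (- 2 * ln ((norm z)\<^sup>2)) = exp (- ln ((norm z)\<^sup>2)) * exp (- ln ((norm z)\<^sup>2))" by (simp flip: exp_add)
    then have e2: "exp (- 2 * ln ((norm z)\<^sup>2)) = inverse (((norm z)\<^sup>2)\<^sup>2)" unfolding e by (simp add: power2_eq_square)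
    show "complex_of_real (f1 (ln ((norm z)\<^sup>2))) * cip v v + complex_of_real (f2 (ln ((norm z)\<^sup>2))) * (cip v z * cip z v) = sesq (h z) v v"
      unfolding h_eq[OF z] sesq_rmat f1_def f2_def e e2 divide_inverse mult.assoc ..
  qed
  then have "frechet_derivative (\<lambda>z. sesq (h z) v v) (at x) u =
     complex_of_real ((y 1 t - y 0 t) * exp (- t) * (2 * Re (cip u x) / r)) * cip v v
       + (complex_of_real (f2 (ln ((norm x)\<^sup>2))) * (cip v x * cip u v + cip v u * cip x v)
        + complex_of_real ((y 2 t - 3 * y 1 t + 2 * y 0 t) * exp (- 2 * t) * (2 * Re (cip u x) / r)) * (cip v x * cip x v))" for u
    by (rule fun_cong[OF frechet_derivative_at[symmetric]])
  note D = this[of "X x"]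
  have N: "2 * Re (cip (X x) x) / r = N" by (simp add: N_def radial_rate_def r_def)
  have f2: "f2 (ln ((norm x)\<^sup>2)) = (y 1 t - y 0 t) / r\<^sup>2"
    unfolding t_def[symmetric] f2_def et divide_inverse ..
  have c: "Re (cip v x * cip (X x) v + cip v (X x) * cip x v) = 2 * Re (cip v x * cip (X x) v)"
  proof -
    have "cip v (X x) * cip x v = cnj (cip v x * cip (X x) v)" by (simp add: cnj_cip mult.commute)
    then show ?thesis by simp
  qed
  have Rr: "Re (of_real a * z) = a * Re z" for a z by simp
  show ?thesis
    unfolding D plus_complex.sel Rr N f2 et cip_self
    unfolding plus_complex.sel(1)[symmetric] c by (simp add: divide_inverse)
qed

lemma soliton_real_eq:
  assumes X: "holo_map_on U X" and x: "x \<in> U" "x \<noteq> 0"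
    and sol: "\<And>v w. form11 (ric x) v w = of_real l * form11 (h x) v w + lie_form X (\<lambda>x. form11 (h x)) x v w"
  defines "r \<equiv> (norm x)\<^sup>2" and "t \<equiv> ln ((norm x)\<^sup>2)" and "N \<equiv> radial_rate X x" and "DX \<equiv> frechet_derivative X (at x)"
  shows "\<sigma> 0 t / r * (norm v)\<^sup>2 + (\<sigma> 1 t - \<sigma> 0 t) / r\<^sup>2 * Re (cip v x * cip x v) =
    l * (y 0 t / r * (norm v)\<^sup>2 + (y 1 t - y 0 t) / r\<^sup>2 * Re (cip v x * cip x v))
    + ((y 1 t - y 0 t) / r * N * (norm v)\<^sup>2 + (y 2 t - 3 * y 1 t + 2 * y 0 t) / r\<^sup>2 * N * Re (cip v x * cip x v)
      + (y 1 t - y 0 t) / r\<^sup>2 * (2 * Re (cip v x * cip (X x) v)))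
    + 2 * (y 0 t / r * Re (cip (DX v) v) + (y 1 t - y 0 t) / r\<^sup>2 * Re (cip (DX v) x * cip x v))"
proof -
  have Rr: "Re (of_real a * z) = a * Re z" for a z by simp
  have hx: "Re (sesq (h x) v w) = y 0 t / r * Re (cip v w) + (y 1 t - y 0 t) / r\<^sup>2 * Re (cip v x * cip x w)" for v w
    unfolding h_eq[OF x] sesq_rmat r_def t_def plus_complex.sel mult.assoc Rr ..
  have rx: "Re (sesq (ric x) v w) = \<sigma> 0 t / r * Re (cip v w) + (\<sigma> 1 t - \<sigma> 0 t) / r\<^sup>2 * Re (cip v x * cip x w)" for v w
    unfolding ric_eq[OF x] sesq_rmat r_def t_def plus_complex.sel mult.assoc Rr ..
  have "Re (sesq (h x) v (DX v)) = Re (sesq (h x) (DX v) v)"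
    using arg_cong[OF cnj_sesq_h[OF x(1), of v "DX v"], of Re] by simp
  then have "Re (sesq (ric x) v v) = l * Re (sesq (h x) v v)
     + Re (frechet_derivative (\<lambda>y. sesq (h y) v v) (at x) (X x)) + 2 * Re (sesq (h x) (DX v) v)"
    using arg_cong[OF soliton_sesq[OF X x(1) sol, of v v], of Re] by (simp add: DX_def)
  then show ?thesis
    unfolding rx hx h_deriv[OF x, folded t_def r_def] N_def cip_self Re_complex_of_real .
qed

text \<open>The first equation is the soliton equation tested on \<open>x\<close>. For the second
  the Euclidean trace is taken, and the radial derivative \<open>EE\<close> and then
  \<open>y 2\<close> are eliminated. Invariantly it is the trace with respect to the metric:
  \<open>X\<close> changes the volume density \<open>det h\<close>, whose logarithm has
  \<open>t\<close>-derivative \<open>- \<sigma>\<close>.\<close>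

lemma soliton_equations:
  assumes X: "holo_map_on U X" and x: "x \<in> U" "x \<noteq> 0"
    and sol: "\<And>v w. form11 (ric x) v w = of_real l * form11 (h x) v w + lie_form X (\<lambda>x. form11 (h x)) x v w"
  defines "t \<equiv> ln ((norm x)\<^sup>2)" and "N \<equiv> radial_rate X x"
    and "N' \<equiv> 2 * Re ((cip (frechet_derivative X (at x) x) x - cip (X x) x) / of_real ((norm x)\<^sup>2))"
  shows "\<sigma> 1 t = l * y 1 t + N * y 2 t + y 1 t * N'"
    and "2 * Re (divergence X x) = \<sigma> 0 t * N + sc t - real n * l"
proof -
  define r where "r = (norm x)\<^sup>2"
  have r: "0 < r" using x by (simp add: r_def)
  have t: "t \<in> I" unfolding t_def by (rule ln_norm_in_I[OF x])
  have y1p: "0 < y 1 t" by (rule y1_pos[OF t])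
  define DX where "DX = frechet_derivative X (at x)"
  define EE where "EE = 2 * Re (cip (DX x) x) / r"
  note eq = soliton_real_eq[OF X x sol, folded r_def t_def N_def DX_def]
  have cX: "Re (cip (X x) x) = r * N / 2" using r by (simp add: N_def radial_rate_def r_def)
  have cE: "Re (cip (DX x) x) = r * EE / 2" using r by (simp add: EE_def)
  have N': "N' = EE - N"
    unfolding N'_def EE_def N_def radial_rate_def DX_def r_def
    by (simp add: diff_divide_distrib Re_divide_of_real del: of_real_power)
  have rad: "\<sigma> 1 t = l * y 1 t + N * (y 2 t - y 1 t) + y 1 t * EE"
  proof -
    have c: "Re (of_real r * z) = r * Re z" "Re (z * of_real r) = Re z * r" for z by simp_all
    have nx: "(norm x)\<^sup>2 = r" "cip x x = of_real r" by (simp_all add: r_def cip_self)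
    have "\<sigma> 0 t / r * r + (\<sigma> 1 t - \<sigma> 0 t) / r\<^sup>2 * (r * r) =
      l * (y 0 t / r * r + (y 1 t - y 0 t) / r\<^sup>2 * (r * r))
      + ((y 1 t - y 0 t) / r * N * r + (y 2 t - 3 * y 1 t + 2 * y 0 t) / r\<^sup>2 * N * (r * r)
        + (y 1 t - y 0 t) / r\<^sup>2 * (2 * (r * (r * N / 2))))
      + 2 * (y 0 t / r * (r * EE / 2) + (y 1 t - y 0 t) / r\<^sup>2 * (r * EE / 2 * r))"
      using eq[of x] unfolding nx c cX cE Re_complex_of_real .
    moreover have "z / r * r = z" "z / r\<^sup>2 * (r * r) = z" "z / r\<^sup>2 * (2 * (r * (r * N / 2))) = z * N"
       "z / r * (r * EE / 2) = z * EE / 2" "z / r\<^sup>2 * (r * EE / 2 * r) = z * EE / 2" "z / r * N * r = z * N" "z / r\<^sup>2 * N * (r * r) = z * N" for z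
      using r by (simp_all add: power2_eq_square)
    ultimately show ?thesis by (simp only:) (simp add: field_simps)
  qed
  show "\<sigma> 1 t = l * y 1 t + N * y 2 t + y 1 t * N'"
    using rad by (simp add: N' algebra_simps)
  interpret D: Vector_Spaces.linear "(*s)" "(*s)" DX
    unfolding DX_def by (rule holo_map_onD(2)[OF X x(1)])
  have div: "(\<Sum>a\<in>UNIV. Re (DX (axis a 1) $ a)) = Re (divergence X x)"
    by (simp add: divergence_def DX_def)
  have s1: "(\<Sum>a\<in>UNIV. Re (cnj (x $ a) * x $ a)) = r"
    using arg_cong[OF cip_self[of x], of Re] by (simp add: cip_def r_def mult.commute)
  have s2: "(\<Sum>a\<in>UNIV. Re (cnj (x $ a) * X x $ a)) = r * N / 2"
    unfolding cX[symmetric] by (simp add: cip_def mult.commute)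
  have s4: "(\<Sum>a\<in>UNIV. Re (cip (DX (axis a 1)) x * x $ a)) = r * EE / 2"
  proof -
    have "DX x = (\<Sum>a\<in>UNIV. x $ a *s DX (axis a 1))"
      by (subst basis_expansion[of x, symmetric]) (simp only: D.sum D.scale)
    moreover have "cip (\<Sum>a\<in>A. f a) x = (\<Sum>a\<in>A. cip (f a) x)" for A :: "'n set" and f
      by (simp add: cip_def sum_distrib_right) (rule sum.swap)
    ultimately have "cip (DX x) x = (\<Sum>a\<in>UNIV. x $ a * cip (DX (axis a 1)) x)"
      by (simp add: cip_scale_left)
    then show ?thesis unfolding cE[symmetric] by (simp add: mult.commute)
  qed
  have trace: "(real n - 1) * \<sigma> 0 t + \<sigma> 1 t = l * ((real n - 1) * y 0 t + y 1 t)
     + N * ((real n + 1) * (y 1 t - y 0 t) + y 2 t - 3 * y 1 t + 2 * y 0 t)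
     + 2 * y 0 t * Re (divergence X x) + (y 1 t - y 0 t) * EE"
  proof -
    have "real CARD('n) * (\<sigma> 0 t / r) + (\<sigma> 1 t - \<sigma> 0 t) / r\<^sup>2 * r =
      l * (real CARD('n) * (y 0 t / r) + (y 1 t - y 0 t) / r\<^sup>2 * r)
      + (real CARD('n) * ((y 1 t - y 0 t) / r * N) + (y 2 t - 3 * y 1 t + 2 * y 0 t) / r\<^sup>2 * N * r
        + (y 1 t - y 0 t) / r\<^sup>2 * (2 * (r * N / 2)))
      + 2 * (y 0 t / r * Re (divergence X x) + (y 1 t - y 0 t) / r\<^sup>2 * (r * EE / 2))"
    proof -
      have "\<sigma> 0 t / r + (\<sigma> 1 t - \<sigma> 0 t) / r\<^sup>2 * Re (cnj (x $ a) * x $ a) =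
        l * (y 0 t / r + (y 1 t - y 0 t) / r\<^sup>2 * Re (cnj (x $ a) * x $ a))
        + ((y 1 t - y 0 t) / r * N + (y 2 t - 3 * y 1 t + 2 * y 0 t) / r\<^sup>2 * N * Re (cnj (x $ a) * x $ a)
          + (y 1 t - y 0 t) / r\<^sup>2 * (2 * Re (cnj (x $ a) * X x $ a)))
        + 2 * (y 0 t / r * Re (DX (axis a 1) $ a) + (y 1 t - y 0 t) / r\<^sup>2 * Re (cip (DX (axis a 1)) x * x $ a))" for a
        using eq[of "axis a 1"] unfolding cip_axis norm_axis_sq mult_1_right .
      from sum_affine_eq[of _ _ "\<lambda>a. Re (cnj (x $ a) * x $ a)" _ _ _ _ _ "\<lambda>a. Re (cnj (x $ a) * X x $ a)", OF this]
      show ?thesis unfolding s1 s2 s4 div .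
    qed
    from clear_denominators[OF r this]
    have "real n * \<sigma> 0 t + (\<sigma> 1 t - \<sigma> 0 t) =
      l * (real n * y 0 t + (y 1 t - y 0 t))
      + (real n * (y 1 t - y 0 t) * N + (y 2 t - 3 * y 1 t + 2 * y 0 t) * N + (y 1 t - y 0 t) * N)
      + 2 * y 0 t * Re (divergence X x) + (y 1 t - y 0 t) * EE"
      unfolding n_def .
    then show ?thesis by (simp add: algebra_simps)
  qed
  have key: "2 * Re (divergence X x) * y 0 t = y 0 t * EE + (real n - 1) * (\<sigma> 0 t - l * y 0 t - N * (y 1 t - y 0 t))"
    using trace rad by (simp add: algebra_simps)
  have sig: "\<sigma> 0 t * y 1 t = real n * y 1 t - (real n - 1) * (y 1 t)\<^sup>2 / y 0 t - y 2 t"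
    by (rule \<sigma>_eq[OF t])
  have "y 1 t * (2 * Re (divergence X x)) = y 1 t * (\<sigma> 0 t * N + sc t - real n * l)"
  proof (cases "2 \<le> n")
    case True
    have y0p: "0 < y 0 t" by (rule y_pos[OF True t])
    have "y 0 t * (y 1 t * (2 * Re (divergence X x))) = y 1 t * (2 * Re (divergence X x) * y 0 t)" by simp
    also have "\<dots> = y 0 t * (y 1 t * EE) + y 1 t * (real n - 1) * (\<sigma> 0 t - l * y 0 t - N * (y 1 t - y 0 t))"
      unfolding key by (simp add: algebra_simps)
    also have "y 1 t * EE = \<sigma> 1 t - l * y 1 t - N * (y 2 t - y 1 t)" using rad by simp
    also have "y 0 t * (\<sigma> 1 t - l * y 1 t - N * (y 2 t - y 1 t)) = y 0 t * \<sigma> 1 t - l * y 1 t * y 0 t - N * (y 2 t * y 0 t) + N * y 1 t * y 0 t"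
      by (simp add: algebra_simps)
    also have "\<dots> + y 1 t * (real n - 1) * (\<sigma> 0 t - l * y 0 t - N * (y 1 t - y 0 t)) =
       y 0 t * \<sigma> 1 t + (real n - 1) * \<sigma> 0 t * y 1 t + (\<sigma> 0 t * N - real n * l) * y 0 t * y 1 t"
      unfolding y2_eq[OF t True] by (simp add: algebra_simps power2_eq_square)
    also have "\<dots> = y 0 t * (y 1 t * (\<sigma> 0 t * N + sc t - real n * l))"
      unfolding sc_def using y0p y1p by (simp add: field_simps)
    finally show ?thesis using y0p by simp
  next
    \<comment> \<open>Here the trace repeats the radial equation: the divergence is the only entry
      of the differential of \<open>X\<close>, and twice its real part is \<open>EE\<close>.\<close>
    case False
    then have n1: "n = 1" using n by simp
    then have "CARD('n) = 1" by (simp add: n_def)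
    then obtain k :: 'n where k: "UNIV = {k}" using card_1_singletonE by blast
    have xk: "cnj (x $ k) * x $ k = of_real r"
      using cip_self[of x] unfolding cip_def k r_def by (simp add: mult.commute)
    have "cip (DX (axis k 1)) x * x $ k = DX (axis k 1) $ k * of_real r"
      unfolding cip_def k xk[symmetric] by simp
    then have "r * EE / 2 = r * Re (divergence X x)"
      using s4 div unfolding k by (simp add: mult.commute) auto
    then have "2 * Re (divergence X x) = EE" using r by simp
    moreover have "y 1 t * EE = \<sigma> 1 t - l * y 1 t - N * (y 2 t - y 1 t)" using rad by simp
    moreover have "y 2 t = y 1 t - \<sigma> 0 t * y 1 t" using sig n1 by simp
    moreover have "y 1 t * sc t = \<sigma> 1 t" unfolding sc_def using y1p n1 by simp
    moreover have "real n = 1" using n1 by simp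
    ultimately show ?thesis by (simp only: right_diff_distrib distrib_left) (simp add: algebra_simps)
  qed
  then show "2 * Re (divergence X x) = \<sigma> 0 t * N + sc t - real n * l"
    using y1p by simp
qed

end

section \<open>The profile of a soliton\<close>

lemma clin_on_exp_line:
  fixes a :: "complex^'n"
  assumes F: "clin_on S F" shows "(\<lambda>w. F (exp w *s a)) holomorphic_on {w. exp w *s a \<in> S}"
proof (rule holomorphic_onI, rule field_differentiable_at_within)
  fix w assume "w \<in> {w. exp w *s a \<in> S}"
  then have "exp w *s a \<in> S" by simp
  then have "((\<lambda>w. F (exp w *s a)) has_field_derivative frechet_derivative F (at (exp w *s a)) (exp w *s a)) (at w)"
  proof (rule clin_on_curve[where \<gamma> = "\<lambda>w. exp w *s a", OF F])
    show "((\<lambda>w. exp w *s a) has_derivative (\<lambda>h. h *s (exp w *s a))) (at w)"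
      by (auto intro!: derivative_eq_intros simp: vector_smult_assoc mult.commute)
  qed
  then show "(\<lambda>w. F (exp w *s a)) field_differentiable at w" unfolding field_differentiable_def by blast
qed

lemma DERIV_zero_constant_ex:
  fixes f :: "real \<Rightarrow> real"
  assumes "connected J" "open J" "\<And>t. t \<in> J \<Longrightarrow> (f has_real_derivative 0) (at t)"
  shows "\<exists>c. \<forall>t\<in>J. f t = c"
  using DERIV_zero_constant_on[OF assms] by blast

lemma DERIV_affine_arg:
  fixes f :: "real \<Rightarrow> real"
  assumes "(f has_real_derivative D) (at (c + m * x))"
  shows "((\<lambda>x. f (c + m * x)) has_real_derivative m * D) (at x)"
proof -
  have "((\<lambda>x. c + m * x) has_real_derivative m) (at x)" by (auto intro!: derivative_eq_intros)
  from DERIV_chain2[where g = "\<lambda>x. c + m * x", OF assms this] show ?thesis by (simp only: mult.commute)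
qed

text \<open>The second derivative of \<open>c / y\<close> along a curve on which \<open>t\<close>
  moves with speed 2; it vanishes iff \<open>1 / y\<close> is affine to second order.\<close>

lemma DERIV_scaled_quotient_sq:
  fixes F G :: "real \<Rightarrow> real"
  assumes F: "(F has_real_derivative 2 * G x) (at x)" and G: "(G has_real_derivative 2 * k) (at x)" and nz: "F x \<noteq> 0"
  shows "((\<lambda>x. - 2 * c * G x / (F x)\<^sup>2) has_real_derivative - 4 * c * (k * F x - 2 * (G x)\<^sup>2) / F x ^ 3) (at x)"
proof -
  have "((\<lambda>x. - 2 * c * G x / (F x)\<^sup>2) has_real_derivative
     ((- 2 * c * (2 * k)) * (F x)\<^sup>2 - (- 2 * c * G x) * (of_nat 2 * F x ^ (2 - 1) * (2 * G x))) / ((F x)\<^sup>2 * (F x)\<^sup>2)) (at x)"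
    by (intro DERIV_divide DERIV_cmult G)
       (use nz in \<open>auto intro!: derivative_eq_intros F\<close>)
  moreover have "((- 2 * c * (2 * k)) * (F x)\<^sup>2 - (- 2 * c * G x) * (of_nat 2 * F x ^ (2 - 1) * (2 * G x))) / ((F x)\<^sup>2 * (F x)\<^sup>2)
     = - 4 * c * (k * F x - 2 * (G x)\<^sup>2) / F x ^ 3"
    using nz by (simp add: field_simps power2_eq_square power3_eq_cube)
  ultimately show ?thesis by (simp only:)
qed

lemma norm_add_orthogonal:
  assumes "cip v z = 0" shows "(norm (z + w *s v))\<^sup>2 = (norm z)\<^sup>2 + (cmod w)\<^sup>2 * (norm v)\<^sup>2"
proof -
  have "cip z v = 0" using cnj_cip[of v z] assms by simp
  then have "inner z (w *s v) = 0" by (simp add: cip_scale_right flip: Re_cip)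
  then show ?thesis
    by (simp add: power2_norm_eq_inner inner_add_left inner_add_right inner_commute[of "w *s v" z])
       (simp add: norm_vector_smult power_mult_distrib flip: power2_norm_eq_inner)
qed

context radial_geometry
begin

declare One_nat_def [simp del]

lemma clin_divergence: "holo_map_on U X \<Longrightarrow> clin_on U (divergence X)"
  unfolding divergence_def by (intro clin_on_sum clin_on_jacobian U(1))

lemma line_fun_radial_rate:
  assumes "a \<noteq> 0" shows "2 * Re (line_fun X a w) = radial_rate X (exp w *s a)"
  unfolding line_fun_def line_fun_eq[OF assms] radial_rate_def Re_divide_of_real by simp

lemma line_equations:
  assumes X: "holo_map_on U X"
    and sol: "\<And>x v w. x \<in> U \<Longrightarrow> form11 (ric x) v w = of_real l * form11 (h x) v w + lie_form X (\<lambda>x. form11 (h x)) x v w"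
    and a: "a \<noteq> 0" and w: "exp w *s a \<in> U"
  defines "t \<equiv> ln ((norm a)\<^sup>2) + 2 * Re w"
  shows "\<sigma> 1 t = l * y 1 t + 2 * Re (line_fun X a w) * y 2 t + y 1 t * (2 * Re (deriv (line_fun X a) w))"
    and "2 * Re (divergence X (exp w *s a)) = \<sigma> 0 t * (2 * Re (line_fun X a w)) + sc t - real n * l"
proof -
  note e = soliton_equations[OF X w exp_line[OF a] sol[OF w], unfolded ln_norm_exp[OF a], folded t_def line_fun_radial_rate[OF a]]
  show "\<sigma> 1 t = l * y 1 t + 2 * Re (line_fun X a w) * y 2 t + y 1 t * (2 * Re (deriv (line_fun X a) w))"
    using e(1) unfolding DERIV_imp_deriv[OF line_fun_deriv[OF X a w]] .
  show "2 * Re (divergence X (exp w *s a)) = \<sigma> 0 t * (2 * Re (line_fun X a w)) + sc t - real n * l"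
    by (rule e(2))
qed

lemma real_line_in_I:
  assumes a: "a \<noteq> 0" and \<delta>: "ball 0 \<delta> \<subseteq> {w. exp w *s a \<in> U}" and t: "\<bar>t - ln ((norm a)\<^sup>2)\<bar> < 2 * \<delta>"
  defines "x \<equiv> (t - ln ((norm a)\<^sup>2)) / 2"
  shows "complex_of_real x \<in> ball 0 \<delta>" "exp (complex_of_real x) *s a \<in> U" "\<bar>x\<bar> < \<delta>" "t \<in> I"
    "ln ((norm a)\<^sup>2) + 2 * Re (complex_of_real x) = t" "ln ((norm a)\<^sup>2) + 2 * x = t"
proof -
  show x: "\<bar>x\<bar> < \<delta>" using t by (simp add: x_def)
  then show "complex_of_real x \<in> ball 0 \<delta>" by simp
  then show u: "exp (complex_of_real x) *s a \<in> U" using \<delta> by blast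
  show "ln ((norm a)\<^sup>2) + 2 * x = t" by (simp add: x_def field_simps)
  then show e: "ln ((norm a)\<^sup>2) + 2 * Re (complex_of_real x) = t" by simp
  show "t \<in> I"
    using ln_norm_in_I[OF u exp_line[OF a]] unfolding ln_norm_exp[OF a] e .
qed

text \<open>On the curves through \<open>a\<close> and \<open>b\<close> the profile is the same, so the difference of the two soliton equations is
  homogeneous: \<open>Re k\<close> and \<open>\<sigma> Re k\<close> are harmonic, where \<open>k\<close> is the difference of the radial components.\<close>
lemma soliton_nonradial:
  assumes X: "holo_map_on U X"
    and sol: "\<And>x v w. x \<in> U \<Longrightarrow> form11 (ric x) v w = of_real l * form11 (h x) v w + lie_form X (\<lambda>x. form11 (h x)) x v w"
    and ab: "a \<in> U" "b \<in> U" "a \<noteq> 0" "b \<noteq> 0" "norm a = norm b" "radial_rate X a \<noteq> radial_rate X b"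
  obtains J' where "open J'" "connected J'" "J' \<noteq> {}" "J' \<subseteq> I" "affine_profile J'"
proof -
  define t0 where "t0 = ln ((norm a)\<^sup>2)"
  have t0b: "t0 = ln ((norm b)\<^sup>2)" by (simp add: t0_def ab(5))
  define W where "W = {w. exp w *s a \<in> U} \<inter> {w. exp w *s b \<in> U}"
  define k where "k = (\<lambda>w. line_fun X a w - line_fun X b w)"
  have oW: "open W" unfolding W_def by (intro open_Int open_exp_preimage U(1))
  have hk: "line_fun X a holomorphic_on W" "line_fun X b holomorphic_on W"
    by (rule holomorphic_on_subset[OF line_fun_holomorphic[OF X ab(3)]], simp add: W_def)
       (rule holomorphic_on_subset[OF line_fun_holomorphic[OF X ab(4)]], simp add: W_def)
  then have k: "k holomorphic_on W" unfolding k_def by (intro holomorphic_intros)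
  \<comment> \<open>At the centre \<open>Re k\<close> is half the difference of the two rates, which
    is not 0; the disc is shrunk so that it vanishes nowhere.\<close>
  have "open (W \<inter> (\<lambda>w. Re (k w)) -` (- {0}))"
    by (rule continuous_open_preimage[OF _ oW])
       (auto intro!: continuous_intros holomorphic_on_imp_continuous_on[OF k])
  moreover have "0 \<in> W \<inter> (\<lambda>w. Re (k w)) -` (- {0})"
    using ab line_fun_radial_rate[OF ab(3), of X 0] line_fun_radial_rate[OF ab(4), of X 0] by (auto simp: W_def k_def)
  ultimately obtain \<delta> where \<delta>: "\<delta> > 0" "ball 0 \<delta> \<subseteq> W \<inter> (\<lambda>w. Re (k w)) -` (- {0})"
    using open_contains_ball by blast
  have \<delta>W: "ball 0 \<delta> \<subseteq> W" using \<delta>(2) by blast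
  then have \<delta>a: "ball 0 \<delta> \<subseteq> {w. exp w *s a \<in> U}" and \<delta>b: "ball 0 \<delta> \<subseteq> {w. exp w *s b \<in> U}" by (auto simp: W_def)
  define J' where "J' = {t0 - 2 * \<delta> <..< t0 + 2 * \<delta>}"
  have J'D: "\<bar>t - ln ((norm a)\<^sup>2)\<bar> < 2 * \<delta>" if "t \<in> J'" for t
    using that unfolding J'_def t0_def[symmetric] by (simp add: abs_less_iff)
  have tJ: "t0 + 2 * x \<in> J'" if "\<bar>x\<bar> < \<delta>" for x using that by (auto simp: J'_def abs_less_iff)
  note line = real_line_in_I[OF ab(3) \<delta>a J'D]
  have J'I: "J' \<subseteq> I" using line(4) by blast
  have hd: "(\<lambda>w. divergence X (exp w *s a)) holomorphic_on ball 0 \<delta>" "(\<lambda>w. divergence X (exp w *s b)) holomorphic_on ball 0 \<delta>"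
    by (rule holomorphic_on_subset[OF clin_on_exp_line[OF clin_divergence[OF X]]], rule \<delta>a)
       (rule holomorphic_on_subset[OF clin_on_exp_line[OF clin_divergence[OF X]]], rule \<delta>b)
  have hka: "line_fun X a holomorphic_on ball 0 \<delta>" "line_fun X b holomorphic_on ball 0 \<delta>" "k holomorphic_on ball 0 \<delta>"
    using hk k holomorphic_on_subset[OF _ \<delta>W] by auto
  have J'0: "open J'" "connected J'" "J' \<noteq> {}" using \<delta>(1) by (auto simp: J'_def)
    \<comment> \<open>The Laplacian of \<open>\<sigma> * Re k\<close> gives one linear equation for
      \<open>Re k\<close> and \<open>Re (deriv k)\<close>, the difference of the radial equations
      another. As \<open>Re k\<close> is nonzero, their determinant vanishes.\<close>
    have eq1: "\<sigma> 2 t * y 1 t = \<sigma> 1 t * y 2 t" if t: "t \<in> J'" for t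
    proof -
      define x where "x = (t - ln ((norm a)\<^sup>2)) / 2"
      note lx = line[OF t, folded x_def]
      define w where "w = complex_of_real x"
      have wb: "exp w *s a \<in> U" "exp w *s b \<in> U" using \<delta>a \<delta>b lx(1) unfolding w_def by blast+
      have tw: "t0 + 2 * Re w = t" using lx(6) by (simp add: t0_def w_def)
      have der: "deriv k w = deriv (line_fun X a) w - deriv (line_fun X b) w"
        unfolding k_def w_def using lx(1) hka(1,2)
        by (intro deriv_diff) (auto intro: holomorphic_on_imp_differentiable_at[OF _ open_ball])
      have "4 * \<sigma> 2 t * Re (k (of_real x)) + 2 * (2 * \<sigma> 1 (t0 + 2 * x)) * Re (deriv k (of_real x)) = 0"
      proof (rule harmonic_product_translation_invariant[where \<tau> = "\<lambda>x. \<sigma> 0 (t0 + 2 * x)" and ?\<tau>1.0 = "\<lambda>x. 2 * \<sigma> 1 (t0 + 2 * x)"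
            and d = "\<lambda>w. divergence X (exp w *s a) - divergence X (exp w *s b)"])
        show "k holomorphic_on ball 0 \<delta>" by (rule hka(3))
        show "(\<lambda>w. divergence X (exp w *s a) - divergence X (exp w *s b)) holomorphic_on ball 0 \<delta>"
          by (intro holomorphic_intros hd)
        show "Re (divergence X (exp w *s a) - divergence X (exp w *s b)) = \<sigma> 0 (t0 + 2 * Re w) * Re (k w)"
          if w: "w \<in> ball 0 \<delta>" for w
        proof -
          have "exp w *s a \<in> U" "exp w *s b \<in> U" using w \<delta>a \<delta>b by blast+
          from line_equations(2)[OF X sol ab(3) this(1), folded t0_def] line_equations(2)[OF X sol ab(4) this(2), folded t0b]
          show ?thesis by (simp add: k_def algebra_simps)
        qed
        show "((\<lambda>x. \<sigma> 0 (t0 + 2 * x)) has_real_derivative 2 * \<sigma> 1 (t0 + 2 * x)) (at x)" if "\<bar>x\<bar> < \<delta>" for x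
          by (intro DERIV_affine_arg \<sigma> subsetD[OF J'I tJ] that)
        have "((\<lambda>x. 2 * \<sigma> 1 (t0 + 2 * x)) has_real_derivative 2 * (2 * \<sigma> 2 (t0 + 2 * x))) (at x)"
          by (intro DERIV_cmult DERIV_affine_arg \<sigma>1 subsetD[OF J'I tJ] lx(3))
        then show "((\<lambda>x. 2 * \<sigma> 1 (t0 + 2 * x)) has_real_derivative 4 * \<sigma> 2 t) (at x)"
          using lx(6) by (simp add: t0_def)
      qed (rule lx(3))
      then have h1: "\<sigma> 2 t * Re (k w) + \<sigma> 1 t * Re (deriv k w) = 0"
        using lx(6) by (simp add: t0_def w_def)
      have h2: "Re (k w) * y 2 t + y 1 t * Re (deriv k w) = 0"
        using line_equations(1)[OF X sol ab(3) wb(1), folded t0_def, unfolded tw]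
          line_equations(1)[OF X sol ab(4) wb(2), folded t0b, unfolded tw]
        unfolding der by (simp add: k_def algebra_simps)
      have "Re (k w) \<noteq> 0" using \<delta>(2) lx(1) unfolding w_def by blast
      moreover have "Re (k w) * (\<sigma> 2 t * y 1 t - \<sigma> 1 t * y 2 t) = 0"
      proof -
        have "Re (k w) * (\<sigma> 2 t * y 1 t - \<sigma> 1 t * y 2 t) = y 1 t * (\<sigma> 2 t * Re (k w) + \<sigma> 1 t * Re (deriv k w))
           - \<sigma> 1 t * (Re (k w) * y 2 t + y 1 t * Re (deriv k w))" by (simp add: algebra_simps)
        then show ?thesis unfolding h1 h2 by simp
      qed
      ultimately show ?thesis by simp
    qed
    \<comment> \<open>With \<open>\<sigma>\<close> a constant \<open>e\<close>, the second soliton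
      equation along the single curve through \<open>a\<close> exhibits \<open>sc\<close> as the
      real part of a holomorphic function. Depending on \<open>t\<close> alone, it is affine in
      \<open>t\<close>; and here \<open>sc\<close> is a nonzero multiple of
      \<open>1 / y\<close>.\<close>
    have eq2: "y 2 t * y 0 t = 2 * (y 1 t)\<^sup>2"
      if n2: "2 \<le> n" and e: "e \<noteq> 0" "\<And>t. t \<in> J' \<Longrightarrow> \<sigma> 0 t = e" and t: "t \<in> J'" for e t
    proof -
      define x where "x = (t - ln ((norm a)\<^sup>2)) / 2"
      note lx = line[OF t, folded x_def]
      have s1: "\<sigma> 1 s = 0" if s: "s \<in> J'" for s
        by (rule DERIV_eq_on_open[of J' s "\<sigma> 0" "\<lambda>_. e"]) (use s e(2) J'I \<sigma> in \<open>auto simp: J'_def\<close>)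
      define c where "c = (real n - 1) * e"
      have c: "c \<noteq> 0" using e n2 by (simp add: c_def)
      have scJ: "sc s = c / y 0 s" if "s \<in> J'" for s
        using e(2)[OF that] s1[OF that] by (simp add: sc_def c_def)
      have y0: "y 0 s \<noteq> 0" if "s \<in> J'" for s using y_pos[OF n2, of s] J'I that by auto
      have yx: "((\<lambda>x. y 0 (t0 + 2 * x)) has_real_derivative 2 * y 1 (t0 + 2 * x)) (at x)"
        "((\<lambda>x. y 1 (t0 + 2 * x)) has_real_derivative 2 * y 2 (t0 + 2 * x)) (at x)" if "\<bar>x\<bar> < \<delta>" for x
        by (intro DERIV_affine_arg y y1 subsetD[OF J'I tJ] that)+
      define \<tau>1 where "\<tau>1 = (\<lambda>x. - 2 * c * y 1 (t0 + 2 * x) / (y 0 (t0 + 2 * x))\<^sup>2)"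
      define \<tau>2 where "\<tau>2 = - 4 * c * (y 2 t * y 0 t - 2 * (y 1 t)\<^sup>2) / (y 0 t) ^ 3"
      have "\<tau>2 * Re ((\<lambda>_. 1) (of_real x)) + 2 * \<tau>1 x * Re (deriv (\<lambda>_. 1) (complex_of_real x)) = 0"
      proof (rule harmonic_product_translation_invariant[where \<tau> = "\<lambda>x. c / y 0 (t0 + 2 * x)"
            and d = "\<lambda>w. 2 * divergence X (exp w *s a) - of_real (2 * e) * line_fun X a w + of_real (real n * l)"])
        show "(\<lambda>w. 2 * divergence X (exp w *s a) - of_real (2 * e) * line_fun X a w + of_real (real n * l)) holomorphic_on ball 0 \<delta>"
          by (intro holomorphic_intros hd hka)
        show "Re (2 * divergence X (exp w *s a) - of_real (2 * e) * line_fun X a w + of_real (real n * l)) = c / y 0 (t0 + 2 * Re w) * Re 1"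
          if w: "w \<in> ball 0 \<delta>" for w
        proof -
          have "\<bar>Re w\<bar> < \<delta>" using w abs_Re_le_cmod[of w] by simp
          from tJ[OF this] have tw: "t0 + 2 * Re w \<in> J'" .
          have "exp w *s a \<in> U" using w \<delta>a by blast
          from line_equations(2)[OF X sol ab(3) this, folded t0_def]
          show ?thesis unfolding scJ[OF tw] e(2)[OF tw] by simp
        qed
        show "((\<lambda>x. c / y 0 (t0 + 2 * x)) has_real_derivative \<tau>1 x) (at x)" if "\<bar>x\<bar> < \<delta>" for x
          unfolding \<tau>1_def using y0[OF tJ[OF that]]
          by (auto intro!: derivative_eq_intros yx[OF that] simp: power2_eq_square)
        have "(\<tau>1 has_real_derivative - 4 * c * (y 2 (t0 + 2 * x) * y 0 (t0 + 2 * x) - 2 * (y 1 (t0 + 2 * x))\<^sup>2) / (y 0 (t0 + 2 * x)) ^ 3) (at x)"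
          unfolding \<tau>1_def by (rule DERIV_scaled_quotient_sq[OF yx[OF lx(3)] y0[OF tJ[OF lx(3)]]])
        then show "(\<tau>1 has_real_derivative \<tau>2) (at x)" unfolding \<tau>2_def using lx(6) by (simp add: t0_def)
      qed (use lx(3) in auto)
      then have "\<tau>2 = 0" by simp
      then show ?thesis using c y0[OF t] by (simp add: \<tau>2_def)
    qed
  have "affine_profile J'"
    by (rule affine_profileI[OF J'0 J'I eq1 eq2])
  with J'0 J'I show ?thesis by (rule that)
qed

text \<open>Here \<open>Re (line_fun X x0 w)\<close> is harmonic and depends on \<open>Re w\<close> only, hence is affine in \<open>t\<close>.  For \<open>n \<ge> 2\<close> the
  divergence of \<open>X\<close> has radial real part, which must be constant.\<close>
lemma soliton_radial:
  assumes X: "holo_map_on U X"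
    and sol: "\<And>x v w. x \<in> U \<Longrightarrow> form11 (ric x) v w = of_real l * form11 (h x) v w + lie_form X (\<lambda>x. form11 (h x)) x v w"
    and B: "open B" "B \<subseteq> U - {0}" "x0 \<in> B"
    and rad: "\<And>a b. a \<in> B \<Longrightarrow> b \<in> B \<Longrightarrow> norm a = norm b \<Longrightarrow> radial_rate X a = radial_rate X b"
  obtains J' where "open J'" "connected J'" "J' \<noteq> {}" "J' \<subseteq> I" "affine_profile J' \<or> soliton_profile J'"
proof -
  have x0: "x0 \<in> U" "x0 \<noteq> 0" using B by auto
  define t0 where "t0 = ln ((norm x0)\<^sup>2)"
  define lf where "lf = line_fun X x0"
  have "0 \<in> {w. exp w *s x0 \<in> B}" using B(3) by simp
  then obtain \<delta> where \<delta>: "\<delta> > 0" "ball 0 \<delta> \<subseteq> {w. exp w *s x0 \<in> B}"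
    using open_exp_preimage[OF B(1), of x0] open_contains_ball by blast
  have \<delta>U: "ball 0 \<delta> \<subseteq> {w. exp w *s x0 \<in> U}" using \<delta>(2) B(2) by blast
  have hol: "lf holomorphic_on ball 0 \<delta>"
    unfolding lf_def by (rule holomorphic_on_subset[OF line_fun_holomorphic[OF X x0(2)] \<delta>U])
  define J' where "J' = {t0 - 2 * \<delta> <..< t0 + 2 * \<delta>}"
  have J'D: "\<bar>t - ln ((norm x0)\<^sup>2)\<bar> < 2 * \<delta>" if "t \<in> J'" for t
    using that unfolding J'_def t0_def[symmetric] by (simp add: abs_less_iff)
  have J'0: "open J'" "connected J'" "J' \<noteq> {}" using \<delta>(1) by (auto simp: J'_def)
  note line = real_line_in_I[OF x0(2) \<delta>U J'D, folded t0_def]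
  have J'I: "J' \<subseteq> I" using line(4) by blast
  have lf_Re: "Re (lf w) = Re (lf (of_real (Re w)))" if w: "w \<in> ball 0 \<delta>" for w
  proof -
    have "\<bar>Re w\<bar> < \<delta>" using w abs_Re_le_cmod[of w] by simp
    then have "complex_of_real (Re w) \<in> ball 0 \<delta>" by simp
    then have "exp w *s x0 \<in> B" "exp (complex_of_real (Re w)) *s x0 \<in> B" using w \<delta>(2) by blast+
    moreover have "norm (exp w *s x0) = norm (exp (complex_of_real (Re w)) *s x0)"
      by (simp add: norm_vector_smult)
    ultimately have "radial_rate X (exp w *s x0) = radial_rate X (exp (complex_of_real (Re w)) *s x0)" by (rule rad)
    then show ?thesis unfolding line_fun_radial_rate[OF x0(2), symmetric] lf_def by simp
  qed
  have hol2: "deriv lf holomorphic_on ball 0 \<delta>" by (rule holomorphic_deriv[OF hol open_ball])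
  have D: "(lf has_field_derivative deriv lf (of_real x)) (at (of_real x))"
    "(deriv lf has_field_derivative deriv (deriv lf) (of_real x)) (at (of_real x))" if "\<bar>x\<bar> < \<delta>" for x
    by (rule holomorphic_derivI[OF hol open_ball], use that in simp)
       (rule holomorphic_derivI[OF hol2 open_ball], use that in simp)
  have "Re (deriv (deriv lf) (of_real x)) = 0" if x: "\<bar>x\<bar> < \<delta>" for x
  proof -
    have "Re (deriv (deriv lf) (of_real x)) * Re ((\<lambda>_. 1) (complex_of_real x))
      + 2 * Re (deriv lf (of_real x)) * Re (deriv (\<lambda>_. 1) (complex_of_real x)) = 0"
    proof (rule harmonic_product_translation_invariant[where \<tau> = "\<lambda>x. Re (lf (of_real x))" and d = lf])
      show "Re (lf w) = Re (lf (complex_of_real (Re w))) * Re 1" if "w \<in> ball 0 \<delta>" for w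
        using lf_Re[OF that] by simp
      show "((\<lambda>x. Re (lf (complex_of_real x))) has_real_derivative Re (deriv lf (of_real x))) (at x)" if "\<bar>x\<bar> < \<delta>" for x
        by (rule has_real_derivative_Re[OF D(1)[OF that]])
      show "((\<lambda>x. Re (deriv lf (complex_of_real x))) has_real_derivative Re (deriv (deriv lf) (of_real x))) (at x)"
        by (rule has_real_derivative_Re[OF D(2)[OF x]])
    qed (use hol x in auto)
    then show ?thesis by simp
  qed
  then have D2: "((\<lambda>x. Re (deriv lf (of_real x))) has_real_derivative 0) (at x)" if "x \<in> {-\<delta><..<\<delta>}" for x
    using has_real_derivative_Re[OF D(2), of x] that by (simp add: abs_less_iff)
  obtain \<kappa> where "\<And>x. x \<in> {-\<delta><..<\<delta>} \<Longrightarrow> Re (deriv lf (of_real x)) = \<kappa>"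
    using DERIV_zero_constant_ex[OF connected_Ioo open_greaterThanLessThan D2] by blast
  then have \<kappa>: "Re (deriv lf (of_real x)) = \<kappa>" if "\<bar>x\<bar> < \<delta>" for x using that by (simp add: abs_less_iff)
  have D3: "((\<lambda>x. Re (lf (of_real x)) - \<kappa> * x) has_real_derivative 0) (at x)" if "x \<in> {-\<delta><..<\<delta>}" for x
  proof -
    have x: "\<bar>x\<bar> < \<delta>" using that by (simp add: abs_less_iff)
    have "((\<lambda>x. Re (lf (of_real x))) has_real_derivative \<kappa>) (at x)"
      using has_real_derivative_Re[OF D(1)[OF x]] unfolding \<kappa>[OF x] .
    from DERIV_diff[OF this DERIV_cmult[OF DERIV_ident, of \<kappa>]] show ?thesis by (rule DERIV_cong) simp
  qed
  from DERIV_zero_constant_ex[OF connected_Ioo open_greaterThanLessThan D3]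
  obtain c where c0: "\<forall>x\<in>{-\<delta><..<\<delta>}. Re (lf (of_real x)) - \<kappa> * x = c" ..
  have c: "Re (lf (of_real x)) = \<kappa> * x + c" if "\<bar>x\<bar> < \<delta>" for x
    using bspec[OF c0, of x] that by (simp only: greaterThanLessThan_iff) linarith
  \<comment> \<open>Rewrites \<open>2 * (\<kappa> * x + c)\<close> with
    \<open>x = (t - t0) / 2\<close> in terms of \<open>t\<close>.\<close>
  define b where "b = 2 * c - \<kappa> * t0"
  have L: "2 * Re (lf (complex_of_real ((t - t0) / 2))) = \<kappa> * t + b" if "t \<in> J'" for t
    unfolding c[OF line(3)[OF that]] b_def by (simp add: field_simps)
  have eq1: "\<sigma> 1 t = l * y 1 t + (\<kappa> * t + b) * y 2 t + 2 * \<kappa> * y 1 t" if t: "t \<in> J'" for t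
    using line_equations(1)[OF X sol x0(2) line(2)[OF t], folded t0_def lf_def]
    unfolding line(5)[OF t] L[OF t] \<kappa>[OF line(3)[OF t]] by simp
  define m where "m = (\<lambda>t. \<sigma> 0 t * (\<kappa> * t + b) + sc t - real n * l)"
  have div: "2 * Re (divergence X z) = m (ln ((norm z)\<^sup>2))" if z: "z \<in> B" "ln ((norm z)\<^sup>2) \<in> J'" for z
  proof -
    define t where "t = ln ((norm z)\<^sup>2)"
    have t: "t \<in> J'" using z by (simp add: t_def)
    have zU: "z \<in> U" "z \<noteq> 0" using z B(2) by auto
    define z' where "z' = exp (complex_of_real ((t - t0) / 2)) *s x0"
    have z'B: "z' \<in> B" using line(1)[OF t] \<delta>(2) unfolding z'_def by blast
    have "ln ((norm z')\<^sup>2) = t"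
      unfolding z'_def ln_norm_exp[OF x0(2)] t0_def[symmetric] using line(5)[OF t] by simp
    moreover have "0 < (norm z')\<^sup>2" "0 < (norm z)\<^sup>2" using z'B B(2) zU by auto
    ultimately have "(norm z')\<^sup>2 = (norm z)\<^sup>2" unfolding t_def by simp
    then have "norm z = norm z'" by simp
    from rad[OF z(1) z'B this] have "radial_rate X z = \<kappa> * t + b"
      unfolding z'_def line_fun_radial_rate[OF x0(2), symmetric] lf_def[symmetric] L[OF t] .
    moreover have "2 * Re (divergence X z) = \<sigma> 0 t * (2 * Re (line_fun X z 0)) + sc t - real n * l"
      using line_equations(2)[OF X sol zU(2), of 0] zU by (simp add: t_def)
    moreover have "2 * Re (line_fun X z 0) = radial_rate X z" using line_fun_radial_rate[OF zU(2), of X 0] by simp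
    ultimately show ?thesis by (simp add: m_def t_def)
  qed
  have "\<exists>m0. \<forall>t\<in>J'. m t = m0" if n2: "2 \<le> n"
  proof -
    have m0: "(m has_real_derivative 0) (at t)" if t: "t \<in> J'" for t
    proof -
      have tI: "t \<in> I" using t J'I by blast
      obtain D where "(sc has_real_derivative D) (at t)" using sc_differentiable[OF tI] .
      then have "(m has_real_derivative \<sigma> 1 t * (\<kappa> * t + b) + \<sigma> 0 t * \<kappa> + D) (at t)"
        unfolding m_def by (auto intro!: derivative_eq_intros \<sigma> tI)
      then obtain m' where m': "(m has_real_derivative m') (at t)" by blast
      define z where "z = exp (complex_of_real ((t - t0) / 2)) *s x0"
      have zB: "z \<in> B" using line(1)[OF t] \<delta>(2) unfolding z_def by blast
      have zt: "ln ((norm z)\<^sup>2) = t"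
        unfolding z_def ln_norm_exp[OF x0(2)] t0_def[symmetric] using line(5)[OF t] by simp
      have zU: "z \<in> U" "z \<noteq> 0" using zB B(2) by auto
      \<comment> \<open>Along the complex line through \<open>z\<close> in a direction orthogonal to
        \<open>z\<close>, the norm depends only on \<open>|w|\<close>. There the divergence has a
        real part that is constant on circles, hence constant.\<close>
      obtain v where v: "v \<noteq> 0" "cip v z = 0" using orthogonal_vector n2 unfolding n_def by blast
      define V where "V = B \<inter> (\<lambda>z. ln ((norm z)\<^sup>2)) -` J'"
      have V: "open V" "z \<in> V" "V \<subseteq> U"
      proof -
        show "open V" unfolding V_def
          by (rule continuous_open_preimage[OF _ B(1) J'0(1)]) (use B(2) in \<open>auto intro!: continuous_intros\<close>)
      qed (use zB zt t B(2) in \<open>auto simp: V_def\<close>)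
      have "0 \<in> {w. z + w *s v \<in> V}" using V(2) by simp
      then obtain \<rho> where \<rho>: "\<rho> > 0" "ball 0 \<rho> \<subseteq> {w. z + w *s v \<in> V}"
        using open_line_preimage[OF V(1), of z v] open_contains_ball by blast
      define d where "d = (\<lambda>w. divergence X (z + w *s v))"
      have d: "d holomorphic_on ball 0 \<rho>"
        unfolding d_def
        by (rule holomorphic_on_subset[OF holomorphic_on_clin_line[OF clin_divergence[OF X]]]) (use \<rho>(2) V(3) in blast)
      define q where "q = (norm v)\<^sup>2 / (norm z)\<^sup>2"
      have q: "q > 0" using v zU by (simp add: q_def)
      have ln: "ln ((norm (z + w *s v))\<^sup>2) = ln ((norm z)\<^sup>2 + (cmod w)\<^sup>2 * (norm v)\<^sup>2)" for w
        unfolding norm_add_orthogonal[OF v(2)] ..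
      have dm: "2 * Re (d w) = m (ln ((norm z)\<^sup>2 + (cmod w)\<^sup>2 * (norm v)\<^sup>2))" if "w \<in> ball 0 \<rho>" for w
      proof -
        have "z + w *s v \<in> V" using \<rho>(2) that by blast
        then show ?thesis unfolding d_def ln[symmetric] by (intro div) (auto simp: V_def)
      qed
      have const: "m (ln ((norm z)\<^sup>2 + u * (norm v)\<^sup>2)) = m t" if u: "0 < u" "u < \<rho>\<^sup>2" for u
      proof -
        define w where "w = complex_of_real (sqrt u)"
        have cw: "(cmod w)\<^sup>2 = u" using u by (simp add: w_def)
        have "cmod w < \<rho>" using u \<rho>(1) by (simp add: w_def real_less_lsqrt)
        then have w: "w \<in> ball 0 \<rho>" by simp
        have "Re (d w) = Re (d 0)"
        proof (rule radial_real_part_constant[OF d _ w])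
          fix w1 w2 :: complex assume w1: "w1 \<in> ball 0 \<rho>" and e: "cmod w1 = cmod w2"
          then have "w2 \<in> ball 0 \<rho>" by simp
          from dm[OF w1] dm[OF this] e show "Re (d w1) = Re (d w2)" by simp
        qed
        then show ?thesis using dm[OF w] dm[of 0] \<rho>(1) cw zt by simp
      qed
      define G where "G = (\<lambda>u. m (ln ((norm z)\<^sup>2 + u * (norm v)\<^sup>2)))"
      have G0: "G 0 = m t" using zt by (simp add: G_def)
      have "((\<lambda>u. ln ((norm z)\<^sup>2 + u * (norm v)\<^sup>2)) has_real_derivative q) (at 0)"
        using zU by (auto intro!: derivative_eq_intros simp: q_def)
      then have G: "(G has_real_derivative m' * q) (at 0)"
        unfolding G_def by (rule DERIV_chain2[rotated]) (use m' zt in simp)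
      \<comment> \<open>On the line the norm can only grow, so \<open>m\<close> is seen to be
        constant on one side of \<open>t\<close> only; since the derivative is already known to
        exist, this determines it.\<close>
      have "m' * q = 0"
      proof (rule ccontr)
        assume "m' * q \<noteq> 0"
        then have "\<exists>e>0. \<forall>u>0. u < e \<longrightarrow> G 0 \<noteq> G (0 + u)"
        proof (cases "m' * q > 0")
          case True
          from DERIV_pos_inc_right[OF G True] show ?thesis by (metis less_irrefl)
        next
          case False
          with \<open>m' * q \<noteq> 0\<close> have "m' * q < 0" by linarith
          from DERIV_neg_dec_right[OF G this] show ?thesis by (metis less_irrefl)
        qed
        then obtain e where e: "e > 0" "\<And>u. 0 < u \<Longrightarrow> u < e \<Longrightarrow> G 0 \<noteq> G u" by auto
        define u where "u = min e (\<rho>\<^sup>2) / 2"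
        have u: "0 < u" "u < e" "u < \<rho>\<^sup>2" using e(1) \<rho>(1) by (auto simp: u_def min_def)
        have "G u = m t" using const[OF u(1,3)] by (simp only: G_def)
        with e(2)[OF u(1,2)] G0 show False by simp
      qed
      then have "m' = 0" using q by simp
      then show ?thesis using m' by simp
    qed
    show ?thesis by (rule DERIV_zero_constant_ex[OF J'0(2,1) m0])
  qed
  then obtain m0 where m0: "\<And>t. 2 \<le> n \<Longrightarrow> t \<in> J' \<Longrightarrow> m t = m0" by blast
  have "affine_profile J' \<or> soliton_profile J'"
    by (rule soliton_profile_cases[OF J'0 J'I eq1, of m0]) (use m0 in \<open>auto simp: m_def\<close>)
  with J'0 J'I show ?thesis by (rule that)
qed

lemma soliton_profile_exists:
  assumes X: "holo_map_on U X"
    and sol: "\<And>x v w. x \<in> U \<Longrightarrow> form11 (ric x) v w = of_real l * form11 (h x) v w + lie_form X (\<lambda>x. form11 (h x)) x v w"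
  obtains J' where "open J'" "connected J'" "J' \<noteq> {}" "J' \<subseteq> I" "affine_profile J' \<or> soliton_profile J'"
proof (cases "\<exists>a\<in>U - {0}. \<exists>b\<in>U - {0}. norm a = norm b \<and> radial_rate X a \<noteq> radial_rate X b")
  case True
  then obtain a b where ab: "a \<in> U" "b \<in> U" "a \<noteq> 0" "b \<noteq> 0" "norm a = norm b" "radial_rate X a \<noteq> radial_rate X b" by blast
  obtain J' where "open J'" "connected J'" "J' \<noteq> {}" "J' \<subseteq> I" "affine_profile J'"
    by (rule soliton_nonradial[OF X sol ab])
  then show ?thesis by (intro that[of J'] disjI1)
next
  case False
  obtain x0 where "x0 \<in> U - {0}" using I_open_connected(3) unfolding I_def by blast
  have rad: "radial_rate X a = radial_rate X b" if "a \<in> U - {0}" "b \<in> U - {0}" "norm a = norm b" for a b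
    using False that by blast
  obtain J' where "open J'" "connected J'" "J' \<noteq> {}" "J' \<subseteq> I" "affine_profile J' \<or> soliton_profile J'"
    by (rule soliton_radial[OF X sol nz_open(1) subset_refl \<open>x0 \<in> U - {0}\<close> rad])
  then show ?thesis by (rule that[of J'])
qed

end

section \<open>Charts\<close>

lemma form11_scaleR: "form11 (l *\<^sub>R h) v w = of_real l * form11 h v w"
  unfolding form11_def scaleR_matrix_nth by (simp add: sum_distrib_left mult_ac)

lemma det_const_poly: "det (\<chi> i j. [:A $ i $ j:] :: complex poly^'n^'n) = [:det A:]"
proof -
  have p: "(\<Prod>i\<in>S. [:f i:]) = [:\<Prod>i\<in>S. f i:]" for S :: "'n set" and f :: "'n \<Rightarrow> complex"
    by (induction S rule: infinite_finite_induct) (simp_all add: one_pCons)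
  have s: "(\<Sum>i\<in>S. [:f i:]) = [:\<Sum>i\<in>S. f i:]" for S :: "('n \<Rightarrow> 'n) set" and f :: "('n \<Rightarrow> 'n) \<Rightarrow> complex"
    by (induction S rule: infinite_finite_induct) simp_all
  have "of_int (sign q) * [:c:] = [:of_int (sign q) * c :: complex:]" for q :: "'n \<Rightarrow> 'n" and c
    by (simp add: of_int_poly)
  then show ?thesis unfolding det_def by (simp add: p s)
qed

text \<open>Both matrices are multiplied by the same constant matrices, so the determinant of the
  pencil and that of the metric acquire the same factor \<open>|det J|^2\<close>, which
  cancels.\<close>

lemma coeff_pencil_pullback:
  fixes a b a' b' :: "complex^'n^'n" and D :: "complex^'n \<Rightarrow> complex^'n"
  assumes D: "Vector_Spaces.linear (*s) (*s) D"
    and a: "\<And>v w. sesq a' v w = sesq a (D v) (D w)" and b: "\<And>v w. sesq b' v w = sesq b (D v) (D w)"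
    and nz: "det a' \<noteq> 0"
  shows "coeff (det (\<chi> i j. [: a' $ i $ j, b' $ i $ j :])) k / det a' = coeff (det (\<chi> i j. [: a $ i $ j, b $ i $ j :])) k / det a"
proof -
  define J :: "complex^'n^'n" where "J = (\<chi> k j. D (axis j 1) $ k)"
  define Jc :: "complex^'n^'n" where "Jc = (\<chi> i j. cnj (J $ i $ j))"
  have pull: "h' = transpose J ** h ** Jc" if "\<And>v w. sesq h' v w = sesq h (D v) (D w)" for h h'
  proof -
    have "h' = (\<chi> i j. \<Sum>k\<in>UNIV. (\<Sum>l\<in>UNIV. h $ l $ k * D (axis i 1) $ l) * cnj (D (axis j 1) $ k))"
      by (rule sesq_eq_imp_matrix_eq) (simp only: that sesq_pullback[OF D])
    also have "\<dots> = transpose J ** h ** Jc"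
      by (simp add: matrix_matrix_mult_def transpose_def vec_eq_iff mult.commute J_def Jc_def)
    finally show ?thesis .
  qed
  have det: "det h' = det J * cnj (det J) * det h" if "h' = transpose J ** h ** Jc" for h h'
    unfolding that by (simp add: det_mul Jc_def det_cnj)
  \<comment> \<open>Constant matrices are embedded into polynomial ones, so that multiplicativity of
    the determinant is applied over the polynomial ring.\<close>
  define P :: "complex^'n^'n \<Rightarrow> complex poly^'n^'n" where "P = (\<lambda>A. \<chi> i j. [:A $ i $ j:])"
  define Q :: "complex^'n^'n \<Rightarrow> complex^'n^'n \<Rightarrow> complex poly^'n^'n" where "Q = (\<lambda>A B. \<chi> i j. [:A $ i $ j, B $ i $ j:])"
  have Q: "Q A B = P A + (\<chi> i j. [:0, 1:] * P B $ i $ j)" for A B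
    by (simp add: P_def Q_def vec_eq_iff)
  have Pm: "P (A ** B) = P A ** P B" for A B
  proof -
    have "(\<Sum>i\<in>S. [:f i :: complex:]) = [:\<Sum>i\<in>S. f i:]" for S :: "'n set" and f
      by (induction S rule: infinite_finite_induct) simp_all
    from this[symmetric] show ?thesis by (simp add: P_def vec_eq_iff matrix_matrix_mult_def mult.commute)
  qed
  have "Q a' b' = P (transpose J) ** Q a b ** P Jc"
    unfolding Q pull[OF a] pull[OF b] Pm
    by (simp add: vec_eq_iff matrix_matrix_mult_def sum.distrib sum_distrib_left distrib_left distrib_right mult_ac)
  then have "det (Q a' b') = [:det J:] * det (Q a b) * [:cnj (det J):]"
    by (simp only: det_mul P_def det_const_poly) (simp add: Jc_def det_cnj)
  then have "det (Q a' b') = smult (det J * cnj (det J)) (det (Q a b))" by (simp add: mult.commute)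
  then have "coeff (det (Q a' b')) k = det J * cnj (det J) * coeff (det (Q a b)) k" by simp
  moreover have "det J * cnj (det J) \<noteq> 0" using nz unfolding det[OF pull[OF a]] by auto
  ultimately have "coeff (det (Q a' b')) k / det a' = coeff (det (Q a b)) k / det a"
    unfolding det[OF pull[OF a]] by simp
  then show ?thesis unfolding Q_def .
qed

section \<open>Tensors in the charts of the maximal atlas\<close>

locale manifold_atlas =
  fixes M :: "'m topology" and A :: "('m, 'n::finite) chart set"
  assumes manifold: "complex_manifold M A"
begin

lemma chart_props:
  assumes "c \<in> charts M A"
  shows "openin M (fst c)" "open (cimage c)" "inj_on (snd c) (fst c)"
    "\<And>T. openin M T \<Longrightarrow> T \<subseteq> fst c \<Longrightarrow> open (snd c ` T)"
proof -
  have ch: "is_chart M c" using assms by (simp add: charts_def)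
  then show o: "openin M (fst c)" "open (cimage c)" by (auto simp: is_chart_def)
  have hm: "homeomorphic_map (subtopology M (fst c)) (top_of_set (cimage c)) (snd c)"
    using ch by (simp add: is_chart_def)
  have sub: "fst c \<subseteq> topspace M" using o(1) by (rule openin_subset)
  then have ts: "topspace (subtopology M (fst c)) = fst c" by auto
  show "inj_on (snd c) (fst c)" using homeomorphic_imp_injective_map[OF hm] unfolding ts .
  show "open (snd c ` T)" if T: "openin M T" "T \<subseteq> fst c" for T
  proof -
    have "openin (subtopology M (fst c)) T"
      using T o(1) by (simp add: openin_open_subtopology)
    then have "openin (top_of_set (cimage c)) (snd c ` T)"
      using homeomorphic_imp_open_map[OF hm] unfolding open_map_def by blast
    then show ?thesis using openin_open_eq[OF o(2)] by blast
  qed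
qed

lemma atlas_subset: "A \<subseteq> charts M A"
  using manifold by (auto simp: complex_manifold_def charts_def)

lemma ex_chart: "p \<in> topspace M \<Longrightarrow> \<exists>c. c \<in> charts M A \<and> p \<in> fst c"
  using manifold atlas_subset unfolding complex_manifold_def by blast

lemma transition_apply:
  assumes "c \<in> charts M A" "p \<in> fst c" shows "transition c d (snd c p) = snd d p"
  using inv_into_f_f[OF chart_props(3)[OF assms(1)] assms(2)] by (simp add: transition_def)

text \<open>Charts of the maximal atlas are compatible with those of \<open>A\<close> by definition,
  with each other only through a detour: near each point the transition factors through a chart
  \<open>e\<close> of \<open>A\<close>.\<close>

lemma transition_holo:
  assumes c: "c \<in> charts M A" and d: "d \<in> charts M A"
  shows "holo_map_on (snd c ` (fst c \<inter> fst d)) (transition c d)"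
  unfolding holo_map_on_def
proof
  fix x assume "x \<in> snd c ` (fst c \<inter> fst d)"
  then obtain p where p: "p \<in> fst c" "p \<in> fst d" "x = snd c p" by auto
  then have "p \<in> topspace M" using chart_props(1)[OF c] openin_subset by blast
  then obtain e where e: "e \<in> A" "p \<in> fst e" using manifold unfolding complex_manifold_def by blast
  have e': "e \<in> charts M A" using e atlas_subset by blast
  define V where "V = snd c ` (fst c \<inter> fst d \<inter> fst e)"
  have V: "open V" "x \<in> V"
    unfolding V_def using p e
    by (auto intro!: chart_props(4)[OF c] openin_Int chart_props(1) c d e')
  have h1: "holo_map_on (snd c ` (fst c \<inter> fst e)) (transition c e)"
    using c e by (auto simp: charts_def compatible_def)
  have h2: "holo_map_on (snd e ` (fst d \<inter> fst e)) (transition e d)"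
    using d e by (auto simp: charts_def compatible_def)
  obtain D1 where D1: "(transition c e has_derivative D1) (at x)" "Vector_Spaces.linear (*s) (*s) D1"
    using h1 p e unfolding holo_map_on_def by blast
  have te: "transition c e x = snd e p" unfolding p(3) by (rule transition_apply[OF c p(1)])
  obtain D2 where D2: "(transition e d has_derivative D2) (at (transition c e x))" "Vector_Spaces.linear (*s) (*s) D2"
    using h2 p e unfolding holo_map_on_def te by blast
  have "((\<lambda>y. transition e d (transition c e y)) has_derivative (\<lambda>v. D2 (D1 v))) (at x)"
    using diff_chain_at[OF D1(1) D2(1)] by (simp add: o_def)
  then have "(transition c d has_derivative (\<lambda>v. D2 (D1 v))) (at x)"
  proof (rule has_derivative_transform_within_open[OF _ V])
    fix y assume "y \<in> V"
    then obtain q where q: "q \<in> fst c" "q \<in> fst d" "q \<in> fst e" "y = snd c q" by (auto simp: V_def)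
    show "transition e d (transition c e y) = transition c d y"
      unfolding q(4) transition_apply[OF c q(1)] transition_apply[OF e' q(3)] ..
  qed
  moreover have "Vector_Spaces.linear (*s) (*s) (\<lambda>v. D2 (D1 v))"
    using Vector_Spaces.linear_compose[OF D1(2) D2(2)] by (simp add: o_def)
  ultimately show "\<exists>D. (transition c d has_derivative D) (at x) \<and> Vector_Spaces.linear (*s) (*s) D" by blast
qed

lemma kaehler_det_pos:
  assumes "kaehler_metric M A g" "c \<in> charts M A" "x \<in> cimage c"
  shows "0 < Re (det (g c x))"
  by (rule det_pos_def(1); use assms in \<open>unfold kaehler_metric_def, blast\<close>)

lemma kaehler_pullback:
  assumes "kaehler_metric M A g" "c \<in> charts M A" "d \<in> charts M A" "x \<in> snd c ` (fst c \<inter> fst d)"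
  shows "sesq (g c x) v w = sesq (g d (transition c d x))
          (frechet_derivative (transition c d) (at x) v)
          (frechet_derivative (transition c d) (at x) w)"
  using assms unfolding kaehler_metric_def by blast

lemma ricci_pullback:
  assumes g: "kaehler_metric M A g" and c: "c \<in> charts M A" and d: "d \<in> charts M A"
    and x: "x \<in> snd c ` (fst c \<inter> fst d)"
  shows "sesq (ricci g c x) v w = sesq (ricci g d (transition c d x))
          (frechet_derivative (transition c d) (at x) v)
          (frechet_derivative (transition c d) (at x) w)"
proof -
  have sm: "smooth_on (cimage e) (\<lambda>x. g e x $ i $ j)" if "e \<in> charts M A" for e i j
    using g that unfolding kaehler_metric_def by blast
  let ?V = "snd c ` (fst c \<inter> fst d)"
  have sub: "?V \<subseteq> cimage c" unfolding cimage_def by (rule image_mono) simp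
  have V: "open ?V"
    by (rule chart_props(4)[OF c]) (simp_all add: openin_Int chart_props(1)[OF c] chart_props(1)[OF d])
  have im: "transition c d ` ?V \<subseteq> cimage d"
  proof
    fix z assume "z \<in> transition c d ` ?V"
    then obtain p where p: "p \<in> fst c" "p \<in> fst d" "z = transition c d (snd c p)" by auto
    show "z \<in> cimage d" unfolding p(3) transition_apply[OF c p(1)] cimage_def using p(2) by simp
  qed
  have pos: "0 < Re (det (g c y))" if "y \<in> ?V" for y
    by (rule kaehler_det_pos[OF g c]) (rule subsetD[OF sub that])
  have neg: "sesq (- h) v w = - sesq h v w" for h :: "complex^'n^'n" and v w
    by (simp add: sesq_def sum_negf)
  have "sesq (ddbar (\<lambda>y. complex_of_real (ln (Re (det (g c y))))) x) v w =
     sesq (ddbar (\<lambda>y. complex_of_real (ln (Re (det (g d y))))) (transition c d x))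
       (frechet_derivative (transition c d) (at x) v) (frechet_derivative (transition c d) (at x) w)"
  proof (rule ddbar_ln_det_transform[where h = "g d" and h' = "g c" and T = "transition c d" and V = ?V and W = "cimage d"])
    show "sesq (g c y) v w = sesq (g d (transition c d y)) (frechet_derivative (transition c d) (at y) v)
        (frechet_derivative (transition c d) (at y) w)" if "y \<in> ?V" for y v w
      by (rule kaehler_pullback[OF g c d that])
    show "smooth_on (cimage d) (\<lambda>y. g d y $ i $ j)" for i j by (rule sm[OF d])
    show "smooth_on ?V (\<lambda>y. g c y $ i $ j)" for i j by (rule smooth_on_subset[OF sm[OF c] sub])
    show "0 < Re (det (g d y))" if "y \<in> cimage d" for y by (rule kaehler_det_pos[OF g d that])
    show "0 < Re (det (g c y))" if "y \<in> ?V" for y by (rule pos[OF that])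
  qed (rule V, rule chart_props(2)[OF d], rule transition_holo[OF c d], rule im, rule x)
  then show ?thesis by (simp only: ricci_def neg)
qed

lemma gen_scal_loc_invariant:
  assumes g: "kaehler_metric M A g" and c: "c \<in> charts M A" and d: "d \<in> charts M A"
    and p: "p \<in> fst c" "p \<in> fst d"
  shows "gen_scal_loc g k c (snd c p) = gen_scal_loc g k d (snd d p)"
proof -
  have x: "snd c p \<in> snd c ` (fst c \<inter> fst d)" using p by blast
  have "snd c p \<in> cimage c" using p by (simp add: cimage_def)
  from kaehler_det_pos[OF g c this] have nz: "det (g c (snd c p)) \<noteq> 0" by auto
  have "coeff (det (\<chi> i j. [: g c (snd c p) $ i $ j, ricci g c (snd c p) $ i $ j :])) k / det (g c (snd c p)) =
     coeff (det (\<chi> i j. [: g d (transition c d (snd c p)) $ i $ j, ricci g d (transition c d (snd c p)) $ i $ j :])) k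
       / det (g d (transition c d (snd c p)))"
    by (rule coeff_pencil_pullback[OF holo_map_onD(2)[OF transition_holo[OF c d] x]])
       (rule kaehler_pullback[OF g c d x], rule ricci_pullback[OF g c d x], rule nz)
  then show ?thesis unfolding gen_scal_loc_def transition_apply[OF c p(1)] .
qed

text \<open>By chart invariance the arbitrary choice in \<open>gen_scal\<close> is harmless.\<close>

lemma gen_scal_eq:
  assumes g: "kaehler_metric M A g" and c: "c \<in> charts M A" and p: "p \<in> fst c"
  shows "gen_scal M A g k p = Re (gen_scal_loc g k c (snd c p))"
proof -
  define c' where "c' = (SOME c. c \<in> charts M A \<and> p \<in> fst c)"
  have "c' \<in> charts M A \<and> p \<in> fst c'" unfolding c'_def by (rule someI[of "\<lambda>c. c \<in> charts M A \<and> p \<in> fst c", OF conjI[OF c p]])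
  then have "gen_scal_loc g k c' (snd c' p) = gen_scal_loc g k c (snd c p)"
    by (intro gen_scal_loc_invariant[OF g _ c _ p]) simp_all
  then show ?thesis unfolding gen_scal_def c'_def[symmetric] by (simp only: Let_def)
qed

lemma KE_ricci:
  assumes "g \<in> KE M A"
  obtains l where "\<forall>c\<in>charts M A. \<forall>x\<in>cimage c. ricci g c x = l *\<^sub>R g c x"
proof -
  from assms have "\<exists>l::real. \<forall>c\<in>charts M A. \<forall>x\<in>cimage c. \<forall>v w.
      ricci_form g c x v w = complex_of_real l * kaehler_form g c x v w"
    unfolding KE_def by (rule CollectE) (rule conjunct2)
  then obtain l where l: "\<forall>c\<in>charts M A. \<forall>x\<in>cimage c. \<forall>v w.
      ricci_form g c x v w = complex_of_real l * kaehler_form g c x v w" by (rule exE)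
  have "ricci g c x = l *\<^sub>R g c x" if "c \<in> charts M A" "x \<in> cimage c" for c x
  proof (rule form11_eq_imp_eq)
    fix v w show "form11 (ricci g c x) v w = form11 (l *\<^sub>R g c x) v w"
      using bspec[OF bspec[OF l that(1)] that(2), rule_format, of v w]
      unfolding ricci_form_def kaehler_form_def form11_scaleR .
  qed
  then show ?thesis by (intro that[of l] ballI)
qed

text \<open>For \<open>Ric = l * g\<close> the determinant of the pencil is
  \<open>(1 + l * s) ^ n * det g\<close>, so every coefficient is a universal constant.\<close>

lemma KE_gen_scal:
  assumes "g \<in> KE M A"
  obtains a where "\<forall>p\<in>topspace M. gen_scal M A g k p = a"
proof -
  have g: "kaehler_metric M A g" using assms by (simp add: KE_def)
  obtain l where l: "\<forall>c\<in>charts M A. \<forall>x\<in>cimage c. ricci g c x = l *\<^sub>R g c x"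
    by (rule KE_ricci[OF assms])
  have "gen_scal M A g k p = Re (coeff ([:1, of_real l:] ^ CARD('n)) k)" if p: "p \<in> topspace M" for p
  proof -
    obtain c where c: "c \<in> charts M A" "p \<in> fst c" using ex_chart[OF p] by blast
    define x where "x = snd c p"
    have x: "x \<in> cimage c" using c by (simp add: cimage_def x_def)
    have nz: "det (g c x) \<noteq> 0" using kaehler_det_pos[OF g c(1) x] by auto
    have "(\<chi> i j. [: g c x $ i $ j, ricci g c x $ i $ j :]) = (\<chi> i. [:1, of_real l:] *s (\<chi> j. [:g c x $ i $ j:]))"
      unfolding bspec[OF bspec[OF l c(1)] x] by (simp only: vec_eq_iff scaleR_matrix_nth) (simp add: mult.commute)
    then have "det (\<chi> i j. [: g c x $ i $ j, ricci g c x $ i $ j :]) = [:1, of_real l:] ^ CARD('n) * [:det (g c x):]"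
      by (simp only: det_rows_mul det_const_poly prod_constant)
    then have "gen_scal_loc g k c x = coeff ([:1, of_real l:] ^ CARD('n)) k"
      unfolding gen_scal_loc_def using nz by simp
    then show ?thesis using gen_scal_eq[OF g c] by (simp add: x_def)
  qed
  then show ?thesis by (intro that ballI)
qed

text \<open>The zero field is the witness that makes Einstein metrics extremal, their scalar
  curvature being constant, and solitons.\<close>

lemma vector_field_zero: "vector_field M A (\<lambda>c x. 0)"
  unfolding vector_field_def
proof (intro ballI)
  fix c d x assume "c \<in> charts M A" "d \<in> charts M A" "x \<in> snd c ` (fst c \<inter> fst d)"
  then have "linear (frechet_derivative (transition c d) (at x))"
    using holo_map_onD(1)[OF transition_holo] has_derivative_linear by blast
  then show "0 = frechet_derivative (transition c d) (at x) 0" by (simp add: linear_0)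
qed

lemma holomorphic_field_zero: "holomorphic_field M A (\<lambda>c x. 0)"
proof -
  have "Vector_Spaces.linear (*s) (*s) (\<lambda>v::complex^'n. 0::complex^'n)"
    by (rule vec.linear_zero)
  then have "holo_map_on S (\<lambda>x. 0 :: complex^'n)" for S :: "(complex^'n) set"
    unfolding holo_map_on_def by (intro ballI exI conjI) (rule has_derivative_const)
  then show ?thesis unfolding holomorphic_field_def by (simp add: vector_field_zero)
qed

lemma form11_zero: "form11 h 0 w = 0" "form11 h v 0 = 0"
  by (simp_all add: form11_def)

lemma KE_subset_ConstScal: "KE M A \<subseteq> ConstScal M A k"
proof
  fix g assume g: "g \<in> KE M A"
  obtain a where "\<forall>p\<in>topspace M. gen_scal M A g k p = a" by (rule KE_gen_scal[OF g])
  then have "\<exists>a. \<forall>p\<in>topspace M. gen_scal M A g k p = a" by (rule exI)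
  with g show "g \<in> ConstScal M A k" by (simp only: ConstScal_def KE_def mem_Collect_eq simp_thms)
qed

lemma KE_subset_Extremal: "KE M A \<subseteq> Extremal M A"
proof
  fix g assume g: "g \<in> KE M A"
  obtain a where a: "\<forall>p\<in>topspace M. scal M A g p = a" by (rule KE_gen_scal[OF g])
  have "hamiltonian_field M A g (scal M A g) (\<lambda>c x. 0)"
    unfolding hamiltonian_field_def
  proof (intro conjI ballI allI vector_field_zero)
    fix c x v assume c: "c \<in> charts M A" and x: "x \<in> cimage c"
    have "((scal M A g \<circ> inv_into (fst c) (snd c)) has_derivative (\<lambda>v. 0)) (at x)"
    proof (rule has_derivative_transform_within_open[OF has_derivative_const chart_props(2)[OF c] x])
      fix y assume "y \<in> cimage c"
      then have "inv_into (fst c) (snd c) y \<in> fst c" unfolding cimage_def by (rule inv_into_into)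
      then have "inv_into (fst c) (snd c) y \<in> topspace M"
        using chart_props(1)[OF c] openin_subset by blast
      from bspec[OF a this] show "a = (scal M A g \<circ> inv_into (fst c) (snd c)) y" by (simp only: o_apply)
    qed
    from fun_cong[OF frechet_derivative_at[OF this], of v, symmetric]
    show "kaehler_form g c x 0 v = complex_of_real (frechet_derivative (scal M A g \<circ> inv_into (fst c) (snd c)) (at x) v)"
      by (simp only: kaehler_form_def form11_zero of_real_0)
  qed
  then have "\<exists>X. hamiltonian_field M A g (scal M A g) X \<and> holomorphic_field M A X"
    using holomorphic_field_zero by (intro exI conjI)
  moreover have "kaehler_metric M A g" using g by (simp add: KE_def)
  ultimately show "g \<in> Extremal M A" unfolding Extremal_def by simp
qed

lemma KE_subset_KRS: "KE M A \<subseteq> KRS M A"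
proof
  fix g assume g: "g \<in> KE M A"
  then have k: "kaehler_metric M A g" by (simp add: KE_def)
  have lie: "lie_form (\<lambda>x. 0) (kaehler_form g c) x v w = 0" if c: "c \<in> charts M A" and x: "x \<in> cimage c" for c x v w
  proof -
    have sm: "smooth_on (cimage c) (\<lambda>y. g c y $ i $ j)" for i j
      using k c unfolding kaehler_metric_def by blast
    have "smooth_on (cimage c) (\<lambda>y. form11 (g c y) v w)"
      unfolding form11_def
      by (intro smooth_on_mult[OF chart_props(2)[OF c]] smooth_on_sum[OF chart_props(2)[OF c]] smooth_on_const sm)
    from linear_0[OF has_derivative_linear[OF smooth_on_has_derivative[OF this x]]]
    show ?thesis
      by (simp only: lie_form_def kaehler_form_def form11_zero frechet_derivative_const add_0_right)
  qed
  obtain l where l: "\<forall>c\<in>charts M A. \<forall>x\<in>cimage c. ricci g c x = l *\<^sub>R g c x"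
    by (rule KE_ricci[OF g])
  have "ricci_form g c x v w = complex_of_real l * kaehler_form g c x v w
        + lie_form (\<lambda>x. 0) (kaehler_form g c) x v w" if "c \<in> charts M A" "x \<in> cimage c" for c x v w
    by (simp only: ricci_form_def bspec[OF bspec[OF l that(1)] that(2)] form11_scaleR lie[OF that] kaehler_form_def add_0_right)
  then have "kaehler_ricci_soliton M A g (\<lambda>c x. 0)"
    unfolding kaehler_ricci_soliton_def
    by (intro conjI k holomorphic_field_zero exI[of _ l] ballI allI)
  then show "g \<in> KRS M A" unfolding KRS_def by (intro CollectI exI)
qed

end

section \<open>Radial metrics on the manifold\<close>

locale radial_metric =
  manifold_atlas M A + radial_geometry "cimage c\<^sub>0" "g c\<^sub>0" f J
  for M :: "'m topology" and A :: "('m, 'n::finite) chart set" and g :: "('m, 'n) herm_tensor"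
    and c\<^sub>0 f J +
  assumes g: "kaehler_metric M A g" and c\<^sub>0: "c\<^sub>0 \<in> charts M A" "fst c\<^sub>0 = topspace M"
begin

lemma ric_eq_ricci: "ric x = ricci g c\<^sub>0 x"
  unfolding ric_def ricci_def ..

lemma gen_scal_chart:
  assumes "x \<in> cimage c\<^sub>0"
  shows "gen_scal M A g k (inv_into (fst c\<^sub>0) (snd c\<^sub>0) x) = Re (gen_scal_loc g k c\<^sub>0 x)"
proof -
  have x: "x \<in> snd c\<^sub>0 ` fst c\<^sub>0" using assms unfolding cimage_def .
  show ?thesis
    using gen_scal_eq[OF g c\<^sub>0(1) inv_into_into[OF x]] unfolding f_inv_into_f[OF x] .
qed

text \<open>The global coordinates cover \<open>M\<close>, so the equation proved there is pulled
  back to all other charts.\<close>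

lemma KE_if_einstein:
  assumes "\<exists>l. einstein l" shows "g \<in> KE M A"
proof -
  obtain l where l: "einstein l" using assms by (rule exE)
  have ric: "ricci g c\<^sub>0 x = l *\<^sub>R g c\<^sub>0 x" if "x \<in> cimage c\<^sub>0" for x
    using einstein_imp_ric[OF l that] unfolding ric_eq_ricci .
  have sesq_scaleR: "sesq (l *\<^sub>R h) v w = of_real l * sesq h v w" for h :: "complex^'n^'n" and v w
    unfolding sesq_def scaleR_matrix_nth by (simp add: sum_distrib_left mult.assoc)
  have "ricci_form g c x v w = complex_of_real l * kaehler_form g c x v w"
    if c: "c \<in> charts M A" and x: "x \<in> cimage c" for c x v w
  proof -
    have "fst c \<subseteq> topspace M" by (rule openin_subset[OF chart_props(1)[OF c]])
    then have "fst c \<inter> fst c\<^sub>0 = fst c" unfolding c\<^sub>0(2) by (rule Int_absorb2)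
    then have x': "x \<in> snd c ` (fst c \<inter> fst c\<^sub>0)" using x by (simp only: cimage_def)
    then obtain p where p: "p \<in> fst c" "p \<in> fst c\<^sub>0" "x = snd c p" by auto
    have y: "transition c c\<^sub>0 x \<in> cimage c\<^sub>0"
      unfolding p(3) transition_apply[OF c p(1)] cimage_def using p(2) by (rule imageI)
    have "sesq (ricci g c x) v w = of_real l * sesq (g c x) v w" for v w
      unfolding ricci_pullback[OF g c c\<^sub>0(1) x'] kaehler_pullback[OF g c c\<^sub>0(1) x'] ric[OF y] sesq_scaleR ..
    then show ?thesis
      unfolding ricci_form_def kaehler_form_def form11_sesq by (simp add: algebra_simps)
  qed
  then have "\<exists>l::real. \<forall>c\<in>charts M A. \<forall>x\<in>cimage c. \<forall>v w.
      ricci_form g c x v w = complex_of_real l * kaehler_form g c x v w"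
    by (intro exI[of _ l] ballI allI)
  with g show ?thesis by (simp only: KE_def mem_Collect_eq simp_thms)
qed

lemma ConstScal_profile:
  assumes "g \<in> ConstScal M A k" and k: "1 \<le> k" "k \<le> n"
  shows "\<exists>c d. \<forall>t\<in>I. \<sigma> 0 t ^ k * y 0 t ^ (n - k) = c * y 0 t ^ n + d"
proof -
  obtain a where a: "\<forall>p\<in>topspace M. gen_scal M A g k p = a"
    using assms(1) unfolding ConstScal_def by blast
  have const: "Re (coeff (det (\<chi> i j. [: g c\<^sub>0 x $ i $ j, ric x $ i $ j :])) k / det (g c\<^sub>0 x)) = a" if x: "x \<in> cimage c\<^sub>0" for x
  proof -
    have "inv_into (fst c\<^sub>0) (snd c\<^sub>0) x \<in> topspace M"
      using inv_into_into[OF x[unfolded cimage_def]] unfolding c\<^sub>0(2) .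
    from bspec[OF a this] show ?thesis
      unfolding gen_scal_chart[OF x] gen_scal_loc_def ric_eq_ricci .
  qed
  show ?thesis by (rule constant_curvature_profile[OF k const], assumption) (intro exI ballI)
qed

lemma Extremal_profile:
  assumes "g \<in> Extremal M A"
  shows "\<exists>\<alpha> \<beta>. \<forall>t\<in>I. sc t = \<alpha> * y 0 t + \<beta>"
proof -
  obtain X where X: "hamiltonian_field M A g (scal M A g) X" "holomorphic_field M A X"
    using assms unfolding Extremal_def by blast
  have holo: "holo_map_on (cimage c\<^sub>0) (X c\<^sub>0)"
    using X(2) c\<^sub>0(1) unfolding holomorphic_field_def by blast
  have ham: "form11 (g c\<^sub>0 x) (X c\<^sub>0 x) v =
      of_real (frechet_derivative (scal M A g \<circ> inv_into (fst c\<^sub>0) (snd c\<^sub>0)) (at x) v)"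
    if "x \<in> cimage c\<^sub>0" for x v
    using X(1) c\<^sub>0(1) that unfolding hamiltonian_field_def kaehler_form_def by blast
  have u: "(scal M A g \<circ> inv_into (fst c\<^sub>0) (snd c\<^sub>0)) x = sc (ln ((norm x)\<^sup>2))"
    if "x \<in> cimage c\<^sub>0" "x \<noteq> 0" for x
    using scalar_curvature_coeff[OF that]
    unfolding o_apply gen_scal_chart[OF that(1)] gen_scal_loc_def ric_eq_ricci by (simp only: Re_complex_of_real)
  show ?thesis by (rule extremal_profile[OF holo ham u], assumption, assumption, assumption) (intro exI ballI)
qed

lemma KRS_profile:
  assumes "g \<in> KRS M A"
  obtains J' where "open J'" "connected J'" "J' \<noteq> {}" "J' \<subseteq> I" "affine_profile J' \<or> soliton_profile J'"
proof -
  obtain X where "kaehler_ricci_soliton M A g X" using assms unfolding KRS_def by blast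
  then obtain l :: real where X: "holomorphic_field M A X" and l: "\<forall>c\<in>charts M A. \<forall>x\<in>cimage c. \<forall>v w.
        ricci_form g c x v w = complex_of_real l * kaehler_form g c x v w + lie_form (X c) (kaehler_form g c) x v w"
    unfolding kaehler_ricci_soliton_def by blast
  have X: "holo_map_on (cimage c\<^sub>0) (X c\<^sub>0)"
    using X c\<^sub>0(1) unfolding holomorphic_field_def by blast
  have form: "kaehler_form g c\<^sub>0 = (\<lambda>x. form11 (g c\<^sub>0 x))" unfolding kaehler_form_def ..
  have sol: "form11 (ric x) v w = of_real l * form11 (g c\<^sub>0 x) v w + lie_form (X c\<^sub>0) (\<lambda>x. form11 (g c\<^sub>0 x)) x v w"
    if "x \<in> cimage c\<^sub>0" for x v w
    using bspec[OF bspec[OF l c\<^sub>0(1)] that, rule_format, of v w] unfolding ricci_form_def form ric_eq_ricci .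
  show ?thesis by (rule soliton_profile_exists[OF X sol]) (assumption, erule (4) that)
qed

lemma KE_if_Extremal_KRS:
  assumes "g \<in> Extremal M A" "g \<in> KRS M A" shows "g \<in> KE M A"
proof -
  obtain a b where e: "\<forall>t\<in>I. sc t = a * y 0 t + b"
    using Extremal_profile[OF assms(1)] by (elim exE)
  obtain J' where J': "open J'" "connected J'" "J' \<noteq> {}" "J' \<subseteq> I" "affine_profile J' \<or> soliton_profile J'"
    using KRS_profile[OF assms(2)] .
  show ?thesis
    by (rule KE_if_einstein, rule einstein_of_extremal_soliton[OF bspec[OF e] J'])
qed

lemma KE_if_ConstScal_ConstScal:
  assumes "1 \<le> k" "k < h" "h \<le> CARD('n)" "g \<in> ConstScal M A k" "g \<in> ConstScal M A h"
  shows "g \<in> KE M A"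
proof -
  have kh: "k \<le> n" "1 \<le> h" "h \<le> n" using assms(1-3) unfolding n_def by simp_all
  obtain c d where c: "\<forall>t\<in>I. \<sigma> 0 t ^ k * y 0 t ^ (n - k) = c * y 0 t ^ n + d"
    using ConstScal_profile[OF assms(4,1) kh(1)] by (elim exE)
  obtain c' d' where c': "\<forall>t\<in>I. \<sigma> 0 t ^ h * y 0 t ^ (n - h) = c' * y 0 t ^ n + d'"
    using ConstScal_profile[OF assms(5) kh(2,3)] by (elim exE)
  show ?thesis
    by (rule KE_if_einstein, rule einstein_of_constant_curvatures[OF assms(1,2) kh(3) bspec[OF c] bspec[OF c']])
qed

lemma KE_if_ConstScal_Extremal:
  assumes "1 < k" "k \<le> CARD('n)" "g \<in> ConstScal M A k" "g \<in> Extremal M A"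
  shows "g \<in> KE M A"
proof -
  have k: "1 \<le> k" "k \<le> n" using assms(1,2) unfolding n_def by simp_all
  obtain c d where c: "\<forall>t\<in>I. \<sigma> 0 t ^ k * y 0 t ^ (n - k) = c * y 0 t ^ n + d"
    using ConstScal_profile[OF assms(3) k] by (elim exE)
  obtain a b where e: "\<forall>t\<in>I. sc t = a * y 0 t + b"
    using Extremal_profile[OF assms(4)] by (elim exE)
  show ?thesis
    by (rule KE_if_einstein, rule einstein_of_extremal_constant_curvature[OF assms(1) k(2) bspec[OF c] bspec[OF e]])
qed

lemma KE_if_ConstScal_KRS:
  assumes "1 \<le> k" "k \<le> CARD('n)" "g \<in> ConstScal M A k" "g \<in> KRS M A"
  shows "g \<in> KE M A"
proof -
  have k: "k \<le> n" using assms(2) unfolding n_def .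
  obtain c d where c: "\<forall>t\<in>I. \<sigma> 0 t ^ k * y 0 t ^ (n - k) = c * y 0 t ^ n + d"
    using ConstScal_profile[OF assms(3,1) k] by (elim exE)
  obtain J' where J': "open J'" "connected J'" "J' \<noteq> {}" "J' \<subseteq> I" "affine_profile J' \<or> soliton_profile J'"
    using KRS_profile[OF assms(4)] .
  show ?thesis
    by (rule KE_if_einstein, rule einstein_of_soliton_constant_curvature[OF assms(1) k bspec[OF c] J'])
qed

end

text \<open>\<open>connected_space\<close> admits the empty space, which
  \<open>radial_geometry\<close> excludes; on it the Einstein condition is vacuous.\<close>

lemma (in manifold_atlas) Radial_imp_KE_or_radial_metric:
  assumes "g \<in> Radial M A"
  shows "g \<in> KE M A \<or> (\<exists>c\<^sub>0 f J. radial_metric M A g c\<^sub>0 f J)"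
proof (cases "topspace M = {}")
  case True
  have g: "kaehler_metric M A g" using assms by (simp add: Radial_def)
  have "cimage c = {}" if "c \<in> charts M A" for c
    using openin_subset[OF chart_props(1)[OF that]] True by (simp add: cimage_def)
  with g show ?thesis by (simp add: KE_def)
next
  case False
  obtain z and f :: "real \<Rightarrow> real" and rinf rsup where z: "(topspace M, z) \<in> charts M A"
      and f: "smooth_on (einterval rinf rsup) f"
      and dom: "\<forall>p\<in>topspace M. (norm (z p))\<^sup>2 \<in> einterval rinf rsup \<or> (z p = 0 \<and> rinf = 0)"
      and pot: "\<forall>x\<in>z ` topspace M. \<forall>v w. kaehler_form g (topspace M, z) x v w =
           form11 (ddbar (\<lambda>y. complex_of_real (f ((norm y)\<^sup>2))) x) v w"
      and g: "kaehler_metric M A g" and conn: "connected_space M"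
    using assms unfolding Radial_def by blast
  define c\<^sub>0 where "c\<^sub>0 = (topspace M, z)"
  have c\<^sub>0: "c\<^sub>0 \<in> charts M A" "fst c\<^sub>0 = topspace M" "snd c\<^sub>0 = z" using z by (simp_all add: c\<^sub>0_def)
  have im: "cimage c\<^sub>0 = z ` topspace M" unfolding cimage_def c\<^sub>0(2,3) ..
  have "is_chart M c\<^sub>0" using c\<^sub>0(1) by (simp add: charts_def)
  then have "homeomorphic_map M (top_of_set (cimage c\<^sub>0)) z"
    by (simp only: is_chart_def c\<^sub>0(2,3) subtopology_topspace)
  then have "M homeomorphic_space top_of_set (cimage c\<^sub>0)" by (rule homeomorphic_map_imp_homeomorphic_space)
  from homeomorphic_connected_space[OF this] conn have "connectedin euclidean (cimage c\<^sub>0)"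
    by (simp add: connectedin_def)
  then have conn': "connected (cimage c\<^sub>0)" by (simp only: connectedin_iff_connected)
  have "radial_geometry (cimage c\<^sub>0) (g c\<^sub>0) f (einterval rinf rsup)"
  proof
    show "open (cimage c\<^sub>0)" by (rule chart_props(2)[OF c\<^sub>0(1)])
    show "connected (cimage c\<^sub>0)" by (rule conn')
    show "cimage c\<^sub>0 \<noteq> {}" using False unfolding im by simp
    show "open (einterval rinf rsup)" by (rule open_einterval)
    show "smooth_on (einterval rinf rsup) f" by (rule f)
    show "(norm x)\<^sup>2 \<in> einterval rinf rsup" if x: "x \<in> cimage c\<^sub>0" "x \<noteq> 0" for x
    proof -
      obtain p where "p \<in> topspace M" "x = z p" using x(1) unfolding im by blast
      with bspec[OF dom, of p] x(2) show ?thesis by simp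
    qed
    show "g c\<^sub>0 x = ddbar (\<lambda>y. complex_of_real (f ((norm y)\<^sup>2))) x" if x: "x \<in> cimage c\<^sub>0" for x
    proof (rule form11_eq_imp_eq)
      fix v w show "form11 (g c\<^sub>0 x) v w = form11 (ddbar (\<lambda>y. complex_of_real (f ((norm y)\<^sup>2))) x) v w"
        using bspec[OF pot x[unfolded im], rule_format, of v w] unfolding kaehler_form_def c\<^sub>0_def .
    qed
    show "g c\<^sub>0 x $ j $ i = cnj (g c\<^sub>0 x $ i $ j)" if "x \<in> cimage c\<^sub>0" for x i j
      using g c\<^sub>0(1) that unfolding kaehler_metric_def by blast
    show "0 < Re (sesq (g c\<^sub>0 x) v v)" if "x \<in> cimage c\<^sub>0" "v \<noteq> 0" for x v
      using g c\<^sub>0(1) that unfolding kaehler_metric_def by blast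
    show "smooth_on (cimage c\<^sub>0) (\<lambda>x. g c\<^sub>0 x $ i $ j)" for i j
      using g c\<^sub>0(1) unfolding kaehler_metric_def by blast
  qed
  then have "radial_metric M A g c\<^sub>0 f (einterval rinf rsup)"
    unfolding radial_metric_def radial_metric_axioms_def
    by (intro conjI manifold_atlas_axioms g c\<^sub>0(1,2))
  then show ?thesis by (intro disjI2 exI)
qed

theorem theorem1p1:
  fixes M :: "'m topology" and A :: "('m, 'n::finite) chart set"
  assumes "complex_manifold M A" and "connected_space M"
  shows "Extremal M A \<inter> KRS M A \<inter> Radial M A = KE M A \<inter> Radial M A
    \<and> (\<forall>h k. 1 \<le> h \<and> h \<le> CARD('n) \<and> 1 \<le> k \<and> k \<le> CARD('n) \<and> h \<noteq> k \<longrightarrow>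
         ConstScal M A k \<inter> ConstScal M A h \<inter> Radial M A = KE M A \<inter> Radial M A)
    \<and> (\<forall>k. 1 < k \<and> k \<le> CARD('n) \<longrightarrow>
         ConstScal M A k \<inter> Extremal M A \<inter> Radial M A = KE M A \<inter> Radial M A)
    \<and> (\<forall>k. 1 \<le> k \<and> k \<le> CARD('n) \<longrightarrow>
         ConstScal M A k \<inter> KRS M A \<inter> Radial M A = KE M A \<inter> Radial M A)"
proof -
  interpret manifold_atlas M A by (rule manifold_atlas.intro) (rule assms(1))
  \<comment> \<open>The common pattern of the four claims: Einstein metrics satisfy both conditions,
    and conversely for metrics covered by the locale.\<close>
  have *: "P \<inter> Q \<inter> Radial M A = KE M A \<inter> Radial M A"
    if "KE M A \<subseteq> P" "KE M A \<subseteq> Q"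
      "\<And>g c\<^sub>0 f J. radial_metric M A g c\<^sub>0 f J \<Longrightarrow> g \<in> P \<Longrightarrow> g \<in> Q \<Longrightarrow> g \<in> KE M A" for P Q
    using that Radial_imp_KE_or_radial_metric by blast
  have "Extremal M A \<inter> KRS M A \<inter> Radial M A = KE M A \<inter> Radial M A"
    by (rule *[OF KE_subset_Extremal KE_subset_KRS radial_metric.KE_if_Extremal_KRS])
  moreover have "ConstScal M A k \<inter> ConstScal M A h \<inter> Radial M A = KE M A \<inter> Radial M A"
    if hk: "1 \<le> h \<and> h \<le> CARD('n) \<and> 1 \<le> k \<and> k \<le> CARD('n) \<and> h \<noteq> k" for h k
  proof (rule *[OF KE_subset_ConstScal KE_subset_ConstScal])
    fix g c\<^sub>0 f J assume r: "radial_metric M A g c\<^sub>0 f J" and C: "g \<in> ConstScal M A k" "g \<in> ConstScal M A h"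
    consider "k < h" | "h < k" using hk by linarith
    then show "g \<in> KE M A"
    proof cases
      case 1
      show ?thesis by (rule radial_metric.KE_if_ConstScal_ConstScal[OF r _ 1 _ C]) (simp_all only: hk)
    next
      case 2
      show ?thesis by (rule radial_metric.KE_if_ConstScal_ConstScal[OF r _ 2 _ C(2,1)]) (simp_all only: hk)
    qed
  qed
  moreover have "ConstScal M A k \<inter> Extremal M A \<inter> Radial M A = KE M A \<inter> Radial M A"
    if "1 < k \<and> k \<le> CARD('n)" for k
    by (rule *[OF KE_subset_ConstScal KE_subset_Extremal
          radial_metric.KE_if_ConstScal_Extremal[OF _ conjunct1[OF that] conjunct2[OF that]]])
  moreover have "ConstScal M A k \<inter> KRS M A \<inter> Radial M A = KE M A \<inter> Radial M A"
    if "1 \<le> k \<and> k \<le> CARD('n)" for k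
    by (rule *[OF KE_subset_ConstScal KE_subset_KRS
          radial_metric.KE_if_ConstScal_KRS[OF _ conjunct1[OF that] conjunct2[OF that]]])
  ultimately show ?thesis by (intro conjI allI impI)
qed

end
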